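(* Let $P(z),q(z)\in\mathbb{C}[z]$, $q\neq 0$, $a,b\in\mathbb{C}$, $a\neq b$, and let $Q(z)=\int q(z)\,dz$. Suppose that $P(a)=P(b)=c_1$ and that all points of the preimage $P^{-1}(c_1)$, except possibly $a$ and $b$, are not critical points of $P$. Then the following two conditions are equivalent: (i) $\int_a^b P^i(z)q(z)\,dz=0$ for all integers $i\ge 0$; (ii) there exist polynomials $\tilde P,\tilde Q,W\in\mathbb{C}[z]$ such that $P(z)=\tilde P(W(z))$, $Q(z)=\tilde Q(W(z))$ and $W(a)=W(b)$.
   Context: $Q$ denotes any antiderivative of $q$ (condition (ii) does not depend on the choice of constant). *)

theory Defs
  imports "HOL-Complex_Analysis.Complex_Analysis" "HOL-Computational_Algebra.Polynomial"
begin

end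

theory Submission
  imports Defs "HOL-Computational_Algebra.Fundamental_Theorem_Algebra"
begin

text \<open>
  We argue by induction on the degree of \<open>P\<close>. Vanishing moments say that near infinity the sum over the
  fibre \<open>P z = t\<close> of \<open>Q z * log ((z - b) / (z - a))\<close>, corrected by a polynomial in \<open>z\<close>, is zero.
  Continue this identity to \<open>c\<^sub>1\<close> and turn around \<open>c\<^sub>1\<close> often enough to restore all branches: the
  logarithms change, and what remains is that the mean of \<open>Q\<close> over the branches tending to \<open>a\<close> equals
  the mean over those tending to \<open>b\<close>. This holds under every further continuation.

  If \<open>Q\<close> takes the same values on two branches, then \<open>P\<close> and \<open>Q\<close> are polynomials in some \<open>W\<close> of
  degree at least 2; either \<open>W a = W b\<close>, or the induction hypothesis applies to the outer factors and the
  points \<open>W a\<close>, \<open>W b\<close>. Otherwise the Gram matrix of the values of \<open>Q\<close> on the branches, averaged over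
  the monodromy group, is a symmetric invariant kernel that separates branches and annihilates the
  difference \<open>v\<close> of the two means. Applied to the branches themselves it gives a constant, because it gives
  a polynomial of degree at most 1 with equal values at \<open>a\<close> and \<open>b\<close>. Let \<open>C\<close> be the set of branches that
  tend to \<open>a\<close> or \<open>b\<close>. The monodromy around \<open>c\<^sub>1\<close> moves no others, so a branch outside \<open>C\<close> has the same
  kernel value with all members of \<open>C\<close>. A minimal subset of \<open>C\<close> with this property and at least two
  elements is a block of size at least 3, hence comes from a right factor \<open>W\<close> of \<open>P\<close>. If no block meets both
  kinds of branches, \<open>W\<close> is up to constants a power of \<open>z - a\<close> and also of \<open>z - b\<close>. If one does, \<open>W\<close>
  is up to constants a product of powers of \<open>z - a\<close> and \<open>z - b\<close>, and has one further critical
  point, which is simple; a loop around its value swaps two branches, which the kernel then cannot separate.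
\<close>

section \<open>Local coordinates on the fibres of a polynomial\<close>

text \<open>The identity near infinity comes from the integral of Q P' / (P - t) from
  \<open>a\<close> to \<open>b\<close>. Integration by parts turns the given moments into those of Q
  P' P^k, so the integral is 0 for large t; partial fractions over the fibre produce the logarithms,
  and the divided difference of Q produces the polynomial correction. The obstacle is that this
  compares only two means and says nothing about single branches. The kernel makes it rigid: an
  equivariant function of the branches with linear growth is a polynomial of degree at most 1 in the
  branch, and orthogonality to \<open>v\<close> removes its slope. Constancy then rules out
  homogeneous pairs, because the difference of the two kernel rows would have only two nonzero
  entries; this is why blocks have size at least 3. The hypothesis on critical points makes the turn
  around \<open>c\<^sub>1\<close> fix every branch outside \<open>C\<close>, and it is inherited by
  the outer factor of P, as the induction requires.\<close>

lemma degree_minus_const: "degree (p - [:c:]) = degree p"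
  for p :: "complex poly"
proof (cases "degree p = 0")
  case True
  then show ?thesis using degree_diff_le[of p 0 "[:c:]"] by simp
next
  case False
  then show ?thesis
    by (metis degree_add_eq_left degree_minus degree_pCons_0 diff_conv_add_uminus neq0_conv)
qed

lemma holomorphic_isCont: "f holomorphic_on S \<Longrightarrow> open S \<Longrightarrow> z \<in> S \<Longrightarrow> isCont f z"
  using holomorphic_on_imp_continuous_on continuous_on_eq_continuous_at by blast

lemma isCont_filterlim_nhds: "isCont f z \<Longrightarrow> filterlim f (nhds (f z)) (nhds z)"
  by (simp add: isCont_def tendsto_at_iff_tendsto_nhds)

lemma holomorphic_zero_near:
  fixes F :: "complex \<Rightarrow> complex"
  assumes "F holomorphic_on S" "open S" "connected S" "t \<in> S"
    and "\<forall>\<^sub>F s in nhds t. F s = 0" and "s \<in> S"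
  shows "F s = 0"
proof -
  obtain N where N: "open N" "t \<in> N" "\<And>s. s \<in> N \<Longrightarrow> F s = 0"
    using assms(5) unfolding eventually_nhds by blast
  show ?thesis
  proof (rule analytic_continuation_open[of "N \<inter> S" S F "\<lambda>_. 0"])
    show "N \<inter> S \<noteq> {}" using N(2) assms(4) by blast
    show "open (N \<inter> S)" using N(1) assms(2) by blast
  qed (use assms(1-3,6) N(3) in auto)
qed

text \<open>Write W - w as (z - s)^d q with q nonzero at s. Near s the factor q has a holomorphic
  d-th root, and (z - s) times this root is a coordinate whose d-th power is W - w;
  \<open>\<kappa>\<close> is the inverse of that coordinate.\<close>

lemma poly_local_coordinate:
  fixes W :: "complex poly"
  assumes "degree W > 0" and s: "poly W s = w" and "\<eta> > 0"
  obtains \<rho> \<kappa> where "\<rho> > 0" "\<kappa> holomorphic_on ball 0 \<rho>" "inj_on \<kappa> (ball 0 \<rho>)" "\<kappa> 0 = s"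
    "\<kappa> ` ball 0 \<rho> \<subseteq> ball s \<eta>"
    "\<And>\<zeta>. \<zeta> \<in> ball 0 \<rho> \<Longrightarrow> poly W (\<kappa> \<zeta>) = w + \<zeta> ^ order s (W - [:w:])"
proof -
  define p where "p = W - [:w:]"
  define d where "d = order s p"
  have "p \<noteq> 0"
    using assms(1) by (auto simp: p_def)
  obtain q where pq: "p = [:-s, 1:] ^ d * q" and nd: "\<not> [:-s, 1:] dvd q"
    using order_decomp[OF \<open>p \<noteq> 0\<close>, of s] by (auto simp: d_def)
  have qs: "poly q s \<noteq> 0"
    using nd by (simp add: poly_eq_0_iff_dvd)
  have "poly p s = 0"
    by (simp add: p_def s)
  then have "d > 0"
    using \<open>p \<noteq> 0\<close> by (auto simp: d_def order_root)
  have "continuous (at s) (poly q)"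
    by (rule poly_isCont)
  then obtain r0 where r0: "r0 > 0" "\<And>z. dist s z < r0 \<Longrightarrow> poly q z \<noteq> 0"
    using continuous_at_avoid[of s "poly q" 0] qs by auto
  define r where "r = min r0 \<eta>"
  have "r > 0" using r0 assms by (simp add: r_def)
  obtain L where L: "L holomorphic_on ball s r" "\<And>x. x \<in> ball s r \<Longrightarrow> exp (L x) = poly q x"
    by (rule holomorphic_logarithm_exists[of "ball s r" "poly q" s])
       (use r0 \<open>r > 0\<close> in \<open>auto simp: r_def intro!: holomorphic_intros\<close>)
  define \<psi> where "\<psi> = (\<lambda>z. (z - s) * exp (L z / of_nat d))"
  have hol\<psi>: "\<psi> holomorphic_on ball s r"
    unfolding \<psi>_def by (intro holomorphic_intros L) (use \<open>d > 0\<close> in auto)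
  have \<psi>d: "poly W z = w + \<psi> z ^ d" if "z \<in> ball s r" for z
  proof -
    have "exp (L z / of_nat d) ^ d = poly q z"
      using L(2)[OF that] \<open>d > 0\<close> by (simp flip: exp_of_nat_mult)
    then have "\<psi> z ^ d = poly p z"
      by (simp add: \<psi>_def pq power_mult_distrib poly_power)
    then show ?thesis by (simp add: p_def)
  qed
  have "(\<psi> has_field_derivative (1 * exp (L s / of_nat d) + deriv (\<lambda>z. exp (L z / of_nat d)) s * (s - s))) (at s)"
    unfolding \<psi>_def
  proof (rule DERIV_mult)
    show "((\<lambda>z. z - s) has_field_derivative 1) (at s)"
      by (auto intro!: derivative_eq_intros)
    have "(\<lambda>z. exp (L z / of_nat d)) holomorphic_on ball s r"
      by (intro holomorphic_intros L) (use \<open>d > 0\<close> in auto)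
    then show "((\<lambda>z. exp (L z / of_nat d)) has_field_derivative deriv (\<lambda>z. exp (L z / of_nat d)) s) (at s)"
      using \<open>r > 0\<close> by (auto intro!: holomorphic_derivI)
  qed
  then have "deriv \<psi> s \<noteq> 0"
    by (simp add: DERIV_imp_deriv)
  then obtain r2 where r2: "r2 > 0" "ball s r2 \<subseteq> ball s r" "open (\<psi> ` ball s r2)" "inj_on \<psi> (ball s r2)"
    using has_complex_derivative_locally_invertible[OF hol\<psi>, of s] \<open>r > 0\<close> by auto
  obtain g where g: "g holomorphic_on (\<psi> ` ball s r2)" "\<And>z. z \<in> ball s r2 \<Longrightarrow> g (\<psi> z) = z"
    using holomorphic_has_inverse[OF holomorphic_on_subset[OF hol\<psi> r2(2)] open_ball r2(4)] by metis
  have \<psi>s: "\<psi> s = 0" by (simp add: \<psi>_def)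
  have "0 \<in> \<psi> ` ball s r2"
    using r2(1) \<psi>s by (metis centre_in_ball image_eqI)
  then obtain \<rho> where \<rho>: "\<rho> > 0" "ball 0 \<rho> \<subseteq> \<psi> ` ball s r2"
    using r2(3) open_contains_ball by blast
  show ?thesis
  proof (rule that[of \<rho> g])
    show "\<rho> > 0" by fact
    show "g holomorphic_on ball 0 \<rho>"
      using g(1) \<rho>(2) by (rule holomorphic_on_subset)
    show "inj_on g (ball 0 \<rho>)"
    proof (rule inj_onI)
      fix x y assume xy: "x \<in> ball 0 \<rho>" "y \<in> ball 0 \<rho>" "g x = g y"
      then obtain x' y' where "x' \<in> ball s r2" "x = \<psi> x'" "y' \<in> ball s r2" "y = \<psi> y'"
        using \<rho>(2) by blast
      then show "x = y" using g(2) xy(3) by metis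
    qed
    show "g 0 = s"
      using g(2)[of s] r2(1) \<psi>s by simp
    have "g ` ball 0 \<rho> \<subseteq> ball s r2" using \<rho>(2) g(2) by fastforce
    also have "\<dots> \<subseteq> ball s \<eta>" using r2(2) by (auto simp: r_def)
    finally show "g ` ball 0 \<rho> \<subseteq> ball s \<eta>" .
    fix \<zeta> :: complex assume "\<zeta> \<in> ball 0 \<rho>"
    then obtain z where z: "z \<in> ball s r2" "\<zeta> = \<psi> z" using \<rho>(2) by auto
    then show "poly W (g \<zeta>) = w + \<zeta> ^ order s (W - [:w:])"
      using \<psi>d[of z] r2(2) g(2) by (auto simp: d_def p_def)
  qed
qed

lemma finite_poly_fibre:
  fixes W :: "complex poly"
  assumes "degree W > 0"
  shows "finite {z. poly W z = w}"
proof -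
  have "W - [:w:] \<noteq> 0" using assms by auto
  then have "finite {z. poly (W - [:w:]) z = 0}" by (rule poly_roots_finite)
  then show ?thesis by simp
qed

lemma card_poly_fibre_le:
  fixes W :: "complex poly"
  assumes "degree W > 0"
  shows "card {z. poly W z = w} \<le> degree W"
proof -
  have "W - [:w:] \<noteq> 0" using assms by auto
  then show ?thesis using card_poly_roots_bound[of "W - [:w:]"] by (simp add: degree_minus_const)
qed

text \<open>One radius serves all points of the fibre, and the charts have disjoint images. The
  bound \<open>\<rho> \<le> 1\<close> makes \<open>ln \<rho>\<close> nonpositive, so that a single
  half-plane of logarithmic parameters works for all multiplicities.\<close>

locale fibre_chart =
  fixes W :: "complex poly" and w :: complex and \<rho> :: real and \<kappa> :: "complex \<Rightarrow> complex \<Rightarrow> complex"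
  assumes degW: "degree W > 0" and \<rho>: "\<rho> > 0" "\<rho> \<le> 1"
    and hol\<kappa>: "\<And>s. poly W s = w \<Longrightarrow> \<kappa> s holomorphic_on ball 0 \<rho>"
    and inj\<kappa>: "\<And>s. poly W s = w \<Longrightarrow> inj_on (\<kappa> s) (ball 0 \<rho>)"
    and \<kappa>0: "\<And>s. poly W s = w \<Longrightarrow> \<kappa> s 0 = s"
    and val\<kappa>: "\<And>s \<zeta>. poly W s = w \<Longrightarrow> \<zeta> \<in> ball 0 \<rho> \<Longrightarrow>
      poly W (\<kappa> s \<zeta>) = w + \<zeta> ^ order s (W - [:w:])"
    and disj\<kappa>: "\<And>s s' \<zeta> \<zeta>'. poly W s = w \<Longrightarrow> poly W s' = w \<Longrightarrow> \<zeta> \<in> ball 0 \<rho> \<Longrightarrow>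
      \<zeta>' \<in> ball 0 \<rho> \<Longrightarrow> \<kappa> s \<zeta> = \<kappa> s' \<zeta>' \<Longrightarrow> s = s'"

lemma fibre_chart_exists:
  assumes "degree W > 0"
  obtains \<rho> \<kappa> where "fibre_chart W w \<rho> \<kappa>"
proof -
  let ?F = "{z. poly W z = w}"
  have fin: "finite ?F" by (rule finite_poly_fibre[OF assms])
  have "\<exists>\<eta>>0. \<forall>s'\<in>?F. s' \<noteq> s \<longrightarrow> \<eta> \<le> dist s s'" for s
    using finite_set_avoid[OF fin] by auto
  then obtain \<eta>0 where \<eta>0: "\<And>s. \<eta>0 s > 0" "\<And>s s'. s' \<in> ?F \<Longrightarrow> s' \<noteq> s \<Longrightarrow> \<eta>0 s \<le> dist s s'"
    by metis
  have "\<exists>\<rho> \<kappa>. \<rho> > 0 \<and> \<kappa> holomorphic_on ball 0 \<rho> \<and> inj_on \<kappa> (ball 0 \<rho>) \<and> \<kappa> 0 = s \<and>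
    \<kappa> ` ball 0 \<rho> \<subseteq> ball s (\<eta>0 s / 2) \<and>
    (\<forall>\<zeta>\<in>ball 0 \<rho>. poly W (\<kappa> \<zeta>) = w + \<zeta> ^ order s (W - [:w:]))" if "s \<in> ?F" for s
  proof -
    have "poly W s = w" "\<eta>0 s / 2 > 0" using that \<eta>0(1)[of s] by auto
    from poly_local_coordinate[OF assms this]
    obtain \<rho> \<kappa> where "\<rho> > 0" "\<kappa> holomorphic_on ball 0 \<rho>" "inj_on \<kappa> (ball 0 \<rho>)" "\<kappa> 0 = s"
      "\<kappa> ` ball 0 \<rho> \<subseteq> ball s (\<eta>0 s / 2)"
      "\<And>\<zeta>. \<zeta> \<in> ball 0 \<rho> \<Longrightarrow> poly W (\<kappa> \<zeta>) = w + \<zeta> ^ order s (W - [:w:])"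
      by blast
    then show ?thesis by (intro exI[of _ \<rho>] exI[of _ \<kappa>]) simp
  qed
  then obtain R \<kappa> where R: "\<And>s. s \<in> ?F \<Longrightarrow> R s > 0 \<and> \<kappa> s holomorphic_on ball 0 (R s) \<and>
    inj_on (\<kappa> s) (ball 0 (R s)) \<and> \<kappa> s 0 = s \<and> \<kappa> s ` ball 0 (R s) \<subseteq> ball s (\<eta>0 s / 2) \<and>
    (\<forall>\<zeta>\<in>ball 0 (R s). poly W (\<kappa> s \<zeta>) = w + \<zeta> ^ order s (W - [:w:]))"
    by metis
  define \<rho> where "\<rho> = Min (insert 1 (R ` ?F))"
  have \<rho>: "\<rho> > 0" "\<rho> \<le> 1" "\<And>s. s \<in> ?F \<Longrightarrow> \<rho> \<le> R s"
    unfolding \<rho>_def using fin R by (auto simp: Min_gr_iff intro!: Min_le)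
  have sub: "ball 0 \<rho> \<subseteq> ball (0::complex) (R s)" if "s \<in> ?F" for s
    using \<rho>(3)[OF that] by (auto simp: subset_iff)
  have "fibre_chart W w \<rho> \<kappa>"
  proof
    fix s assume s: "poly W s = w"
    then have sF: "s \<in> ?F" by simp
    show "\<kappa> s holomorphic_on ball 0 \<rho>" using R[OF sF] sub[OF sF] holomorphic_on_subset by blast
    show "inj_on (\<kappa> s) (ball 0 \<rho>)" using R[OF sF] sub[OF sF] inj_on_subset by blast
    show "\<kappa> s 0 = s" using R[OF sF] by auto
    show "poly W (\<kappa> s \<zeta>) = w + \<zeta> ^ order s (W - [:w:])" if "\<zeta> \<in> ball 0 \<rho>" for \<zeta>
      using R[OF sF] sub[OF sF] that by blast
    fix s' \<zeta> \<zeta>' assume s': "poly W s' = w" and z: "\<zeta> \<in> ball 0 \<rho>" "\<zeta>' \<in> ball 0 \<rho>" "\<kappa> s \<zeta> = \<kappa> s' \<zeta>'"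
    then have s'F: "s' \<in> ?F" by simp
    have "\<kappa> s \<zeta> \<in> ball s (\<eta>0 s / 2)" "\<kappa> s' \<zeta>' \<in> ball s' (\<eta>0 s' / 2)"
      using R[OF sF] R[OF s'F] sub[OF sF] sub[OF s'F] z by blast+
    then have "dist s s' < \<eta>0 s / 2 + \<eta>0 s' / 2"
      using z(3) by (metis add_strict_mono dist_commute dist_triangle_less_add mem_ball)
    then show "s = s'"
      using \<eta>0(2)[OF sF, of s'] \<eta>0(2)[OF s'F, of s] by (cases "s = s'") (auto simp: dist_commute)
  qed (use assms \<rho> in auto)
  then show ?thesis by (rule that)
qed

lemma sum_order_fibre:
  fixes W :: "complex poly"
  assumes "degree W > 0"
  shows "(\<Sum>s\<in>{z. poly W z = w}. order s (W - [:w:])) = degree W"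
proof -
  define p where "p = W - [:w:]"
  have p0: "p \<noteq> 0" using assms by (auto simp: p_def)
  have "size (proots p) = (\<Sum>s\<in>set_mset (proots p). count (proots p) s)"
    by (rule size_multiset_overloaded_eq)
  also have "\<dots> = (\<Sum>s\<in>{z. poly W z = w}. order s p)"
    using p0 by (intro sum.cong) (auto simp: p_def)
  finally show ?thesis using size_proots_complex[of p] by (simp add: p_def degree_minus_const)
qed

lemma simple_root_of_full_fibre:
  fixes W :: "complex poly"
  assumes "degree W > 0" and "card {z. poly W z = w} = degree W" and "poly W z = w"
  shows "order z (W - [:w:]) = 1"
proof (rule ccontr)
  let ?F = "{z. poly W z = w}" and ?o = "\<lambda>s. order s (W - [:w:])"
  assume ne: "?o z \<noteq> 1"
  have fin: "finite ?F" by (rule finite_poly_fibre[OF assms(1)])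
  have p0: "W - [:w:] \<noteq> 0" using assms(1) by auto
  have pos: "?o s \<ge> 1" if "s \<in> ?F" for s
    using that p0 order_root[of "W - [:w:]" s] by (simp add: Suc_leI)
  have "(\<Sum>s\<in>?F. 1) < (\<Sum>s\<in>?F. ?o s)"
    by (rule sum_strict_mono_ex1) (use fin pos ne assms(3) in \<open>auto simp: order.strict_iff_order\<close>)
  then show False using assms(2) sum_order_fibre[OF assms(1), of w] by simp
qed

section \<open>Analytic continuation of the fibres\<close>

text \<open>All points of a fibre are labelled at once, so that carrying one branch along carries
  the others too. The set \<open>X\<close> holds values to be avoided in addition to the critical
  ones.\<close>

locale fibre_markings =
  fixes P :: "complex poly" and I :: "'i set" and X :: "complex set"
    and m0 :: "'i \<Rightarrow> complex" and t0 :: complex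
  assumes degP: "degree P > 0" and finX: "finite X" and finI: "finite I"
    and cardI: "card I = degree P" and t0X: "t0 \<notin> X"
    and inj_m0: "inj_on m0 I" and P_m0: "\<And>i. i \<in> I \<Longrightarrow> poly P (m0 i) = t0"
begin

definition \<Omega> :: "complex \<Rightarrow> complex set" where
  "\<Omega> t = {z. poly P z = t}"

definition regular :: "complex \<Rightarrow> bool" where
  "regular t \<longleftrightarrow> t \<notin> X \<and> card (\<Omega> t) = degree P"

definition marking :: "('i \<Rightarrow> complex) \<Rightarrow> complex \<Rightarrow> bool" where
  "marking m t \<longleftrightarrow> t \<notin> X \<and> inj_on m I \<and> (\<forall>i\<in>I. poly P (m i) = t)"

definition family :: "('i \<Rightarrow> complex \<Rightarrow> complex) \<Rightarrow> complex \<Rightarrow> real \<Rightarrow> bool" where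
  "family \<phi> c r \<longleftrightarrow> (\<forall>i\<in>I. \<phi> i holomorphic_on ball c r) \<and> (\<forall>s\<in>ball c r. marking (\<lambda>i. \<phi> i s) s)"

text \<open>Values of a marking outside \<open>I\<close> are irrelevant.\<close>

definition step :: "('i \<Rightarrow> complex) \<Rightarrow> ('i \<Rightarrow> complex) \<Rightarrow> bool" where
  "step m m' \<longleftrightarrow> (\<exists>\<phi> c r. family \<phi> c r \<and>
     (\<exists>t\<in>ball c r. \<exists>t'\<in>ball c r. \<forall>i\<in>I. m i = \<phi> i t \<and> m' i = \<phi> i t'))"

text \<open>Analytic continuation as the transitive closure of moves inside discs: neither paths nor
  homotopies are needed, and symmetry is immediate.\<close>

abbreviation continuable :: "('i \<Rightarrow> complex) \<Rightarrow> ('i \<Rightarrow> complex) \<Rightarrow> bool" where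
  "continuable \<equiv> step\<^sup>*\<^sup>*"

abbreviation reach :: "('i \<Rightarrow> complex) \<Rightarrow> bool" where
  "reach m \<equiv> continuable m0 m"

lemma I_nonempty: "I \<noteq> {}"
  using cardI degP by auto

lemma finite_\<Omega>: "finite (\<Omega> t)"
  unfolding \<Omega>_def by (rule finite_poly_fibre[OF degP])

lemma marking_bij: "marking m t \<Longrightarrow> bij_betw m I (\<Omega> t)"
proof -
  assume m: "marking m t"
  have sub: "m ` I \<subseteq> \<Omega> t" using m by (auto simp: marking_def \<Omega>_def)
  have "card (m ` I) = degree P" using m cardI by (simp add: marking_def card_image)
  then have "m ` I = \<Omega> t"
    using card_poly_fibre_le[OF degP, of t] card_mono[OF finite_\<Omega> sub] sub
    by (metis \<Omega>_def card_seteq finite_\<Omega>)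
  then show ?thesis using m by (simp add: bij_betw_def marking_def)
qed

lemma marking_regular: "marking m t \<Longrightarrow> regular t"
  using marking_bij[of m t] cardI by (auto simp: regular_def marking_def bij_betw_same_card[symmetric])

lemma marking_value: "marking m t \<Longrightarrow> i \<in> I \<Longrightarrow> poly P (m i) = t"
  by (simp add: marking_def)

lemma marking_unique: "marking m t \<Longrightarrow> marking m t' \<Longrightarrow> t = t'"
  using I_nonempty marking_value by blast

lemma marking_cong: "(\<And>i. i \<in> I \<Longrightarrow> m i = m' i) \<Longrightarrow> marking m t \<longleftrightarrow> marking m' t"
  unfolding marking_def by (metis inj_on_cong)

lemma marking_m0: "marking m0 t0"
  using t0X inj_m0 P_m0 by (simp add: marking_def)

lemma marking_comp: "marking m t \<Longrightarrow> g permutes I \<Longrightarrow> marking (m \<circ> g) t"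
  unfolding marking_def
  by (metis (no_types, lifting) bij_betw_imp_inj_on comp_apply comp_inj_on permutes_image permutes_imp_bij permutes_in_image)

lemma family_comp:
  assumes "family \<phi> c r" "g permutes I"
  shows "family (\<phi> \<circ> g) c r"
  unfolding family_def
proof safe
  fix i assume "i \<in> I"
  then show "(\<phi> \<circ> g) i holomorphic_on ball c r"
    using assms permutes_in_image[OF assms(2)] by (auto simp: family_def)
next
  fix s assume "s \<in> ball c r"
  then have "marking (\<lambda>i. \<phi> i s) s" using assms(1) by (simp add: family_def)
  from marking_comp[OF this assms(2)] show "marking (\<lambda>i. (\<phi> \<circ> g) i s) s"
    by (simp add: o_def)
qed

lemma step_comp:
  assumes "step m m'" "g permutes I"
  shows "step (m \<circ> g) (m' \<circ> g)"
proof -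
  obtain \<phi> c r t t' where *: "family \<phi> c r" "t \<in> ball c r" "t' \<in> ball c r"
    "\<And>i. i \<in> I \<Longrightarrow> m i = \<phi> i t \<and> m' i = \<phi> i t'"
    using assms(1) unfolding step_def by blast
  then show ?thesis
    unfolding step_def using family_comp[OF *(1) assms(2)] permutes_in_image[OF assms(2)]
    by (intro exI[of _ "\<phi> \<circ> g"] exI[of _ c] exI[of _ r] conjI bexI[of _ t] bexI[of _ t']) auto
qed

lemma step_marking: "step m m' \<Longrightarrow> \<exists>t. marking m' t"
  unfolding step_def family_def by (metis marking_cong)

lemma step_sym: "step m m' \<Longrightarrow> step m' m"
  unfolding step_def by metis

lemma continuable_sym: "continuable m m' \<Longrightarrow> continuable m' m"
  by (metis step_sym sympI symp_rtranclp sympD)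

lemma continuable_comp: "continuable m m' \<Longrightarrow> g permutes I \<Longrightarrow> continuable (m \<circ> g) (m' \<circ> g)"
  by (induction rule: rtranclp_induct) (auto intro: step_comp rtranclp.rtrancl_into_rtrancl)

lemma reach_marking: "reach m \<Longrightarrow> \<exists>t. marking m t"
  by (induction rule: rtranclp_induct) (auto intro: step_marking marking_m0)

lemma reach_inj: "reach m \<Longrightarrow> inj_on m I"
  using reach_marking unfolding marking_def by blast

lemma reach_value: "reach m \<Longrightarrow> i \<in> I \<Longrightarrow> j \<in> I \<Longrightarrow> poly P (m i) = poly P (m j)"
  using reach_marking marking_value by metis

text \<open>Over a regular value all multiplicities are 1, so the local coordinates are sections of
  \<open>P\<close>. Disjoint charts make them injective on the fibre, and nearby fibres cannot have
  more than \<open>degree P\<close> points. The last clause, that a section inverts \<open>P\<close>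
  near its point, serves to recognise any continuous lift as one of these sections.\<close>

lemma local_chart:
  assumes "regular t"
  obtains r \<phi> where "r > 0" "ball t r \<inter> X = {}"
    "\<And>z. z \<in> \<Omega> t \<Longrightarrow> \<phi> z holomorphic_on ball t r" "\<And>z. z \<in> \<Omega> t \<Longrightarrow> \<phi> z t = z"
    "\<And>s. s \<in> ball t r \<Longrightarrow> bij_betw (\<lambda>z. \<phi> z s) (\<Omega> t) (\<Omega> s)"
    "\<And>z. z \<in> \<Omega> t \<Longrightarrow> \<forall>\<^sub>F z' in nhds z. \<phi> z (poly P z') = z'"
proof -
  obtain \<rho> \<kappa> where "fibre_chart P t \<rho> \<kappa>" by (rule fibre_chart_exists[OF degP])
  then interpret Y: fibre_chart P t \<rho> \<kappa> .
  note \<rho> = Y.\<rho>(1) and \<kappa> = Y.hol\<kappa> Y.inj\<kappa> Y.\<kappa>0 Y.val\<kappa> Y.disj\<kappa>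
  have ord: "order s (P - [:t:]) = 1" if "s \<in> \<Omega> t" for s
    using simple_root_of_full_fibre[OF degP] assms that by (simp add: regular_def \<Omega>_def)
  obtain d where d: "d > 0" "\<And>x. x \<in> X \<Longrightarrow> x \<noteq> t \<Longrightarrow> d \<le> dist t x"
    using finite_set_avoid[OF finX, of t] by auto
  have dX: "d \<le> dist t x" if "x \<in> X" for x
    using d(2) that assms regular_def by blast
  define r where "r = min \<rho> d"
  define \<phi> where "\<phi> = (\<lambda>z s. \<kappa> z (s - t))"
  have inb: "s - t \<in> ball 0 \<rho>" if "s \<in> ball t r" for s
    using that by (auto simp: r_def dist_norm norm_minus_commute)
  show ?thesis
  proof (rule that[of r \<phi>])
    show "r > 0" using \<rho> d by (simp add: r_def)
    show "ball t r \<inter> X = {}" using dX by (force simp: r_def)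
    show hol: "\<phi> z holomorphic_on ball t r" if "z \<in> \<Omega> t" for z
    proof -
      have "\<kappa> z \<circ> (\<lambda>s. s - t) holomorphic_on ball t r"
        by (rule holomorphic_on_compose_gen[where t = "ball 0 \<rho>"])
           (use inb \<kappa>(1) that in \<open>auto simp: \<Omega>_def intro!: holomorphic_intros\<close>)
      then show ?thesis by (simp add: \<phi>_def o_def)
    qed
    show "\<phi> z t = z" if "z \<in> \<Omega> t" for z
      using that \<kappa>(3) by (simp add: \<phi>_def \<Omega>_def)
    have val: "poly P (\<kappa> z \<zeta>) = t + \<zeta>" if "z \<in> \<Omega> t" "\<zeta> \<in> ball 0 \<rho>" for z \<zeta>
      using \<kappa>(4)[of z \<zeta>] ord[of z] that by (simp add: \<Omega>_def)
    show "bij_betw (\<lambda>z. \<phi> z s) (\<Omega> t) (\<Omega> s)" if s: "s \<in> ball t r" for s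
    proof -
      have inj: "inj_on (\<lambda>z. \<phi> z s) (\<Omega> t)"
        unfolding inj_on_def \<phi>_def using \<kappa>(5) inb[OF s] by (auto simp: \<Omega>_def)
      have sub: "(\<lambda>z. \<phi> z s) ` \<Omega> t \<subseteq> \<Omega> s"
        using val inb[OF s] by (auto simp: \<phi>_def \<Omega>_def)
      have "card (\<Omega> s) \<le> card (\<Omega> t)"
        using assms card_poly_fibre_le[OF degP, of s] by (simp add: regular_def \<Omega>_def)
      then have "(\<lambda>z. \<phi> z s) ` \<Omega> t = \<Omega> s"
        using card_image[OF inj] sub by (metis card_seteq finite_\<Omega>)
      then show ?thesis using inj by (simp add: bij_betw_def)
    qed
    show "\<forall>\<^sub>F z' in nhds z. \<phi> z (poly P z') = z'" if z: "z \<in> \<Omega> t" for z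
    proof -
      have "open (\<kappa> z ` ball 0 \<rho>)"
        using open_mapping_thm3[of "\<kappa> z" "ball 0 \<rho>"] \<kappa>(1,2)[of z] z by (simp add: \<Omega>_def)
      moreover have "z \<in> \<kappa> z ` ball 0 \<rho>"
        using \<kappa>(3)[of z] z \<rho> by (force simp: \<Omega>_def image_iff intro: bexI[of _ 0])
      ultimately have "\<forall>\<^sub>F z' in nhds z. z' \<in> \<kappa> z ` ball 0 \<rho>"
        by (rule eventually_nhds_in_open)
      then show ?thesis
        by eventually_elim (use val[OF z] in \<open>auto simp: \<phi>_def\<close>)
    qed
  qed
qed

lemma chart_family_of_marking:
  assumes "marking m t" "ball t r \<inter> X = {}"
    and hol: "\<And>z. z \<in> \<Omega> t \<Longrightarrow> \<phi> z holomorphic_on ball t r"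
    and bij: "\<And>s. s \<in> ball t r \<Longrightarrow> bij_betw (\<lambda>z. \<phi> z s) (\<Omega> t) (\<Omega> s)"
  shows "family (\<lambda>i. \<phi> (m i)) t r"
  unfolding family_def
proof safe
  have b: "bij_betw m I (\<Omega> t)" by (rule marking_bij[OF assms(1)])
  show "\<phi> (m i) holomorphic_on ball t r" if "i \<in> I" for i
    using hol bij_betw_apply[OF b that] by blast
  fix s assume s: "s \<in> ball t r"
  have "bij_betw ((\<lambda>z. \<phi> z s) \<circ> m) I (\<Omega> s)"
    by (rule bij_betw_trans[OF b bij[OF s]])
  then show "marking (\<lambda>i. \<phi> (m i) s) s"
    using s assms(2) unfolding marking_def by (auto simp: bij_betw_def o_def \<Omega>_def)
qed

lemma local_family:
  assumes "marking m t"
  obtains r \<phi> where "r > 0" "family \<phi> t r" "\<And>i. i \<in> I \<Longrightarrow> \<phi> i t = m i"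
proof -
  obtain r \<phi> where r: "r > 0" "ball t r \<inter> X = {}"
    and \<phi>: "\<And>z. z \<in> \<Omega> t \<Longrightarrow> \<phi> z holomorphic_on ball t r" "\<And>z. z \<in> \<Omega> t \<Longrightarrow> \<phi> z t = z"
    "\<And>s. s \<in> ball t r \<Longrightarrow> bij_betw (\<lambda>z. \<phi> z s) (\<Omega> t) (\<Omega> s)"
    "\<And>z. z \<in> \<Omega> t \<Longrightarrow> \<forall>\<^sub>F z' in nhds z. \<phi> z (poly P z') = z'"
    by (rule local_chart[OF marking_regular[OF assms]]) (rule that; assumption)
  have mI: "m i \<in> \<Omega> t" if "i \<in> I" for i
    using bij_betw_apply[OF marking_bij[OF assms] that] .
  show ?thesis
    by (rule that[of r "\<lambda>i. \<phi> (m i)"])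
       (use r \<phi>(2) mI chart_family_of_marking[OF assms r(2) \<phi>(1,3)] in auto)
qed

lemma step_family:
  assumes "family \<phi> c r" "t \<in> ball c r" "t' \<in> ball c r"
    "\<And>i. i \<in> I \<Longrightarrow> m i = \<phi> i t" "\<And>i. i \<in> I \<Longrightarrow> m' i = \<phi> i t'"
  shows "step m m'"
  using assms unfolding step_def by blast

lemma step_same:
  assumes "marking m t" "\<And>i. i \<in> I \<Longrightarrow> m i = m' i"
  shows "step m m'"
proof -
  obtain r \<phi> where "r > 0" "family \<phi> t r" "\<And>i. i \<in> I \<Longrightarrow> \<phi> i t = m i"
    using local_family[OF assms(1)] by blast
  then show ?thesis
    using assms(2) by (intro step_family[of \<phi> t r t t]) auto
qed

lemma continuable_cong:
  assumes "reach m" "\<And>i. i \<in> I \<Longrightarrow> m i = m' i"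
  shows "reach m'"
  using assms step_same reach_marking by (meson rtranclp.rtrancl_into_rtrancl)

text \<open>Partial liftings suffice: the remaining branches are carried along automatically.\<close>

lemma lift_connected:
  fixes S :: "'s::metric_space set" and \<Gamma> :: "'i \<Rightarrow> 's \<Rightarrow> complex"
  assumes "connected S" and "I' \<subseteq> I" and contT: "continuous_on S T"
    and reg: "\<And>s. s \<in> S \<Longrightarrow> regular (T s)"
    and cont\<Gamma>: "\<And>i. i \<in> I' \<Longrightarrow> continuous_on S (\<Gamma> i)"
    and val: "\<And>i s. i \<in> I' \<Longrightarrow> s \<in> S \<Longrightarrow> poly P (\<Gamma> i s) = T s"
    and "s1 \<in> S" "s2 \<in> S"
    and start: "reach m" "marking m (T s1)" "\<And>i. i \<in> I' \<Longrightarrow> m i = \<Gamma> i s1"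
  obtains m' where "reach m'" "marking m' (T s2)" "\<And>i. i \<in> I' \<Longrightarrow> m' i = \<Gamma> i s2"
proof -
  \<comment> \<open>Being reached by a marking that agrees with the prescribed lifts is shown to be
    a locally constant property of \<open>s\<close>; connectedness of \<open>S\<close> then replaces
    a path from \<open>s1\<close> to \<open>s2\<close>.\<close>
  define L where "L = (\<lambda>s. \<exists>m. reach m \<and> marking m (T s) \<and> (\<forall>i\<in>I'. m i = \<Gamma> i s))"
  have "L s1 \<longleftrightarrow> L s2"
  proof (rule connected_equivalence_relation[of S s1 s2 "\<lambda>x y. L x \<longleftrightarrow> L y"])
    fix s assume s: "s \<in> S"
    define t where "t = T s"
    obtain r \<phi> where r: "r > 0" "ball t r \<inter> X = {}"
      and \<phi>: "\<And>z. z \<in> \<Omega> t \<Longrightarrow> \<phi> z holomorphic_on ball t r" "\<And>z. z \<in> \<Omega> t \<Longrightarrow> \<phi> z t = z"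
      "\<And>s. s \<in> ball t r \<Longrightarrow> bij_betw (\<lambda>z. \<phi> z s) (\<Omega> t) (\<Omega> s)"
      "\<And>z. z \<in> \<Omega> t \<Longrightarrow> \<forall>\<^sub>F z' in nhds z. \<phi> z (poly P z') = z'"
      by (rule local_chart[OF reg[OF s, folded t_def]]) (rule that; assumption)
    have \<Gamma>\<Omega>: "\<Gamma> i s \<in> \<Omega> t" if "i \<in> I'" for i
      using val[OF that s] by (simp add: \<Omega>_def t_def)
    have "finite I'" using \<open>I' \<subseteq> I\<close> finI finite_subset by blast
    have ev1: "\<forall>\<^sub>F s' in at s within S. T s' \<in> ball t r"
      using contT s r(1) unfolding t_def continuous_on_def
      by (metis centre_in_ball open_ball topological_tendstoD)
    have ev2: "\<forall>\<^sub>F s' in at s within S. \<forall>i\<in>I'. \<phi> (\<Gamma> i s) (poly P (\<Gamma> i s')) = \<Gamma> i s'"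
    proof (rule eventually_ball_finite[OF \<open>finite I'\<close>], rule ballI)
      fix i assume i: "i \<in> I'"
      have "filterlim (\<Gamma> i) (nhds (\<Gamma> i s)) (at s within S)"
        using cont\<Gamma>[OF i] s by (auto simp: continuous_on_def)
      with \<phi>(4)[OF \<Gamma>\<Omega>[OF i]]
      show "\<forall>\<^sub>F s' in at s within S. \<phi> (\<Gamma> i s) (poly P (\<Gamma> i s')) = \<Gamma> i s'"
        by (rule eventually_compose_filterlim)
    qed
    have "\<forall>\<^sub>F s' in at s within S. T s' \<in> ball t r \<and> (\<forall>i\<in>I'. \<phi> (\<Gamma> i s) (poly P (\<Gamma> i s')) = \<Gamma> i s')"
      using ev1 ev2 by (rule eventually_conj)
    then obtain \<delta> where \<delta>: "\<delta> > 0"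
      "\<And>s'. s' \<in> S \<Longrightarrow> s' \<noteq> s \<Longrightarrow> dist s' s < \<delta> \<Longrightarrow>
         T s' \<in> ball t r \<and> (\<forall>i\<in>I'. \<phi> (\<Gamma> i s) (poly P (\<Gamma> i s')) = \<Gamma> i s')"
      unfolding eventually_at by auto
    have "L s \<longleftrightarrow> L s'" if s': "s' \<in> S \<inter> ball s \<delta>" for s'
    proof (cases "s' = s")
      case False
      then have Tb: "T s' \<in> ball t r" and \<Gamma>': "\<And>i. i \<in> I' \<Longrightarrow> \<phi> (\<Gamma> i s) (T s') = \<Gamma> i s'"
        using \<delta>(2)[of s'] s' val[of _ s'] by (auto simp: dist_commute)
      have tb: "t \<in> ball t r" using r by simp
      note fam = chart_family_of_marking[OF _ r(2) \<phi>(1,3)]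
      show ?thesis
      proof
        assume "L s"
        then obtain m where m: "reach m" "marking m t" "\<And>i. i \<in> I' \<Longrightarrow> m i = \<Gamma> i s"
          unfolding L_def t_def by blast
        have b: "m i \<in> \<Omega> t" if "i \<in> I" for i
          using marking_bij[OF m(2)] that by (auto simp: bij_betw_def)
        define m' where "m' = (\<lambda>i. \<phi> (m i) (T s'))"
        have "step m m'"
          by (rule step_family[OF fam[OF m(2)] tb Tb]) (use b \<phi>(2) in \<open>auto simp: m'_def\<close>)
        moreover have "marking m' (T s')"
          using fam[OF m(2)] Tb by (auto simp: family_def m'_def)
        moreover have "m' i = \<Gamma> i s'" if "i \<in> I'" for i
          using \<Gamma>'[OF that] m(3)[OF that] by (simp add: m'_def)
        ultimately show "L s'"
          unfolding L_def using m(1) by (meson rtranclp.rtrancl_into_rtrancl)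
      next
        assume "L s'"
        then obtain m' where m': "reach m'" "marking m' (T s')" "\<And>i. i \<in> I' \<Longrightarrow> m' i = \<Gamma> i s'"
          unfolding L_def by blast
        have bT: "bij_betw (\<lambda>z. \<phi> z (T s')) (\<Omega> t) (\<Omega> (T s'))" by (rule \<phi>(3)[OF Tb])
        \<comment> \<open>For the way back the marking over \<open>t\<close> is recovered by
          inverting the bijection between the two fibres.\<close>
        define m where "m = (\<lambda>i. the_inv_into (\<Omega> t) (\<lambda>z. \<phi> z (T s')) (m' i))"
        have b': "bij_betw m' I (\<Omega> (T s'))" by (rule marking_bij[OF m'(2)])
        have "bij_betw (the_inv_into (\<Omega> t) (\<lambda>z. \<phi> z (T s')) \<circ> m') I (\<Omega> t)"
          by (rule bij_betw_trans[OF b' bij_betw_the_inv_into[OF bT]])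
        then have bm: "bij_betw m I (\<Omega> t)" by (simp add: m_def o_def)
        have mt: "marking m t"
          using bm reg[OF s] unfolding marking_def regular_def t_def
          by (auto simp: bij_betw_def \<Omega>_def)
        have m'_eq: "\<phi> (m i) (T s') = m' i" if "i \<in> I" for i
          unfolding m_def using bT b' that
          by (metis (mono_tags, lifting) bij_betw_apply f_the_inv_into_f_bij_betw)
        have "step m' m"
          by (rule step_family[OF fam[OF mt] Tb tb]) (use m'_eq \<phi>(2) bij_betw_apply[OF bm] in auto)
        moreover have "m i = \<Gamma> i s" if "i \<in> I'" for i
        proof -
          have "\<phi> (m i) (T s') = \<phi> (\<Gamma> i s) (T s')"
            using m'_eq[of i] m'(3)[OF that] \<Gamma>'[OF that] that \<open>I' \<subseteq> I\<close> by auto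
          then show ?thesis
            using bij_betw_imp_inj_on[OF bT] \<Gamma>\<Omega>[OF that] bij_betw_apply[OF bm] that \<open>I' \<subseteq> I\<close>
            by (meson inj_onD subsetD)
        qed
        ultimately show "L s"
          unfolding L_def t_def[symmetric] using m'(1) mt
          by (meson rtranclp.rtrancl_into_rtrancl)
      qed
    qed simp
    then show "\<exists>U. openin (top_of_set S) U \<and> s \<in> U \<and> (\<forall>x\<in>U. L s \<longleftrightarrow> L x)"
      using \<delta>(1) s by (intro exI[of _ "S \<inter> ball s \<delta>"]) auto
  qed (use assms in auto)
  moreover have "L s1" unfolding L_def using start by blast
  ultimately have "L s2" by simp
  then show ?thesis unfolding L_def using that by blast
qed

end

section \<open>Critical fibres, extension by Liouville's theorem, and growth along fibres\<close>

lemma critical_of_small_fibre: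
  fixes P :: "complex poly"
  assumes "degree P > 0" and "card {z. poly P z = t} \<noteq> degree P"
  shows "\<exists>z. poly P z = t \<and> poly (pderiv P) z = 0"
proof (rule ccontr)
  assume noncrit: "\<not> ?thesis"
  let ?p = "P - [:t:]"
  have p0: "?p \<noteq> 0" using assms(1) by auto
  have "order s ?p = 1" if s: "poly P s = t" for s
  proof -
    have "poly ?p s = 0" using s by simp
    then have "order s ?p > 0" using p0 order_root[of ?p s] by auto
    moreover have "order s (pderiv ?p) = 0"
      using noncrit s by (intro order_0I) (auto simp: pderiv_diff pderiv_pCons)
    ultimately show ?thesis using order_pderiv[OF p0 \<open>poly ?p s = 0\<close>] by simp
  qed
  then have "(\<Sum>s\<in>{z. poly P z = t}. order s ?p) = card {z. poly P z = t}"
    by (simp add: sum.cong[of _ _ _ "\<lambda>_. 1"])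
  then show False using sum_order_fibre[OF assms(1), of t] assms(2) by simp
qed

lemma prod_linear_dvd:
  fixes p :: "complex poly"
  assumes "finite K" "\<And>a. a \<in> K \<Longrightarrow> poly p a = 0"
  shows "(\<Prod>a\<in>K. [:-a, 1:]) dvd p"
  using assms
proof (induction K arbitrary: p rule: finite_induct)
  case (insert a F)
  have "[:-a, 1:] dvd p" using insert.prems by (simp add: poly_eq_0_iff_dvd[symmetric])
  then obtain q where q: "p = [:-a, 1:] * q" by (elim dvdE)
  have "poly q x = 0" if "x \<in> F" for x
    using insert.prems[of x] insert.hyps(2) that by (auto simp: q)
  then have "(\<Prod>a\<in>F. [:-a, 1:]) dvd q" by (rule insert.IH)
  then show ?case using insert.hyps by (simp add: q mult_dvd_mono del: mult_pCons_left)
qed auto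

lemma poly_eq_prod_roots:
  fixes p :: "complex poly"
  assumes "p \<noteq> 0" "finite S" "card S = degree p" "\<And>s. s \<in> S \<Longrightarrow> poly p s = 0"
  shows "p = smult (lead_coeff p) (\<Prod>s\<in>S. [:-s, 1:])"
proof -
  define \<pi> where "\<pi> = (\<Prod>s\<in>S. [:-s, 1:])"
  have deg: "degree \<pi> = degree p" and lc: "lead_coeff \<pi> = 1"
    unfolding \<pi>_def by (subst degree_prod_eq_sum_degree) (auto simp: assms(3) lead_coeff_prod)
  have "\<pi> dvd p" unfolding \<pi>_def by (rule prod_linear_dvd) (use assms in auto)
  then obtain r where r: "p = \<pi> * r" by (elim dvdE)
  have "degree r = 0" using r deg assms(1) degree_mult_eq[of \<pi> r] by auto
  then obtain c where c: "r = [:c:]" using degree_0_id by metis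
  have "lead_coeff p = lead_coeff \<pi> * lead_coeff r" by (simp only: r lead_coeff_mult)
  then have "lead_coeff p = c" using lc c by simp
  moreover have "p = smult c \<pi>" using r c by simp
  ultimately have "p = smult (lead_coeff p) \<pi>" by metis
  then show ?thesis unfolding \<pi>_def .
qed

text \<open>Multiplication by the polynomial \<open>w\<close> with simple zeros on \<open>K\<close>
  gives a function that extends continuously by 0, because the bound keeps \<open>U\<close> bounded
  near \<open>K\<close>. The product is thus entire and of polynomial growth, hence a polynomial of
  degree at most \<open>k + card K\<close>; it vanishes on \<open>K\<close>, and division by
  \<open>w\<close> brings the degree down to \<open>k\<close>.\<close>

lemma entire_extension_poly:
  fixes U :: "complex \<Rightarrow> complex"
  assumes K: "finite K" and hol: "U holomorphic_on - K"
    and bd: "\<And>z. z \<notin> K \<Longrightarrow> norm (U z) \<le> B * (1 + norm z) ^ k"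
  obtains p where "degree p \<le> k" "\<And>z. z \<notin> K \<Longrightarrow> U z = poly p z"
proof -
  define w where "w = (\<Prod>a\<in>K. [:-a, 1:])"
  have w: "poly w z = 0 \<longleftrightarrow> z \<in> K" for z
    using K by (auto simp: w_def poly_prod)
  have degw: "degree w = card K"
    unfolding w_def by (subst degree_prod_eq_sum_degree) auto
  have monic: "lead_coeff w = 1" unfolding w_def by (simp add: lead_coeff_prod)
  have w0: "w \<noteq> 0" using monic by auto
  define B' where "B' = \<bar>B\<bar>"
  have bd': "norm (U z) \<le> B' * (1 + norm z) ^ k" if "z \<notin> K" for z
    by (rule order_trans[OF bd[OF that]]) (auto simp: B'_def intro!: mult_right_mono)
  define h where "h = (\<lambda>z. if z \<in> K then 0 else U z * poly w z)"
  have normw: "norm (poly w z) \<le> (\<Prod>a\<in>K. norm a + norm z)" for z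
    unfolding w_def poly_prod
    by (intro order_trans[OF norm_prod_le[of "\<lambda>a. poly [:-a,1:] z" K]] prod_mono)
       (auto intro: norm_triangle_le_diff norm_triangle_ineq4 order_trans[OF norm_triangle_ineq4] simp: add.commute)
  have hbd: "norm (h z) \<le> B' * (1 + norm z) ^ k * norm (poly w z)" for z
    using bd' by (auto simp: h_def norm_mult B'_def intro!: mult_right_mono)
  have hhol: "h holomorphic_on UNIV"
  proof (rule no_isolated_singularity[OF _ _ open_UNIV K])
    have "(\<lambda>z. U z * poly w z) holomorphic_on - K"
      by (intro holomorphic_intros hol)
    then have hK: "h holomorphic_on - K"
      by (rule holomorphic_transform) (auto simp: h_def)
    then show "h holomorphic_on UNIV - K" by (simp add: Compl_eq_Diff_UNIV)
    show "continuous_on UNIV h"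
    proof (clarsimp simp: continuous_on_eq_continuous_at)
      fix z
      show "isCont h z"
      proof (cases "z \<in> K")
        case False
        then show ?thesis
          using hK K finite_imp_closed[OF K]
          by (meson ComplI holomorphic_on_imp_continuous_on continuous_on_eq_continuous_at open_Compl)
      next
        case True
        have "((\<lambda>y. B' * (1 + norm y) ^ k * norm (poly w y)) \<longlongrightarrow> B' * (1 + norm z) ^ k * norm (poly w z)) (at z)"
          by (intro tendsto_intros)
        then have "((\<lambda>y. B' * (1 + norm y) ^ k * norm (poly w y)) \<longlongrightarrow> 0) (at z)"
          using w[of z] True by simp
        then have "(h \<longlongrightarrow> 0) (at z)"
          by (rule Lim_null_comparison[rotated]) (use hbd in auto)
        then show ?thesis using True by (simp add: isCont_def h_def)
      qed
    qed
  qed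
  define N where "N = k + card K"
  \<comment> \<open>Beyond this radius each \<open>norm a\<close> and 1 are at most
    \<open>norm z\<close>, so every factor of \<open>w\<close> and also \<open>1 + norm z\<close> is
    bounded by \<open>2 * norm z\<close>.\<close>
  define A where "A = 1 + (\<Sum>a\<in>K. norm a)"
  have A1: "A \<ge> 1" by (auto simp: A_def intro: sum_nonneg)
  have big: "norm (h z) \<le> (B' * 2 ^ N) * norm z ^ N" if "A \<le> norm z" for z
  proof -
    have z1: "1 \<le> norm z" using that A1 by simp
    have "norm (poly w z) \<le> (\<Prod>a\<in>K. 2 * norm z)"
    proof (rule order_trans[OF normw prod_mono])
      fix a assume "a \<in> K"
      then have "norm a \<le> (\<Sum>a\<in>K. norm a)" using K by (intro member_le_sum) auto
      then show "0 \<le> norm a + norm z \<and> norm a + norm z \<le> 2 * norm z"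
        using that by (simp add: A_def)
    qed
    also have "\<dots> = (2 * norm z) ^ card K" by simp
    finally have w2: "norm (poly w z) \<le> (2 * norm z) ^ card K" .
    have "norm (h z) \<le> B' * (1 + norm z) ^ k * norm (poly w z)" by (rule hbd)
    also have "\<dots> \<le> B' * (2 * norm z) ^ k * (2 * norm z) ^ card K"
      by (intro mult_mono mult_nonneg_nonneg power_mono w2) (use z1 in \<open>auto simp: B'_def\<close>)
    also have "\<dots> = (B' * 2 ^ N) * norm z ^ N"
      by (simp add: N_def power_add power_mult_distrib)
    finally show ?thesis .
  qed
  define p1 where "p1 = (\<Sum>j\<le>N. monom ((deriv^^j) h 0 / fact j) j)"
  have hp: "h z = poly p1 z" for z
    using Liouville_polynomial[of h A "B' * 2 ^ N" N z] hhol big by (simp add: p1_def poly_sum poly_monom)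
  have degp1: "degree p1 \<le> N"
    unfolding p1_def by (intro degree_sum_le order_trans[OF degree_monom_le]) auto
  have "w dvd p1"
    unfolding w_def by (rule prod_linear_dvd[OF K]) (metis hp h_def)
  then obtain p where p: "p1 = w * p" by (elim dvdE)
  show ?thesis
  proof (rule that[of p])
    show "degree p \<le> k"
    proof (cases "p = 0")
      case False
      then have "degree p1 = card K + degree p" using p w0 degw by (simp add: degree_mult_eq)
      then show ?thesis using degp1 by (simp add: N_def)
    qed auto
    show "U z = poly p z" if "z \<notin> K" for z
      using hp[of z] p w[of z] that by (simp add: h_def)
  qed
qed

text \<open>Far out, \<open>norm (poly P w)\<close> is at least half the size of its leading term,
  and everywhere it is at most a constant times \<open>(1 + norm z) ^ n\<close>. Points with the
  same value are therefore of comparable size, which bounds all branches in terms of one.\<close>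

lemma poly_fibre_growth:
  fixes P :: "complex poly"
  assumes "degree P > 0"
  obtains B where "B \<ge> 0" "\<And>z w. poly P z = poly P w \<Longrightarrow> norm w \<le> B * (1 + norm z)"
proof -
  define n where "n = degree P"
  define S where "S = (\<Sum>i<n. norm (coeff P i))"
  define C where "C = (\<Sum>i\<le>n. norm (coeff P i))"
  define l where "l = norm (lead_coeff P)"
  have n: "n > 0" and l: "l > 0" using assms by (auto simp: n_def l_def)
  have S0: "S \<ge> 0" and C0: "C \<ge> 0" by (auto simp: S_def C_def intro: sum_nonneg)
  define R where "R = max 1 (2 * S / l)"
  \<comment> \<open>A value of at least 1 gives \<open>D \<le> D ^ n\<close>, so the n-th root of
    the estimate can be taken without a root of the constant.\<close>
  define D where "D = max 1 (2 * C / l)"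
  have upper: "norm (poly P z) \<le> C * (1 + norm z) ^ n" for z
  proof -
    have "norm (poly P z) \<le> (\<Sum>i\<le>n. norm (coeff P i) * norm z ^ i)"
      unfolding poly_altdef n_def
      by (rule order_trans[OF norm_sum]) (simp add: norm_mult norm_power)
    also have "\<dots> \<le> (\<Sum>i\<le>n. norm (coeff P i) * (1 + norm z) ^ n)"
    proof (intro sum_mono mult_left_mono)
      fix i assume "i \<in> {..n}"
      have "norm z ^ i \<le> (1 + norm z) ^ i" by (intro power_mono) auto
      also have "\<dots> \<le> (1 + norm z) ^ n" using \<open>i \<in> {..n}\<close> by (intro power_increasing) auto
      finally show "norm z ^ i \<le> (1 + norm z) ^ n" .
    qed auto
    finally show ?thesis by (simp add: C_def sum_distrib_right)
  qed
  have lower: "l / 2 * norm w ^ n \<le> norm (poly P w)" if w: "norm w \<ge> R" for w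
  proof -
    have w1: "norm w \<ge> 1" using w by (simp add: R_def)
    define r where "r = (\<Sum>i<n. coeff P i * w ^ i)"
    have "poly P w = r + lead_coeff P * w ^ n"
      unfolding poly_altdef r_def n_def lessThan_Suc_atMost[symmetric] by simp
    then have "norm (lead_coeff P * w ^ n) - norm r \<le> norm (poly P w)"
      by (metis add.commute norm_diff_ineq)
    moreover have "norm r \<le> l / 2 * norm w ^ n"
    proof -
      have "norm r \<le> (\<Sum>i<n. norm (coeff P i) * norm w ^ i)"
        unfolding r_def by (rule order_trans[OF norm_sum]) (simp add: norm_mult norm_power)
      also have "\<dots> \<le> (\<Sum>i<n. norm (coeff P i) * norm w ^ (n - 1))"
        using w1 by (intro sum_mono mult_left_mono power_increasing) auto
      also have "\<dots> = S * norm w ^ (n - 1)" by (simp add: S_def sum_distrib_right)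
      also have "\<dots> \<le> (l / 2 * norm w) * norm w ^ (n - 1)"
        using w l by (intro mult_right_mono) (auto simp: R_def field_simps)
      also have "\<dots> = l / 2 * norm w ^ n"
        using n by (cases n) auto
      finally show ?thesis .
    qed
    moreover have "norm (lead_coeff P * w ^ n) = l * norm w ^ n"
      by (simp add: norm_mult norm_power l_def)
    ultimately show ?thesis by linarith
  qed
  show ?thesis
  proof (rule that[of "max R D"])
    show "max R D \<ge> 0" by (simp add: R_def le_max_iff_disj)
    fix z w assume eq: "poly P z = poly P w"
    show "norm w \<le> max R D * (1 + norm z)"
    proof (cases "norm w \<ge> R")
      case True
      have "l / 2 * norm w ^ n \<le> C * (1 + norm z) ^ n"
        using lower[OF True] upper[of z] eq by simp
      then have "norm w ^ n \<le> (2 * C / l) * (1 + norm z) ^ n"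
        using l by (simp add: field_simps)
      also have "\<dots> \<le> D * (1 + norm z) ^ n" by (intro mult_right_mono) (auto simp: D_def)
      also have "\<dots> \<le> D ^ n * (1 + norm z) ^ n"
        using n self_le_power[of D n] by (intro mult_right_mono) (auto simp: D_def)
      finally have "norm w ^ n \<le> (D * (1 + norm z)) ^ n" by (simp add: power_mult_distrib)
      then have "norm w \<le> D * (1 + norm z)"
        using n by (subst (asm) power_mono_iff) (auto simp: D_def)
      also have "\<dots> \<le> max R D * (1 + norm z)" by (intro mult_right_mono) auto
      finally show ?thesis .
    next
      case False
      have "1 \<le> max R D" by (simp add: R_def)
      have "norm w \<le> max R D * 1" using False by simp
      also have "\<dots> \<le> max R D * (1 + norm z)" using \<open>1 \<le> max R D\<close> by (intro mult_left_mono) auto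
      finally show ?thesis .
    qed
  qed
qed

section \<open>The monodromy group, permanence of relations, and equivariant functions\<close>

context fibre_markings
begin

lemma finite_irregular: "finite {z. \<not> regular (poly P z)}"
proof -
  have "pderiv P \<noteq> 0" using degP by (simp add: pderiv_eq_0_iff)
  then have "finite {z. poly (pderiv P) z = 0}" by (rule poly_roots_finite)
  moreover have "t \<in> X \<union> poly P ` {z. poly (pderiv P) z = 0}" if "\<not> regular t" for t
    using that critical_of_small_fibre[OF degP, of t] by (auto simp: regular_def \<Omega>_def)
  then have "{t. \<not> regular t} \<subseteq> X \<union> poly P ` {z. poly (pderiv P) z = 0}"
    by blast
  ultimately have "finite {t. \<not> regular t}"
    using finX by (meson finite_UnI finite_imageI finite_subset)
  then have "finite (\<Union>t\<in>{t. \<not> regular t}. \<Omega> t)" using finite_\<Omega> by blast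
  then show ?thesis by (rule finite_subset[rotated]) (auto simp: \<Omega>_def)
qed

lemma regular_t0: "regular t0"
  using marking_m0 marking_regular by blast

text \<open>The lifting is done over the z-plane without the finitely many irregular points, with
  \<open>P\<close> as base map and the identity as lift. Connectedness of this set is what makes the
  monodromy transitive.\<close>

lemma reach_through:
  assumes "regular (poly P z)" "i \<in> I"
  obtains m where "reach m" "marking m (poly P z)" "m i = z"
proof -
  define E where "E = {z. regular (poly P z)}"
  have "E = - {z. \<not> regular (poly P z)}" by (auto simp: E_def)
  then have conn: "connected E"
    using path_connected_complement_countable[OF _ countable_finite[OF finite_irregular]]
    by (simp add: path_connected_imp_connected)
  show ?thesis
  proof (rule lift_connected[of E "{i}" "poly P" "\<lambda>_ z. z" "m0 i" z m0])
    show "m0 i \<in> E" using P_m0[OF assms(2)] regular_t0 by (simp add: E_def)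
    show "marking m0 (poly P (m0 i))" using P_m0[OF assms(2)] marking_m0 by simp
    fix m' assume "reach m'" "marking m' (poly P z)" "\<And>j. j \<in> {i} \<Longrightarrow> m' j = z"
    then show thesis using that by blast
  qed (use assms conn in \<open>auto simp: E_def intro!: continuous_intros\<close>)
qed

text \<open>The monodromy group, acting on labels. Relabelling commutes with continuation, so
  \<open>G\<close> acts on every reached marking and not only on the base one.\<close>

definition G :: "('i \<Rightarrow> 'i) set" where
  "G = {g. g permutes I \<and> reach (m0 \<circ> g)}"

lemma finite_G: "finite G"
  by (rule finite_subset[OF _ finite_permutations[OF finI]]) (auto simp: G_def)

lemma G_permutes: "g \<in> G \<Longrightarrow> g permutes I"
  by (simp add: G_def)

lemma G_in: "g \<in> G \<Longrightarrow> g i \<in> I \<longleftrightarrow> i \<in> I"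
  by (rule permutes_in_image[OF G_permutes])

lemma G_id: "id \<in> G"
  by (simp add: G_def permutes_id)

lemma reach_comp: "g \<in> G \<Longrightarrow> reach m \<Longrightarrow> reach (m \<circ> g)"
  using continuable_comp[of m0 m g] by (auto simp: G_def intro: rtranclp_trans)

lemma G_comp: "g \<in> G \<Longrightarrow> h \<in> G \<Longrightarrow> g \<circ> h \<in> G"
  using reach_comp[of h "m0 \<circ> g"] by (auto simp: G_def permutes_compose o_assoc)

lemma G_inv: assumes "g \<in> G" shows "inv g \<in> G"
proof -
  have g: "g permutes I" "reach (m0 \<circ> g)" using assms by (auto simp: G_def)
  have "continuable (m0 \<circ> inv g) (m0 \<circ> g \<circ> inv g)"
    using continuable_comp[OF g(2) permutes_inv[OF g(1)]] .
  then have "continuable (m0 \<circ> inv g) m0"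
    using permutes_inv_o(1)[OF g(1)] by (simp add: comp_assoc)
  then show ?thesis using continuable_sym permutes_inv[OF g(1)] by (simp add: G_def)
qed

text \<open>The relabelling \<open>g\<close> that takes \<open>m\<close> to \<open>m'\<close> exists
  because both are bijections onto the same fibre. Continuing \<open>m \<circ> g\<close> back to the
  base shows that \<open>m0 \<circ> g\<close> is reached.\<close>

lemma same_fibre:
  assumes "reach m" "reach m'" "marking m t" "marking m' t"
  obtains g where "g \<in> G" "\<And>i. i \<in> I \<Longrightarrow> m' i = m (g i)"
proof -
  define g where "g = (\<lambda>i. if i \<in> I then the_inv_into I m (m' i) else i)"
  have b: "bij_betw m I (\<Omega> t)" and b': "bij_betw m' I (\<Omega> t)"
    using assms marking_bij by auto
  have mg: "m (g i) = m' i" if "i \<in> I" for i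
    using b b' that unfolding g_def by (simp add: f_the_inv_into_f_bij_betw bij_betw_apply)
  have "bij_betw (the_inv_into I m \<circ> m') I I"
    by (rule bij_betw_trans[OF b' bij_betw_the_inv_into[OF b]])
  then have "bij_betw g I I"
    by (rule bij_betw_cong[THEN iffD1, rotated]) (simp add: g_def)
  then have g: "g permutes I"
    by (rule bij_imp_permutes) (simp add: g_def)
  have "continuable (m0 \<circ> g) (m \<circ> g)" using continuable_comp[OF assms(1) g] .
  moreover have "reach (m \<circ> g)" by (rule continuable_cong[OF assms(2)]) (simp add: mg)
  ultimately have "reach (m0 \<circ> g)" using continuable_sym by (meson rtranclp_trans)
  then show ?thesis using that g mg by (simp add: G_def)
qed

lemma G_transitive:
  assumes "i \<in> I" "j \<in> I"
  obtains g where "g \<in> G" "g i = j"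
proof -
  have P: "poly P (m0 j) = t0" using P_m0 assms by simp
  then obtain m where m: "reach m" "marking m t0" "m i = m0 j"
    using reach_through[of "m0 j" i] regular_t0 assms(1) by auto
  obtain g where g: "g \<in> G" "\<And>k. k \<in> I \<Longrightarrow> m k = m0 (g k)"
    using same_fibre[of m0 m t0] m marking_m0 by blast
  have "m0 (g i) = m0 j" using g(2)[OF assms(1)] m(3) by simp
  then have "g i = j" using inj_m0 G_in[OF g(1)] assms by (auto dest: inj_onD)
  with g(1) that show ?thesis by blast
qed

lemma family_marking: "family \<phi> c r \<Longrightarrow> s \<in> ball c r \<Longrightarrow> marking (\<lambda>i. \<phi> i s) s"
  by (simp add: family_def)

lemma family_reach:
  assumes "family \<phi> c r" "t \<in> ball c r" "\<And>i. i \<in> I \<Longrightarrow> \<phi> i t = m i" "reach m" "s \<in> ball c r"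
  shows "reach (\<lambda>i. \<phi> i s)"
proof -
  have "step m (\<lambda>i. \<phi> i s)"
    by (rule step_family[OF assms(1,2,5)]) (use assms(3) in auto)
  then show ?thesis using assms(4) by (rule rtranclp.rtrancl_into_rtrancl[rotated])
qed

lemma family_germ:
  assumes \<phi>: "family \<phi> c r" "t \<in> ball c r" "i \<in> I"
    and ev: "\<forall>\<^sub>F z in nhds (\<phi> i t). \<psi> (poly P z) = z"
  shows "\<forall>\<^sub>F s in nhds t. \<phi> i s = \<psi> s"
proof -
  have "\<phi> i holomorphic_on ball c r" using \<phi> by (simp add: family_def)
  then have "filterlim (\<phi> i) (nhds (\<phi> i t)) (nhds t)"
    using \<phi>(2) by (intro isCont_filterlim_nhds holomorphic_isCont) auto
  then have e1: "\<forall>\<^sub>F s in nhds t. \<psi> (poly P (\<phi> i s)) = \<phi> i s"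
    by (rule eventually_compose_filterlim[OF ev])
  have e2: "\<forall>\<^sub>F s in nhds t. s \<in> ball c r"
    using \<phi>(2) by (intro eventually_nhds_in_open) auto
  show ?thesis
    using e1 e2 by eventually_elim (use marking_value[OF family_marking[OF \<phi>(1)] \<phi>(3)] in simp)
qed

text \<open>Near \<open>t\<close> both branches coincide with the local inverse of \<open>P\<close>
  at their common value.\<close>

lemma families_agree:
  assumes "family \<phi> c r" "family \<phi>' c' r'" "t \<in> ball c r" "t \<in> ball c' r'"
    and eq: "\<And>i. i \<in> I \<Longrightarrow> \<phi> i t = \<phi>' i t" and i: "i \<in> I"
  shows "\<forall>\<^sub>F s in nhds t. \<phi> i s = \<phi>' i s"
proof -
  have mt: "marking (\<lambda>i. \<phi> i t) t" using family_marking assms by blast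
  obtain r0 \<psi> where "\<And>z. z \<in> \<Omega> t \<Longrightarrow> \<forall>\<^sub>F z' in nhds z. \<psi> z (poly P z') = z'"
    by (rule local_chart[OF marking_regular[OF mt]]) (rule that; assumption)
  moreover have "\<phi> i t \<in> \<Omega> t" using mt i by (simp add: marking_def \<Omega>_def)
  ultimately have ev: "\<forall>\<^sub>F z in nhds (\<phi> i t). \<psi> (\<phi> i t) (poly P z) = z" by blast
  have "\<forall>\<^sub>F s in nhds t. \<phi> i s = \<psi> (\<phi> i t) s"
    by (rule family_germ[OF assms(1,3) i ev])
  moreover have "\<forall>\<^sub>F s in nhds t. \<phi>' i s = \<psi> (\<phi> i t) s"
    by (rule family_germ[OF assms(2,4) i]) (use ev in \<open>simp add: eq[OF i]\<close>)
  ultimately show ?thesis by eventually_elim simp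
qed

text \<open>Analytic continuation in abstract form: a property of families that passes between
  overlapping families with a common germ holds along every continuation.\<close>

lemma continuation:
  assumes transfer: "\<And>\<phi> c r \<phi>' c' r' t. family \<phi> c r \<Longrightarrow> family \<phi>' c' r' \<Longrightarrow>
      t \<in> ball c r \<Longrightarrow> t \<in> ball c' r' \<Longrightarrow>
      (\<And>i. i \<in> I \<Longrightarrow> \<forall>\<^sub>F s in nhds t. \<phi> i s = \<phi>' i s) \<Longrightarrow> A \<phi> c r \<Longrightarrow> A \<phi>' c' r'"
    and start: "family \<phi> c r" "t \<in> ball c r" "reach (\<lambda>i. \<phi> i t)" "A \<phi> c r"
    and goal: "family \<phi>' c' r'" "t' \<in> ball c' r'" "reach (\<lambda>i. \<phi>' i t')"
  shows "A \<phi>' c' r'"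
proof -
  \<comment> \<open>Quantifying over all families through \<open>m\<close> makes the property depend
    on the marking alone, so that it can be passed along \<open>step\<close>.\<close>
  define B where "B = (\<lambda>m. \<forall>\<phi> c r t. family \<phi> c r \<longrightarrow> t \<in> ball c r \<longrightarrow> (\<forall>i\<in>I. \<phi> i t = m i) \<longrightarrow> A \<phi> c r)"
  have here: "B m" if "family \<phi> c r" "t \<in> ball c r" "\<forall>i\<in>I. \<phi> i t = m i" "A \<phi> c r" for m \<phi> c r t
    unfolding B_def
  proof (intro allI impI)
    fix \<psi> d u s assume *: "family \<psi> d u" "s \<in> ball d u" "\<forall>i\<in>I. \<psi> i s = m i"
    have "marking m t" "marking m s"
      using that(3) *(3) family_marking[OF that(1,2)] family_marking[OF *(1,2)]
      by (metis (no_types, lifting) marking_cong)+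
    then have "s = t" using marking_unique by blast
    then show "A \<psi> d u"
      using transfer[OF that(1) *(1) that(2)] families_agree[OF that(1) *(1) that(2)] * that(3,4) by simp
  qed
  have stepB: "B m'" if Bm: "B m" and st: "step m m'" for m m'
  proof -
    obtain \<phi> c r t t' where *: "family \<phi> c r" "t \<in> ball c r" "t' \<in> ball c r"
      "\<forall>i\<in>I. m i = \<phi> i t \<and> m' i = \<phi> i t'"
      using st unfolding step_def by blast
    then have "A \<phi> c r" using Bm unfolding B_def by metis
    then show ?thesis using here[OF *(1,3)] * by auto
  qed
  have "continuable (\<lambda>i. \<phi> i t) (\<lambda>i. \<phi>' i t')"
    using start(3) goal(3) continuable_sym by (meson rtranclp_trans)
  then have "B (\<lambda>i. \<phi>' i t')"
    by (induction rule: rtranclp_induct) (use here[OF start(1,2) _ start(4)] stepB in auto)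
  then show ?thesis using goal unfolding B_def by blast
qed

text \<open>Permanence of analytic relations: on overlapping discs with a common germ the identity
  theorem carries the vanishing of \<open>F\<close> from one disc to the next.\<close>

lemma relation_continues:
  assumes hol: "\<And>\<phi> c r. family \<phi> c r \<Longrightarrow> (\<lambda>s. F (\<lambda>i. \<phi> i s)) holomorphic_on ball c r"
    and cong: "\<And>m m'. (\<And>i. i \<in> I \<Longrightarrow> m i = m' i) \<Longrightarrow> F m = F m'"
    and start: "family \<phi> c r" "t \<in> ball c r" "reach (\<lambda>i. \<phi> i t)"
      "\<And>s. s \<in> ball c r \<Longrightarrow> F (\<lambda>i. \<phi> i s) = 0"
    and m: "reach m"
  shows "F m = (0::complex)"
proof -
  obtain t' where t': "marking m t'" using reach_marking[OF m] by blast
  obtain r' \<phi>' where \<phi>': "r' > 0" "family \<phi>' t' r'" "\<And>i. i \<in> I \<Longrightarrow> \<phi>' i t' = m i"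
    by (rule local_family[OF t']) (rule that; assumption)
  have t'b: "t' \<in> ball t' r'" using \<phi>'(1) by simp
  have r': "reach (\<lambda>i. \<phi>' i t')" by (rule continuable_cong[OF m]) (simp add: \<phi>'(3))
  have "\<forall>s\<in>ball t' r'. F (\<lambda>i. \<phi>' i s) = 0"
  proof (rule continuation[where A = "\<lambda>\<phi> c r. \<forall>s\<in>ball c r. F (\<lambda>i. \<phi> i s) = 0", OF _ start(1,2,3) _ \<phi>'(2) t'b r'])
    show "\<forall>s\<in>ball c r. F (\<lambda>i. \<phi> i s) = 0" using start(4) by blast
    fix \<phi> c r \<phi>' c' r' t
    assume *: "family \<phi> c r" "family \<phi>' c' r'" "t \<in> ball c r" "t \<in> ball c' r'"
      "\<And>i. i \<in> I \<Longrightarrow> \<forall>\<^sub>F s in nhds t. \<phi> i s = \<phi>' i s" "\<forall>s\<in>ball c r. F (\<lambda>i. \<phi> i s) = 0"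
    have "\<forall>\<^sub>F s in nhds t. \<forall>i\<in>I. \<phi> i s = \<phi>' i s"
      using *(5) by (intro eventually_ball_finite finI) auto
    moreover have "\<forall>\<^sub>F s in nhds t. s \<in> ball c r" using *(3) by (intro eventually_nhds_in_open) auto
    ultimately have "\<forall>\<^sub>F s in nhds t. F (\<lambda>i. \<phi>' i s) = 0"
    proof eventually_elim
      case (elim s)
      then have "F (\<lambda>i. \<phi>' i s) = F (\<lambda>i. \<phi> i s)" by (intro cong) auto
      then show ?case using *(6) elim by simp
    qed
    then have "F (\<lambda>i. \<phi>' i s) = 0" if "s \<in> ball c' r'" for s
      using holomorphic_zero_near[OF hol[OF *(2)] _ _ *(4)] that by auto
    then show "\<forall>s\<in>ball c' r'. F (\<lambda>i. \<phi>' i s) = 0" by blast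
  qed
  then have "F (\<lambda>i. \<phi>' i t') = 0" using t'b by blast
  moreover have "F (\<lambda>i. \<phi>' i t') = F m" by (rule cong) (simp add: \<phi>'(3))
  ultimately show ?thesis by simp
qed

text \<open>If \<open>m i\<close> and \<open>m' i'\<close> are the same point, both markings lie
  over the same value, so they differ by some \<open>g\<close> in \<open>G\<close> with
  \<open>g i' = i\<close>, and equivariance equates the two values of \<open>F\<close>. Thus
  \<open>F m i\<close> is a single-valued holomorphic function \<open>U\<close> of the point
  \<open>m i\<close> off a finite set, and its growth makes it a polynomial. This is applied with
  \<open>k\<close> the block size and with \<open>k = 1\<close>.\<close>

lemma equivariant_is_poly:
  assumes eqv: "\<And>g m i. g \<in> G \<Longrightarrow> reach m \<Longrightarrow> i \<in> I \<Longrightarrow> F (m \<circ> g) i = F m (g i)"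
    and cong: "\<And>m m' i. (\<And>i. i \<in> I \<Longrightarrow> m i = m' i) \<Longrightarrow> i \<in> I \<Longrightarrow> F m i = F m' i"
    and hol: "\<And>\<phi> c r i. family \<phi> c r \<Longrightarrow> i \<in> I \<Longrightarrow> (\<lambda>s. F (\<lambda>i. \<phi> i s) i) holomorphic_on ball c r"
    and bd: "\<And>m i. reach m \<Longrightarrow> i \<in> I \<Longrightarrow> norm (F m i) \<le> B * (1 + norm (m i)) ^ k"
  obtains p where "degree p \<le> k" "\<And>m i. reach m \<Longrightarrow> i \<in> I \<Longrightarrow> F m i = poly p (m i)"
proof -
  define K where "K = {z. \<not> regular (poly P z)}"
  define U where "U = (\<lambda>z. case (SOME (m, i). reach m \<and> i \<in> I \<and> m i = z) of (m, i) \<Rightarrow> F m i)"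
  have U: "U (m i) = F m i" if m: "reach m" "i \<in> I" for m i
  proof -
    define mi where "mi = (SOME (m', i'). reach m' \<and> i' \<in> I \<and> m' i' = m i)"
    have "case mi of (m', i') \<Rightarrow> reach m' \<and> i' \<in> I \<and> m' i' = m i"
      unfolding mi_def by (rule someI[of _ "(m, i)"]) (use m in auto)
    then obtain m' i' where mi: "mi = (m', i')" "reach m'" "i' \<in> I" "m' i' = m i"
      by (cases mi) auto
    obtain t t' where t: "marking m t" "marking m' t'" using reach_marking m(1) mi(2) by blast
    have "t = t'" using marking_value[OF t(1) m(2)] marking_value[OF t(2) mi(3)] mi(4) by simp
    then obtain g where g: "g \<in> G" "\<And>j. j \<in> I \<Longrightarrow> m' j = m (g j)"
      using same_fibre[OF m(1) mi(2) t(1)] t(2) by blast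
    have "m (g i') = m i" using g(2)[OF mi(3)] mi(4) by simp
    then have gi: "g i' = i"
      using t(1) G_in[OF g(1), of i'] mi(3) m(2) unfolding marking_def by (meson inj_onD)
    have "F m' i' = F (m \<circ> g) i'" using g(2) mi(3) by (intro cong) auto
    also have "\<dots> = F m i" using eqv[OF g(1) m(1) mi(3)] gi by simp
    finally show ?thesis unfolding U_def mi_def[symmetric] by (simp add: mi(1))
  qed
  obtain i0 where i0: "i0 \<in> I" using I_nonempty by blast
  have "\<exists>p. degree p \<le> k \<and> (\<forall>z. z \<notin> K \<longrightarrow> U z = poly p z)"
  proof (rule entire_extension_poly[of K U B k])
    show finK: "finite K" unfolding K_def by (rule finite_irregular)
    show "norm (U z) \<le> B * (1 + norm z) ^ k" if z: "z \<notin> K" for z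
    proof -
      obtain m where m: "reach m" "m i0 = z"
        using reach_through[of z i0] z i0 unfolding K_def by auto
      then show ?thesis using U[OF m(1) i0] bd[OF m(1) i0] by simp
    qed
    show "U holomorphic_on - K"
      unfolding holomorphic_on_def
    proof
      fix z assume z: "z \<in> - K"
      then obtain m where m: "reach m" "marking m (poly P z)" "m i0 = z"
        using reach_through[of z i0] i0 unfolding K_def by auto
      define t where "t = poly P z"
      obtain r0 \<psi> where \<psi>: "\<And>z. z \<in> \<Omega> t \<Longrightarrow> \<forall>\<^sub>F z' in nhds z. \<psi> z (poly P z') = z'"
        by (rule local_chart[OF marking_regular[OF m(2), folded t_def]]) (rule that; assumption)
      obtain r \<phi> where \<phi>: "r > 0" "family \<phi> t r" "\<And>i. i \<in> I \<Longrightarrow> \<phi> i t = m i"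
        by (rule local_family[OF m(2), folded t_def]) (rule that; assumption)
      have tb: "t \<in> ball t r" using \<phi>(1) by simp
      have z\<Omega>: "z \<in> \<Omega> t" by (simp add: \<Omega>_def t_def)
      have lim: "filterlim (poly P) (nhds t) (nhds z)"
        unfolding t_def by (rule isCont_filterlim_nhds[OF poly_isCont])
      have ev1: "\<forall>\<^sub>F z' in nhds z. \<psi> z (poly P z') = z'" by (rule \<psi>[OF z\<Omega>])
      have "\<forall>\<^sub>F s in nhds t. \<phi> i0 s = \<psi> z s"
        by (rule family_germ[OF \<phi>(2) tb i0]) (use ev1 in \<open>simp only: \<phi>(3)[OF i0] m(3)\<close>)
      then have ev2: "\<forall>\<^sub>F z' in nhds z. \<phi> i0 (poly P z') = \<psi> z (poly P z')"
        using lim by (rule eventually_compose_filterlim)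
      have ev3: "\<forall>\<^sub>F z' in nhds z. poly P z' \<in> ball t r"
        by (rule eventually_compose_filterlim[OF eventually_nhds_in_open[OF open_ball tb] lim])
      have ev: "\<forall>\<^sub>F z' in nhds z. U z' = F (\<lambda>i. \<phi> i (poly P z')) i0"
        using ev1 ev2 ev3
      proof eventually_elim
        case (elim z')
        have "reach (\<lambda>i. \<phi> i (poly P z'))" by (rule family_reach[OF \<phi>(2) tb \<phi>(3) m(1) elim(3)])
        from U[OF this i0] show ?case using elim by simp
      qed
      have "(\<lambda>s. F (\<lambda>i. \<phi> i s) i0) field_differentiable at (poly P z)"
        using hol[OF \<phi>(2) i0] tb unfolding t_def
        by (metis at_within_open holomorphic_on_def open_ball)
      then have "((\<lambda>s. F (\<lambda>i. \<phi> i s) i0) \<circ> poly P) field_differentiable at z"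
        by (intro field_differentiable_compose)
           (auto simp: field_differentiable_def intro: poly_DERIV)
      then obtain D where "((\<lambda>s. F (\<lambda>i. \<phi> i s) i0) \<circ> poly P has_field_derivative D) (at z)"
        by (auto simp: field_differentiable_def)
      then have "(U has_field_derivative D) (at z)"
        by (subst DERIV_cong_ev[OF refl _ refl]) (use ev in auto)
      then show "U field_differentiable at z within - K"
        by (meson field_differentiable_at_within field_differentiable_def)
    qed
  qed auto
  then obtain p where p: "degree p \<le> k" "\<And>z. z \<notin> K \<Longrightarrow> U z = poly p z" by blast
  show ?thesis
  proof (rule that[OF p(1)])
    fix m i assume m: "reach m" "i \<in> I"
    obtain t where t: "marking m t" using reach_marking[OF m(1)] by blast
    have "m i \<notin> K"
      using marking_regular[OF t] marking_value[OF t m(2)] by (simp add: K_def)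
    then show "F m i = poly p (m i)" using p(2) U[OF m] by simp
  qed
qed

end

section \<open>Blocks and right factors\<close>

text \<open>Expansion in powers of W - w0: the difference of \<open>h\<close> and its value on the
  full fibre over \<open>w0\<close> is divisible by W - w0, and the quotient is again constant on
  fibres, now away from \<open>w0\<close> as well. Its degree is smaller, and enlarging
  \<open>N\<close> by one value keeps it finite.\<close>

lemma constant_on_fibres_pcompose:
  fixes W h :: "complex poly"
  assumes degW: "degree W > 0" and "finite N"
    and full: "\<And>w. w \<notin> N \<Longrightarrow> card {z. poly W z = w} = degree W"
    and const: "\<And>z z'. poly W z = poly W z' \<Longrightarrow> poly W z \<notin> N \<Longrightarrow> poly h z = poly h z'"
  shows "\<exists>h'. h = pcompose h' W"
  using assms(2-)
proof (induction "degree h" arbitrary: h N rule: less_induct)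
  case less
  obtain w0 where w0: "w0 \<notin> N" using ex_new_if_finite[OF infinite_UNIV_char_0 less.prems(1)] by blast
  define S0 where "S0 = {z. poly W z = w0}"
  have fin: "finite S0" unfolding S0_def by (rule finite_poly_fibre[OF degW])
  have cardS0: "card S0 = degree W" unfolding S0_def by (rule less.prems(2)[OF w0])
  then obtain z0 where z0: "z0 \<in> S0" using degW by (metis card.empty ex_in_conv less_irrefl)
  define \<pi> where "\<pi> = (\<Prod>s\<in>S0. [:-s, 1:])"
  have deg\<pi>: "degree \<pi> = degree W" and lc\<pi>: "lead_coeff \<pi> = 1"
    unfolding \<pi>_def by (subst degree_prod_eq_sum_degree) (auto simp: cardS0 lead_coeff_prod)
  define l where "l = lead_coeff W"
  have l: "l \<noteq> 0" using degW by (auto simp: l_def)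
  have "W - [:w0:] \<noteq> 0" using degW by auto
  then have "W - [:w0:] = smult (lead_coeff (W - [:w0:])) \<pi>"
    unfolding \<pi>_def
    by (rule poly_eq_prod_roots[OF _ fin]) (auto simp: degree_minus_const cardS0, simp add: S0_def)
  moreover have "lead_coeff (W - [:w0:]) = l"
    using degW by (simp add: l_def degree_minus_const coeff_pCons split: nat.split)
  ultimately have W0: "W - [:w0:] = smult l \<pi>" by simp
  have "\<pi> dvd h - [:poly h z0:]"
    unfolding \<pi>_def
    by (rule prod_linear_dvd[OF fin]) (use less.prems(3) w0 z0 in \<open>auto simp: S0_def\<close>)
  then obtain q where q: "h - [:poly h z0:] = \<pi> * q" by (elim dvdE)
  then have h: "h = [:poly h z0:] + \<pi> * q" by (metis add.commute diff_add_cancel)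
  show ?case
  proof (cases "q = 0")
    case True
    then have "h = [:poly h z0:]" using h by simp
    then show ?thesis by (metis pcompose_const)
  next
    case False
    have "\<pi> \<noteq> 0" using lc\<pi> by auto
    have "degree (\<pi> * q) = degree W + degree q"
      using False \<open>\<pi> \<noteq> 0\<close> deg\<pi> by (simp add: degree_mult_eq)
    then have "degree h = degree W + degree q"
      using h degW by (metis add_gr_0 degree_add_eq_right degree_pCons_0)
    then have "degree q < degree h" using degW by simp
    moreover have "poly q z = poly q z'"
      if "poly W z = poly W z'" "poly W z \<notin> insert w0 N" for z z'
    proof -
      have *: "poly \<pi> x * l = poly W x - w0" for x
        using arg_cong[OF W0, of "\<lambda>p. poly p x"] by simp
      have eq: "poly h x - poly h z0 = poly \<pi> x * poly q x" for x
        using arg_cong[OF q, of "\<lambda>p. poly p x"] by simp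
      have "poly \<pi> z * l = poly \<pi> z' * l" using *[of z] *[of z'] that(1) by simp
      moreover have "poly \<pi> z \<noteq> 0" using *[of z] that(2) by auto
      moreover have "poly h z = poly h z'" using less.prems(3) that by blast
      ultimately show ?thesis using l eq[of z] eq[of z'] by simp
    qed
    ultimately obtain q' where q': "q = pcompose q' W"
      using less.hyps[of q "insert w0 N"] less.prems(1,2) by blast
    have "\<pi> = pcompose (smult (1 / l) [:-w0, 1:]) W"
    proof -
      have "W - [:w0:] = pcompose [:-w0, 1:] W" by (simp add: pcompose_pCons)
      then have "smult l \<pi> = pcompose [:-w0, 1:] W" using W0 by simp
      then show ?thesis using l by (metis nonzero_divide_eq_eq one_neq_zero pcompose_smult smult_1_left smult_smult times_divide_eq_left mult.commute)
    qed
    then have "h = pcompose ([:poly h z0:] + smult (1 / l) [:-w0, 1:] * q') W"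
      using h q' by (metis pcompose_add pcompose_const pcompose_mult)
    then show ?thesis by blast
  qed
qed

context fibre_markings
begin

definition G_equivalence :: "('i \<Rightarrow> 'i \<Rightarrow> bool) \<Rightarrow> bool" where
  "G_equivalence R \<longleftrightarrow> (\<forall>i\<in>I. R i i) \<and> (\<forall>i\<in>I. \<forall>j\<in>I. R i j \<longrightarrow> R j i) \<and>
     (\<forall>i\<in>I. \<forall>j\<in>I. \<forall>k\<in>I. R i j \<longrightarrow> R j k \<longrightarrow> R i k) \<and>
     (\<forall>g\<in>G. \<forall>i\<in>I. \<forall>j\<in>I. R i j \<longrightarrow> R (g i) (g j))"

text \<open>The condition on the degree ensures that a block fills a whole fibre of \<open>W\<close>
  instead of being merely contained in one.\<close>

definition block_factor :: "complex poly \<Rightarrow> ('i \<Rightarrow> 'i \<Rightarrow> bool) \<Rightarrow> bool" where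
  "block_factor W R \<longleftrightarrow> degree W > 0 \<and> (\<forall>i\<in>I. degree W = card {j\<in>I. R i j}) \<and>
     (\<forall>m. reach m \<longrightarrow> (\<forall>i\<in>I. \<forall>j\<in>I. poly W (m i) = poly W (m j) \<longleftrightarrow> R i j))"

lemma block_factorD:
  assumes "block_factor W R"
  shows "degree W > 0" "i \<in> I \<Longrightarrow> degree W = card {j\<in>I. R i j}"
    "reach m \<Longrightarrow> i \<in> I \<Longrightarrow> j \<in> I \<Longrightarrow> poly W (m i) = poly W (m j) \<longleftrightarrow> R i j"
  using assms unfolding block_factor_def by blast+

lemma block_fibre:
  assumes "block_factor W R" and m: "reach m" "i \<in> I"
  shows "inj_on m {j\<in>I. R i j}" "m ` {j\<in>I. R i j} = {z. poly W z = poly W (m i)}"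
proof -
  note W = block_factorD[OF assms(1)]
  show inj: "inj_on m {j\<in>I. R i j}" by (rule inj_on_subset[OF reach_inj[OF m(1)]]) auto
  have sub: "m ` {j\<in>I. R i j} \<subseteq> {z. poly W z = poly W (m i)}"
  proof safe
    fix j assume "j \<in> I" "R i j"
    then show "poly W (m j) = poly W (m i)" using W(3)[OF m, of j] by simp
  qed
  show "m ` {j\<in>I. R i j} = {z. poly W z = poly W (m i)}"
    using card_seteq[OF finite_poly_fibre[OF W(1)] sub] card_poly_fibre_le[OF W(1), of "poly W (m i)"]
      card_image[OF inj] W(2)[OF m(2)] by simp
qed

text \<open>A block system of the monodromy group comes from a right factor \<open>W\<close> of \<open>P\<close>: take the
  value at a suitable \<open>\<xi>\<close> of the monic polynomial whose roots are the members of a block.\<close>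

lemma block_polynomial:
  assumes R: "G_equivalence R"
  obtains W where "block_factor W R"
proof -
  define cls where "cls = (\<lambda>i. {j\<in>I. R i j})"
  have Rr: "R i i" if "i \<in> I" for i using R that unfolding G_equivalence_def by blast
  have Rs: "R j i" if "i \<in> I" "j \<in> I" "R i j" for i j
    using R that unfolding G_equivalence_def by blast
  have Rt: "R i k" if "i \<in> I" "j \<in> I" "k \<in> I" "R i j" "R j k" for i j k
    using R that unfolding G_equivalence_def by blast
  have Rg: "R (g i) (g j)" if "g \<in> G" "i \<in> I" "j \<in> I" "R i j" for g i j
    using R that unfolding G_equivalence_def by blast
  have finc: "finite (cls i)" for i using finI by (simp add: cls_def)
  have gcls: "g ` cls i = cls (g i)" if g: "g \<in> G" and i: "i \<in> I" for g i
  proof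
    show "g ` cls i \<subseteq> cls (g i)"
      using Rg[OF g i] G_in[OF g] by (auto simp: cls_def)
    show "cls (g i) \<subseteq> g ` cls i"
    proof
      fix j assume j: "j \<in> cls (g i)"
      have ig: "inv g \<in> G" by (rule G_inv[OF g])
      have b: "bij g" using G_permutes[OF g] permutes_bij by blast
      have "R (inv g (g i)) (inv g j)"
        using Rg[OF ig, of "g i" j] j G_in[OF g] i by (auto simp: cls_def)
      then have "inv g j \<in> cls i"
        using j G_in[OF ig, of j] b by (simp add: cls_def bij_is_inj)
      then show "j \<in> g ` cls i" using b by (metis bij_inv_eq_iff image_eqI)
    qed
  qed
  have injg: "inj_on g S" if "g \<in> G" for g S
    using G_permutes[OF that] permutes_inj inj_on_subset by blast
  obtain i0 where i0: "i0 \<in> I" using I_nonempty by blast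
  define k where "k = card (cls i0)"
  have kcls: "card (cls i) = k" if i: "i \<in> I" for i
  proof -
    obtain g where g: "g \<in> G" "g i0 = i" using G_transitive[OF i0 i] by blast
    have "card (cls i) = card (g ` cls i0)" using gcls[OF g(1) i0] g(2) by simp
    then show ?thesis using card_image[OF injg[OF g(1)]] by (simp add: k_def)
  qed
  obtain B where B: "B \<ge> 0" "\<And>z w. poly P z = poly P w \<Longrightarrow> norm w \<le> B * (1 + norm z)"
    using poly_fibre_growth[OF degP] by blast
  \<comment> \<open>Since \<xi> lies over a regular value, some continuation brings a branch to
    \<xi>, where the product over its block vanishes; at \<open>m0\<close> no factor vanishes. Hence
    the polynomial obtained is not constant.\<close>
  have "finite ({z. \<not> regular (poly P z)} \<union> m0 ` I)" using finite_irregular finI by simp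
  then obtain \<xi> where \<xi>: "regular (poly P \<xi>)" "\<xi> \<notin> m0 ` I"
    using ex_new_if_finite[OF infinite_UNIV_char_0] by blast
  define F where "F = (\<lambda>m i. \<Prod>j\<in>cls i. \<xi> - m j)"
  have "\<exists>p. degree p \<le> k \<and> (\<forall>m i. reach m \<longrightarrow> i \<in> I \<longrightarrow> F m i = poly p (m i))"
  proof (rule equivariant_is_poly[of F "(norm \<xi> + B) ^ k" k])
    show "F (m \<circ> g) i = F m (g i)" if "g \<in> G" "reach m" "i \<in> I" for g m i
      unfolding F_def gcls[OF that(1,3), symmetric] by (subst prod.reindex[OF injg[OF that(1)]]) simp
    show "F m i = F m' i" if "\<And>i. i \<in> I \<Longrightarrow> m i = m' i" "i \<in> I" for m m' i
      unfolding F_def by (rule prod.cong) (use that in \<open>auto simp: cls_def\<close>)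
    show "(\<lambda>s. F (\<lambda>i. \<phi> i s) i) holomorphic_on ball c r" if "family \<phi> c r" "i \<in> I" for \<phi> c r i
      unfolding F_def by (intro holomorphic_intros) (use that in \<open>auto simp: cls_def family_def\<close>)
    show "norm (F m i) \<le> (norm \<xi> + B) ^ k * (1 + norm (m i)) ^ k" if m: "reach m" "i \<in> I" for m i
    proof -
      have "norm (F m i) = (\<Prod>j\<in>cls i. norm (\<xi> - m j))" by (simp add: F_def prod_norm)
      also have "\<dots> \<le> (\<Prod>j\<in>cls i. (norm \<xi> + B) * (1 + norm (m i)))"
      proof (intro prod_mono conjI)
        fix j assume "j \<in> cls i"
        then have "poly P (m i) = poly P (m j)"
          using reach_value[OF m] by (simp add: cls_def)
        then have "norm (m j) \<le> B * (1 + norm (m i))" by (rule B(2))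
        moreover have "norm \<xi> \<le> norm \<xi> * (1 + norm (m i))" by (simp add: algebra_simps)
        ultimately show "norm (\<xi> - m j) \<le> (norm \<xi> + B) * (1 + norm (m i))"
          using norm_triangle_ineq4[of \<xi> "m j"] by (simp add: distrib_right)
      qed auto
      also have "\<dots> = (norm \<xi> + B) ^ k * (1 + norm (m i)) ^ k"
        using kcls[OF m(2)] by (simp add: power_mult_distrib)
      finally show ?thesis .
    qed
  qed auto
  then obtain W where W: "degree W \<le> k" "\<And>m i. reach m \<Longrightarrow> i \<in> I \<Longrightarrow> F m i = poly W (m i)"
    by blast
  have degW: "degree W > 0"
  proof (rule ccontr)
    assume "\<not> degree W > 0"
    then obtain c where c: "W = [:c:]" using degree_0_id by (metis neq0_conv)
    obtain m where m: "reach m" "m i0 = \<xi>" using reach_through[OF \<xi>(1) i0] by blast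
    have "i0 \<in> cls i0" using i0 Rr by (simp add: cls_def)
    then have "F m i0 = 0" using finc m(2) by (auto simp: F_def)
    moreover have "F m0 i0 \<noteq> 0" using finc \<xi>(2) by (auto simp: F_def cls_def)
    ultimately show False using W(2)[OF m(1) i0] W(2)[of m0 i0] i0 c by simp
  qed
  have clseq: "cls i = cls j" if "i \<in> I" "j \<in> I" "R i j" for i j
    using that Rs Rt unfolding cls_def by blast
  have sub: "m ` cls i \<subseteq> {z. poly W z = poly W (m i)}" if "reach m" "i \<in> I" for m i
  proof safe
    fix j assume j: "j \<in> cls i"
    then have "cls i = cls j" using clseq that(2) by (auto simp: cls_def)
    then have "F m j = F m i" by (simp add: F_def)
    then show "poly W (m j) = poly W (m i)"
      using W(2) that j by (auto simp: cls_def)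
  qed
  have cardm: "card (m ` cls i) = k" if rm: "reach m" and "i \<in> I" for m i
  proof -
    have "inj_on m (cls i)" by (rule inj_on_subset[OF reach_inj[OF rm]]) (auto simp: cls_def)
    then show ?thesis using kcls[OF that(2)] by (simp add: card_image)
  qed
  \<comment> \<open>A squeeze: the block has \<open>k\<close> members, all in one fibre of
    \<open>W\<close>, whose size is at most \<open>degree W\<close>, which is at most
    \<open>k\<close>.\<close>
  have full: "m ` cls i = {z. poly W z = poly W (m i)}" "degree W = k" if "reach m" "i \<in> I" for m i
  proof -
    have fin: "finite {z. poly W z = poly W (m i)}" by (rule finite_poly_fibre[OF degW])
    have le: "card {z. poly W z = poly W (m i)} \<le> degree W" by (rule card_poly_fibre_le[OF degW])
    have "k \<le> card {z. poly W z = poly W (m i)}"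
      using card_mono[OF fin sub[OF that]] cardm[OF that] by simp
    with le W(1) show "degree W = k" by simp
    with le show "m ` cls i = {z. poly W z = poly W (m i)}"
      using card_seteq[OF fin sub[OF that]] cardm[OF that] by simp
  qed
  have "block_factor W R"
    unfolding block_factor_def
  proof (intro conjI ballI allI impI degW)
    show "degree W = card {j\<in>I. R i j}" if "i \<in> I" for i
      using full(2)[of m0 i] kcls[OF that] that by (simp add: cls_def)
    fix m i j assume m: "reach m" "i \<in> I" "j \<in> I"
    show "poly W (m i) = poly W (m j) \<longleftrightarrow> R i j"
    proof
      assume "poly W (m i) = poly W (m j)"
      then have "m j \<in> m ` cls i" using full(1)[OF m(1,2)] by simp
      then show "R i j" using reach_inj[OF m(1)] m by (auto simp: cls_def dest: inj_onD)
    next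
      assume "R i j"
      then show "poly W (m i) = poly W (m j)"
        using sub[OF m(1,2)] m by (auto simp: cls_def)
    qed
  qed
  then show ?thesis by (rule that)
qed

text \<open>Outside the images of irregular points every fibre of \<open>W\<close> is the image of a
  block under some reached marking, so it has full size and \<open>h\<close> is constant on
  it.\<close>

lemma factor_through_block_polynomial:
  assumes bf: "block_factor W R"
    and h: "\<And>m i j. reach m \<Longrightarrow> i \<in> I \<Longrightarrow> j \<in> I \<Longrightarrow> R i j \<Longrightarrow> poly h (m i) = poly h (m j)"
  shows "\<exists>h'. h = pcompose h' W"
proof -
  note W = block_factorD[OF bf]
  define K where "K = {z. \<not> regular (poly P z)}"
  obtain i0 where i0: "i0 \<in> I" using I_nonempty by blast
  have through: "\<exists>m. reach m \<and> m i0 = z" if "z \<notin> K" for z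
  proof -
    have "regular (poly P z)" using that by (simp add: K_def)
    then show ?thesis using reach_through[of z i0] i0 by blast
  qed
  show ?thesis
  proof (rule constant_on_fibres_pcompose[OF W(1), of "poly W ` K"])
    show "finite (poly W ` K)" unfolding K_def using finite_irregular by blast
    show "card {z. poly W z = w} = degree W" if "w \<notin> poly W ` K" for w
    proof -
      have "\<not> constant (poly (W - [:w:]))" using W(1) by (simp add: constant_degree degree_minus_const)
      then obtain z where z: "poly W z = w"
        using fundamental_theorem_of_algebra[of "W - [:w:]"] by auto
      then have "z \<notin> K" using that by auto
      then obtain m where m: "reach m" "m i0 = z" using through by blast
      show ?thesis
        using card_image[OF block_fibre(1)[OF bf m(1) i0]] block_fibre(2)[OF bf m(1) i0] W(2)[OF i0] m(2) z by simp
    qed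
    show "poly h z = poly h z'" if "poly W z = poly W z'" "poly W z \<notin> poly W ` K" for z z'
    proof -
      have "z \<notin> K" using that(2) by auto
      then obtain m where m: "reach m" "m i0 = z" using through by blast
      have "z' \<in> m ` {j\<in>I. R i0 j}" using block_fibre(2)[OF bf m(1) i0] m(2) that(1) by simp
      then show ?thesis using h[OF m(1) i0] m(2) by auto
    qed
  qed
qed

lemma block_factor_divides:
  assumes "block_factor W R"
  shows "\<exists>P'. P = pcompose P' W"
  by (rule factor_through_block_polynomial[OF assms]) (rule reach_value; assumption)

end

text \<open>In the language of modular decomposition: the modules of the complete graph on \<open>I\<close> whose edges
  are coloured by \<open>\<kappa>\<close>.\<close>

definition homogeneous :: "('i \<Rightarrow> 'i \<Rightarrow> real) \<Rightarrow> 'i set \<Rightarrow> 'i set \<Rightarrow> bool" where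
  "homogeneous \<kappa> I S \<longleftrightarrow> S \<subseteq> I \<and> (\<forall>k\<in>I - S. \<forall>i\<in>S. \<forall>j\<in>S. \<kappa> k i = \<kappa> k j)"

lemma homogeneous_Int: "homogeneous \<kappa> I S \<Longrightarrow> homogeneous \<kappa> I T \<Longrightarrow> homogeneous \<kappa> I (S \<inter> T)"
  unfolding homogeneous_def by blast

text \<open>The critical case is \<open>k\<close> in both sets. For \<open>i\<close> in
  \<open>S - T\<close>, symmetry and homogeneity of \<open>T\<close> allow \<open>k\<close> to be
  exchanged for \<open>z\<close>, since both lie in \<open>T\<close> and \<open>i\<close> does not;
  as \<open>z\<close> is outside \<open>S\<close>, homogeneity of \<open>S\<close> removes the
  dependence on \<open>i\<close>.\<close>

lemma homogeneous_Diff: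
  assumes sym: "\<And>i j. i \<in> I \<Longrightarrow> j \<in> I \<Longrightarrow> \<kappa> i j = \<kappa> j i"
    and S: "homogeneous \<kappa> I S" and T: "homogeneous \<kappa> I T" and z: "z \<in> T" "z \<notin> S"
  shows "homogeneous \<kappa> I (S - T)"
proof -
  have I: "S \<subseteq> I" "T \<subseteq> I" using S T by (auto simp: homogeneous_def)
  have hS: "\<kappa> k i = \<kappa> k j" if "k \<in> I" "k \<notin> S" "i \<in> S" "j \<in> S" for k i j
    using S that unfolding homogeneous_def by blast
  have hT: "\<kappa> k i = \<kappa> k j" if "k \<in> I" "k \<notin> T" "i \<in> T" "j \<in> T" for k i j
    using T that unfolding homogeneous_def by blast
  have *: "\<kappa> k i = \<kappa> z i" if "k \<in> S" "k \<in> T" "i \<in> S" "i \<notin> T" for k i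
  proof -
    have mem: "k \<in> I" "i \<in> I" "z \<in> I" using that z I by auto
    have "\<kappa> k i = \<kappa> i k" by (rule sym[OF mem(1,2)])
    also have "\<dots> = \<kappa> i z" by (rule hT) (use that z mem in auto)
    also have "\<dots> = \<kappa> z i" by (rule sym[OF mem(2,3)])
    finally show ?thesis .
  qed
  have "\<kappa> k i = \<kappa> k j" if "k \<in> I" "k \<notin> S - T" "i \<in> S - T" "j \<in> S - T" for k i j
  proof (cases "k \<in> S")
    case True
    then have "\<kappa> k i = \<kappa> z i" "\<kappa> k j = \<kappa> z j" using that by (auto intro: *)
    moreover have "\<kappa> z i = \<kappa> z j" by (rule hS) (use that z I in auto)
    ultimately show ?thesis by simp
  next
    case False
    then show ?thesis by (intro hS) (use that in auto)
  qed
  then show ?thesis using I unfolding homogeneous_def by blast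
qed

lemma homogeneous_image:
  assumes g: "g permutes I" and inv: "\<And>i j. i \<in> I \<Longrightarrow> j \<in> I \<Longrightarrow> \<kappa> (g i) (g j) = \<kappa> i j"
    and S: "homogeneous \<kappa> I S"
  shows "homogeneous \<kappa> I (g ` S)"
  unfolding homogeneous_def
proof safe
  have SI: "S \<subseteq> I" using S by (simp add: homogeneous_def)
  have gI: "g x \<in> I \<longleftrightarrow> x \<in> I" for x using permutes_in_image[OF g] .
  show "g x \<in> I" if "x \<in> S" for x using gI SI that by auto
  fix k x y assume k: "k \<in> I" "k \<notin> g ` S" and xy: "x \<in> S" "y \<in> S"
  define k' where "k' = inv g k"
  have k': "k = g k'" using permutes_inverses(1)[OF g] by (simp add: k'_def)
  have k'I: "k' \<in> I" using gI[of k'] k(1) k' by metis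
  have "k' \<notin> S" using k(2) k' by blast
  with k'I have "\<kappa> k' x = \<kappa> k' y" using S xy unfolding homogeneous_def by blast
  moreover have "\<kappa> (g k') (g x) = \<kappa> k' x" "\<kappa> (g k') (g y) = \<kappa> k' y"
    using inv[OF k'I] xy SI by blast+
  ultimately show "\<kappa> k (g x) = \<kappa> k (g y)" using k' by metis
qed

text \<open>Choose \<open>K\<close> of least size at least 2 inside \<open>C\<close>. Since pairs
  are excluded it has at least three elements, and then neither a translate of \<open>K\<close> nor
  \<open>C\<close> can properly overlap \<open>K\<close> or one of its translates.\<close>

lemma minimal_homogeneous_block:
  fixes \<kappa> :: "'i \<Rightarrow> 'i \<Rightarrow> real" and G :: "('i \<Rightarrow> 'i) set"
  assumes finI: "finite I" and sym: "\<And>i j. i \<in> I \<Longrightarrow> j \<in> I \<Longrightarrow> \<kappa> i j = \<kappa> j i"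
    and perm: "\<And>g. g \<in> G \<Longrightarrow> g permutes I" and Ginv: "\<And>g. g \<in> G \<Longrightarrow> inv g \<in> G"
    and inv: "\<And>g i j. g \<in> G \<Longrightarrow> i \<in> I \<Longrightarrow> j \<in> I \<Longrightarrow> \<kappa> (g i) (g j) = \<kappa> i j"
    and C: "homogeneous \<kappa> I C" "card C \<ge> 2"
    and no2: "\<And>i j. i \<in> I \<Longrightarrow> j \<in> I \<Longrightarrow> i \<noteq> j \<Longrightarrow> \<not> homogeneous \<kappa> I {i, j}"
  obtains K where "K \<subseteq> C" "homogeneous \<kappa> I K" "card K \<ge> 3"
    "\<And>g. g \<in> G \<Longrightarrow> g ` K \<inter> K \<noteq> {} \<Longrightarrow> g ` K = K"
    "\<And>g. g \<in> G \<Longrightarrow> g ` K \<inter> C \<noteq> {} \<Longrightarrow> g ` K \<subseteq> C"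
proof -
  define H where "H = (\<lambda>S. homogeneous \<kappa> I S \<and> S \<subseteq> C \<and> card S \<ge> 2)"
  obtain K where K: "H K" "\<And>S. H S \<Longrightarrow> card K \<le> card S"
  proof -
    have "H C" using C by (simp add: H_def)
    then have "\<exists>K. H K \<and> (\<forall>S. H S \<longrightarrow> card K \<le> card S)" by (rule ex_has_least_nat)
    then show thesis using that by blast
  qed
  have CI: "C \<subseteq> I" and KI: "K \<subseteq> I" and KC: "K \<subseteq> C" and hK: "homogeneous \<kappa> I K" and K2: "card K \<ge> 2"
    using C K(1) unfolding H_def homogeneous_def by blast+
  have finC: "finite C" and finK: "finite K" using CI KI finI finite_subset by blast+
  have "card K \<noteq> 2"
  proof
    assume "card K = 2"
    then obtain i j where "K = {i, j}" "i \<noteq> j" by (meson card_2_iff)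
    then show False using no2 hK KI by auto
  qed
  then have K3: "card K \<ge> 3" using K2 by simp
  have small: "card S < 2" if "homogeneous \<kappa> I S" "S \<subset> K" for S
  proof (rule ccontr)
    assume "\<not> card S < 2"
    then have "H S" using that KC by (auto simp: H_def)
    then have "card K \<le> card S" by (rule K(2))
    then show False using psubset_card_mono[OF finK that(2)] by simp
  qed
  have hg: "homogeneous \<kappa> I (g ` S)" if "g \<in> G" "homogeneous \<kappa> I S" for g S
    using homogeneous_image[OF perm[OF that(1)] inv[OF that(1)] that(2)] .
  have cardg: "card (g ` S) = card S" if "g \<in> G" for g S
    using perm[OF that] permutes_inj by (metis card_image inj_on_subset subset_UNIV)
  \<comment> \<open>A proper overlap would cut \<open>M\<close> into the homogeneous proper subsets
    \<open>M - T\<close> and \<open>M \<inter> T\<close>, each with at most one element, although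
    \<open>M\<close> has at least three. The minimality assumption speaks of subsets of
    \<open>M\<close> only, so it also holds for translates of \<open>K\<close> that are not known to
    lie in \<open>C\<close>.\<close>
  have split: False
    if M: "homogeneous \<kappa> I M" "card M = card K" "\<And>S. homogeneous \<kappa> I S \<Longrightarrow> S \<subset> M \<Longrightarrow> card S < 2"
      and T: "homogeneous \<kappa> I T" "M \<inter> T \<noteq> {}" "\<not> M \<subseteq> T" "\<not> T \<subseteq> M" for M T
  proof -
    have finM: "finite M" using M(1) finI unfolding homogeneous_def by (meson finite_subset)
    obtain z where "z \<in> T" "z \<notin> M" using T(4) by blast
    then have "homogeneous \<kappa> I (M - T)" using homogeneous_Diff[OF sym M(1) T(1)] by blast
    then have "card (M - T) < 2" using M(3) T(2) by blast
    moreover have "card (M \<inter> T) < 2"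
      using M(3) homogeneous_Int[OF M(1) T(1)] T(3) by blast
    moreover have "card M = card (M - T) + card (M \<inter> T)"
      using finM by (metis add.commute card_Int_Diff)
    ultimately show False using K3 M(2) by simp
  qed
  show ?thesis
  proof (rule that[OF KC hK K3])
    fix g assume g: "g \<in> G"
    have ncomp: "g ` K = K" if "g ` K \<subseteq> K \<or> K \<subseteq> g ` K"
      using that cardg[OF g, of K] finK by (metis card_subset_eq finite_imageI)
    show "g ` K = K" if "g ` K \<inter> K \<noteq> {}"
      using split[OF hK refl small hg[OF g hK]] that ncomp by blast
    show "g ` K \<subseteq> C" if ne: "g ` K \<inter> C \<noteq> {}"
    proof (rule ccontr)
      assume not: "\<not> g ` K \<subseteq> C"
      show False
      proof (rule split[OF hg[OF g hK] cardg[OF g] _ C(1) ne not])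
        show "\<not> C \<subseteq> g ` K"
        proof
          assume "C \<subseteq> g ` K"
          then have "K \<subseteq> g ` K" using KC by blast
          then show False using ncomp not KC by blast
        qed
        fix S assume S: "homogeneous \<kappa> I S" "S \<subset> g ` K"
        have b: "bij g" using perm[OF g] permutes_bij by blast
        have "inv g ` S \<subset> inv g ` (g ` K)"
          using S(2) b by (metis bij_imp_bij_inv bij_is_inj inj_image_subset_iff psubsetE psubsetI)
        then have "inv g ` S \<subset> K" using b by (simp add: image_inv_f_f bij_is_inj)
        then have "card (inv g ` S) < 2" using small hg[OF Ginv[OF g] S(1)] by blast
        then show "card S < 2" using cardg[OF Ginv[OF g]] by simp
      qed
    qed
  qed
qed

section \<open>Branches near a critical value\<close>

context fibre_chart
begin

abbreviation mult :: "complex \<Rightarrow> nat" where "mult s \<equiv> order s (W - [:w:])"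

text \<open>Labels for the branches near \<open>w\<close>: a limit point and the index of a root of
  order \<open>mult s\<close>. As multiplicities add up to the degree, this is a label set for
  complete fibres.\<close>

definition J :: "(complex \<times> nat) set" where
  "J = (SIGMA s:{z. poly W z = w}. {..<mult s})"

text \<open>The logarithmic parameter \<open>u\<close> with W - w = exp u, running through the
  universal cover of a punctured disc. The bound keeps exp (u / d) inside the charts for every d
  between 1 and \<open>degree W\<close>.\<close>

definition H :: "complex set" where
  "H = {u. Re u < real (degree W) * ln \<rho>}"

definition unif :: "complex \<Rightarrow> nat \<Rightarrow> complex \<Rightarrow> complex" where
  "unif s j u = exp ((u + 2 * of_real pi * \<i> * of_nat j) / of_nat (mult s))"

definition branch :: "complex \<times> nat \<Rightarrow> complex \<Rightarrow> complex" where
  "branch x u = \<kappa> (fst x) (unif (fst x) (snd x) u)"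

lemma in_J: "x \<in> J \<longleftrightarrow> poly W (fst x) = w \<and> snd x < mult (fst x)"
  by (cases x) (auto simp: J_def)

lemma finite_J: "finite J"
  unfolding J_def using finite_poly_fibre[OF degW] by simp

lemma card_J: "card J = degree W"
  unfolding J_def using finite_poly_fibre[OF degW] sum_order_fibre[OF degW]
  by (simp add: card_SigmaI)

lemma open_H: "open H" and convex_H: "convex H"
  unfolding H_def by (auto simp: open_halfspace_Re_lt convex_halfspace_Re_lt)

lemma H_nonempty: "\<exists>u. u \<in> H \<and> Re u < r"
  unfolding H_def by (rule exI[of _ "of_real (min r (real (degree W) * ln \<rho>) - 1)"]) auto

lemma mult_pos: "poly W s = w \<Longrightarrow> mult s > 0"
proof -
  assume s: "poly W s = w"
  have "W - [:w:] \<noteq> 0" using degW by auto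
  moreover have "poly (W - [:w:]) s = 0" using s by simp
  ultimately show ?thesis using order_root[of "W - [:w:]" s] by blast
qed

lemma mult_le: "mult s \<le> degree W"
proof -
  have "W - [:w:] \<noteq> 0" using degW by auto
  then show ?thesis using order_degree[of "W - [:w:]" s] by (simp add: degree_minus_const)
qed

lemma norm_unif: "norm (unif s j u) = exp (Re u / real (mult s))"
  by (simp add: unif_def)

lemma unif_in_ball:
  assumes "poly W s = w" "u \<in> H"
  shows "unif s j u \<in> ball 0 \<rho>"
proof -
  have m: "mult s > 0" by (rule mult_pos[OF assms(1)])
  have "Re u < real (degree W) * ln \<rho>" using assms(2) by (simp add: H_def)
  also have "\<dots> \<le> real (mult s) * ln \<rho>"
    using mult_le[of s] \<rho> by (intro mult_right_mono_neg) auto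
  finally have "Re u / real (mult s) < ln \<rho>" using m by (simp add: field_simps)
  then have "exp (Re u / real (mult s)) < \<rho>" using \<rho> by (metis exp_less_mono exp_ln)
  then show ?thesis by (simp add: norm_unif)
qed

lemma unif_nonzero: "unif s j u \<noteq> 0"
  by (simp add: unif_def)

lemma unif_power: "poly W s = w \<Longrightarrow> unif s j u ^ mult s = exp u"
proof -
  assume "poly W s = w"
  then have m: "mult s > 0" by (rule mult_pos)
  have "unif s j u ^ mult s = exp (u + 2 * of_real pi * \<i> * of_nat j)"
    unfolding unif_def exp_of_nat_mult[symmetric] using m by simp
  also have "\<dots> = exp u" by (subst exp_eq) (auto intro!: exI[of _ "int j"])
  finally show ?thesis .
qed

lemma unif_holomorphic: "unif s j holomorphic_on S"
proof (cases "mult s = 0")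
  case False
  then show ?thesis unfolding unif_def[abs_def] by (intro holomorphic_intros) auto
qed (simp add: unif_def[abs_def])

lemma branch_holomorphic: "x \<in> J \<Longrightarrow> branch x holomorphic_on H"
proof -
  assume x: "x \<in> J"
  have "\<kappa> (fst x) \<circ> unif (fst x) (snd x) holomorphic_on H"
    by (rule holomorphic_on_compose_gen[where t = "ball 0 \<rho>"])
       (use x unif_in_ball hol\<kappa> unif_holomorphic in \<open>auto simp: in_J\<close>)
  then show ?thesis by (simp add: branch_def[abs_def] o_def)
qed

lemma branch_value: "x \<in> J \<Longrightarrow> u \<in> H \<Longrightarrow> poly W (branch x u) = w + exp u"
  unfolding branch_def in_J
  using val\<kappa>[OF _ unif_in_ball, of "fst x" "fst x" u "snd x"] unif_power[of "fst x" "snd x" u] by simp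

lemma branch_inj:
  assumes "u \<in> H"
  shows "inj_on (\<lambda>x. branch x u) J"
proof (rule inj_onI)
  fix x y assume x: "x \<in> J" and y: "y \<in> J" and eq: "branch x u = branch y u"
  have px: "poly W (fst x) = w" and py: "poly W (fst y) = w" using x y by (simp_all add: in_J)
  have s: "fst x = fst y"
    by (rule disj\<kappa>[OF px py unif_in_ball[OF px assms] unif_in_ball[OF py assms] eq[unfolded branch_def]])
  define s where "s = fst x"
  define d where "d = mult s"
  have d: "snd x < d" "snd y < d" "poly W s = w" "fst y = s"
    using x y s by (simp_all add: in_J s_def d_def)
  have "\<kappa> s (unif s (snd x) u) = \<kappa> s (unif s (snd y) u)"
    using eq d(4) by (simp add: branch_def s_def)
  then have "unif s (snd x) u = unif s (snd y) u"
    using inj\<kappa>[OF d(3)] unif_in_ball[OF d(3) assms] by (meson inj_onD)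
  then obtain n :: int where n: "(u + 2 * of_real pi * \<i> * of_nat (snd x)) / of_nat d =
      (u + 2 * of_real pi * \<i> * of_nat (snd y)) / of_nat d + (of_int (2 * n) * pi) * \<i>"
    unfolding unif_def d_def[symmetric] exp_eq by blast
  have d0: "of_nat d \<noteq> (0::complex)" using d(1) by simp
  have "2 * of_real pi * \<i> * of_nat (snd x) = 2 * of_real pi * \<i> * (of_nat (snd y) + of_int n * of_nat d)"
    using n d0 by (simp add: field_simps)
  then have "of_nat (snd x) = (of_nat (snd y) + of_int n * of_nat d :: complex)"
  proof -
    have "2 * of_real pi * \<i> \<noteq> (0 :: complex)" by simp
    then show ?thesis
      using \<open>2 * of_real pi * \<i> * of_nat (snd x) = _\<close> mult_left_cancel by blast
  qed
  then have "of_int (int (snd x)) = (of_int (int (snd y) + n * int d) :: complex)" by simp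
  then have e: "int (snd x) = int (snd y) + n * int d" by (simp only: of_int_eq_iff)
  have "int (snd x) mod int d = int (snd y) mod int d" unfolding e by simp
  then have "snd x = snd y" using d(1,2) by simp
  then show "x = y" using s by (simp add: prod_eq_iff)
qed

text \<open>The monodromy of one turn around \<open>w\<close>, that is, of the translation of
  \<open>u\<close> by 2 pi i.\<close>

definition \<sigma> :: "complex \<times> nat \<Rightarrow> complex \<times> nat" where
  "\<sigma> x = (if x \<in> J then (fst x, Suc (snd x) mod mult (fst x)) else x)"

lemma branch_shift:
  assumes "x \<in> J"
  shows "branch x (u + 2 * of_real pi * \<i>) = branch (\<sigma> x) u"
proof -
  define s where "s = fst x"
  define d where "d = mult s"
  have d: "d > 0" using assms mult_pos by (auto simp: in_J s_def d_def)
  have "unif s (snd x) (u + 2 * of_real pi * \<i>) = unif s (Suc (snd x) mod d) u"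
    unfolding unif_def d_def[symmetric] exp_eq
  \<comment> \<open>This quotient is 1 when the root index wraps around to 0, and 0
    otherwise.\<close>
  proof (rule exI[of _ "int (Suc (snd x) div d)"])
    have "Suc (snd x) = Suc (snd x) div d * d + Suc (snd x) mod d" by simp
    then have "(of_nat (Suc (snd x)) :: complex) = of_nat (Suc (snd x) div d) * of_nat d + of_nat (Suc (snd x) mod d)"
      by (metis of_nat_add of_nat_mult)
    then have e: "(of_nat (snd x) :: complex) = of_nat (Suc (snd x) div d) * of_nat d + of_nat (Suc (snd x) mod d) - 1"
      by (simp add: eq_diff_eq add.commute)
    show "(u + 2 * complex_of_real pi * \<i> + 2 * complex_of_real pi * \<i> * of_nat (snd x)) / of_nat d =
      (u + 2 * complex_of_real pi * \<i> * of_nat (Suc (snd x) mod d)) / of_nat d +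
      (of_int (2 * int (Suc (snd x) div d)) * pi) * \<i>"
      unfolding e using d by (simp add: field_simps)
  qed
  then show ?thesis using assms by (simp add: branch_def \<sigma>_def s_def d_def)
qed

lemma \<sigma>_permutes: "\<sigma> permutes J"
proof (rule bij_imp_permutes)
  have sub: "\<sigma> ` J \<subseteq> J" using mult_pos by (auto simp: \<sigma>_def in_J)
  have "inj_on \<sigma> J"
  proof (rule inj_onI)
    fix x y assume x: "x \<in> J" and y: "y \<in> J" and eq: "\<sigma> x = \<sigma> y"
    have s: "fst x = fst y" using x y eq by (simp add: \<sigma>_def)
    define d where "d = mult (fst x)"
    have "Suc (snd x) mod d = Suc (snd y) mod d" "snd x < d" "snd y < d"
      using x y eq s by (auto simp: \<sigma>_def in_J d_def)
    then have "snd x = snd y" 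
      using mod_Suc[of "snd x" d] mod_Suc[of "snd y" d] by (auto split: if_splits)
    then show "x = y" using s by (simp add: prod_eq_iff)
  qed
  then show "bij_betw \<sigma> J J" using sub finite_J by (simp add: bij_betw_def endo_inj_surj)
qed (simp add: \<sigma>_def)

lemma branch_limit:
  assumes "\<eta> > 0"
  obtains r where "\<And>x u. x \<in> J \<Longrightarrow> u \<in> H \<Longrightarrow> Re u < r \<Longrightarrow> dist (branch x u) (fst x) < \<eta>"
proof -
  let ?F = "{z. poly W z = w}"
  have "\<exists>\<delta>>0. \<forall>\<zeta>. norm \<zeta> < \<delta> \<longrightarrow> dist (\<kappa> s \<zeta>) s < \<eta>" if s: "s \<in> ?F" for s
  proof -
    have "isCont (\<kappa> s) 0" by (rule holomorphic_isCont[OF hol\<kappa>]) (use s \<rho> in auto)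
    then show ?thesis using assms \<kappa>0[of s] s unfolding continuous_at_eps_delta by auto
  qed
  then obtain \<delta> where \<delta>: "\<And>s. s \<in> ?F \<Longrightarrow> \<delta> s > 0"
      "\<And>s \<zeta>. s \<in> ?F \<Longrightarrow> norm \<zeta> < \<delta> s \<Longrightarrow> dist (\<kappa> s \<zeta>) s < \<eta>" by metis
  define d where "d = Min (insert 1 (\<delta> ` ?F))"
  have fin: "finite ?F" by (rule finite_poly_fibre[OF degW])
  have d: "d > 0" "d \<le> 1" "\<And>s. s \<in> ?F \<Longrightarrow> d \<le> \<delta> s"
    unfolding d_def using fin \<delta>(1) by (auto simp: Min_gr_iff intro!: Min_le)
  show ?thesis
  proof (rule that[of "real (degree W) * ln d"])
    fix x u assume x: "x \<in> J" and "u \<in> H" and r: "Re u < real (degree W) * ln d"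
    define s where "s = fst x"
    have s: "s \<in> ?F" "mult s > 0" using x mult_pos by (auto simp: in_J s_def)
    have "Re u < real (degree W) * ln d" by fact
    also have "\<dots> \<le> real (mult s) * ln d"
      using mult_le[of s] d by (intro mult_right_mono_neg) auto
    finally have "Re u / real (mult s) < ln d" using s(2) by (simp add: field_simps)
    then have "exp (Re u / real (mult s)) < d" using d by (metis exp_less_mono exp_ln)
    then have "norm (unif s (snd x) u) < \<delta> s" using d(3)[OF s(1)] by (simp add: norm_unif)
    then show "dist (branch x u) (fst x) < \<eta>"
      using \<delta>(2)[OF s(1)] by (simp add: branch_def s_def)
  qed
qed

text \<open>Hence a logarithm of \<open>(z - b) / (z - a)\<close> along a branch grows like \<open>u / mult b\<close> at \<open>b\<close>, like
  \<open>- u / mult a\<close> at \<open>a\<close>, and is periodic at every other point of the fibre.\<close>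

lemma chart_logarithm:
  assumes ab: "a \<noteq> b" "poly W a = w" "poly W b = w" and s: "poly W s = w"
  obtains \<Lambda> where "\<Lambda> holomorphic_on ball 0 \<rho>"
    "\<And>\<zeta>. \<zeta> \<in> ball 0 \<rho> \<Longrightarrow> \<zeta> \<noteq> 0 \<Longrightarrow> (\<kappa> s \<zeta> - b) / (\<kappa> s \<zeta> - a) =
       (if s = b then \<zeta> else if s = a then 1 / \<zeta> else 1) * exp (\<Lambda> \<zeta>)"
proof -
  define B where "B = ball (0::complex) \<rho>"
  \<comment> \<open>The difference quotient of the chart at 0, with its removable singularity filled
    in. Injectivity of the chart makes it zero-free.\<close>
  define h where "h = (\<lambda>\<zeta>. if \<zeta> = 0 then deriv (\<kappa> s) 0 else (\<kappa> s \<zeta> - \<kappa> s 0) / (\<zeta> - 0))"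
  have holh: "h holomorphic_on B"
    unfolding h_def B_def by (rule pole_lemma[OF hol\<kappa>[OF s]]) (use \<rho> in auto)
  have h0: "h \<zeta> \<noteq> 0" if "\<zeta> \<in> B" for \<zeta>
  proof (cases "\<zeta> = 0")
    case True
    then show ?thesis
      using holomorphic_injective_imp_regular[OF hol\<kappa>[OF s] open_ball inj\<kappa>[OF s], of 0] \<rho> by (simp add: h_def)
  next
    case False
    then have "\<kappa> s \<zeta> \<noteq> \<kappa> s 0"
      using inj\<kappa>[OF s] that \<rho> unfolding B_def by (meson centre_in_ball inj_onD)
    then show ?thesis using False by (simp add: h_def)
  qed
  have h: "\<kappa> s \<zeta> - s = \<zeta> * h \<zeta>" if "\<zeta> \<noteq> 0" for \<zeta> using that \<kappa>0[OF s] by (simp add: h_def)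
  have ne: "\<kappa> s \<zeta> \<noteq> x" if "\<zeta> \<in> B" "poly W x = w" "s \<noteq> x" for \<zeta> x
    using disj\<kappa>[OF s that(2), of \<zeta> 0] \<kappa>0[OF that(2)] that \<rho> by (auto simp: B_def)
  \<comment> \<open>The quotient freed from its zero or pole at the centre; being zero-free on a
    disc it has a logarithm.\<close>
  define f where "f = (\<lambda>\<zeta>. (if s = b then h \<zeta> else \<kappa> s \<zeta> - b) / (if s = a then h \<zeta> else \<kappa> s \<zeta> - a))"
  have f0: "f \<zeta> \<noteq> 0" if "\<zeta> \<in> B" for \<zeta>
    using h0[OF that] ne[OF that ab(2)] ne[OF that ab(3)] by (auto simp: f_def)
  have holf: "f holomorphic_on B"
  proof -
    have "(\<lambda>\<zeta>. if s = b then h \<zeta> else \<kappa> s \<zeta> - b) holomorphic_on B"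
      "(\<lambda>\<zeta>. if s = a then h \<zeta> else \<kappa> s \<zeta> - a) holomorphic_on B"
      using holh hol\<kappa>[OF s] by (cases "s = b"; cases "s = a"; simp add: B_def holomorphic_on_diff)+
    then show ?thesis unfolding f_def
      by (rule holomorphic_on_divide) (use h0 ne ab in auto)
  qed
  obtain \<Lambda> where \<Lambda>: "\<Lambda> holomorphic_on B" "\<And>\<zeta>. \<zeta> \<in> B \<Longrightarrow> exp (\<Lambda> \<zeta>) = f \<zeta>"
    by (rule holomorphic_logarithm_exists[of B f 0]) (use holf f0 \<rho> in \<open>auto simp: B_def\<close>)
  show ?thesis
  proof (rule that[of \<Lambda>])
    show "\<Lambda> holomorphic_on ball 0 \<rho>" using \<Lambda>(1) by (simp add: B_def)
    fix \<zeta> :: complex assume z: "\<zeta> \<in> ball 0 \<rho>" "\<zeta> \<noteq> 0"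
    then have "exp (\<Lambda> \<zeta>) = f \<zeta>" using \<Lambda>(2) by (simp add: B_def)
    then show "(\<kappa> s \<zeta> - b) / (\<kappa> s \<zeta> - a) =
       (if s = b then \<zeta> else if s = a then 1 / \<zeta> else 1) * exp (\<Lambda> \<zeta>)"
      using h[OF z(2)] ab(1) by (auto simp: f_def)
  qed
qed

end

text \<open>Separating the powers of \<open>z\<close> from the coefficients in \<open>w\<close>
  allows the divided difference to be integrated in \<open>z\<close> between fixed endpoints, with a
  polynomial in \<open>w\<close> as the result.\<close>

lemma divided_difference_poly:
  fixes Q :: "complex poly"
  obtains s :: "nat \<Rightarrow> complex poly" and N where
    "\<And>w z. poly Q z - poly Q w = (z - w) * (\<Sum>k<N. poly (s k) w * z ^ k)"
proof -
  have "\<exists>(s :: nat \<Rightarrow> complex poly) N. \<forall>w z. poly Q z - poly Q w = (z - w) * (\<Sum>k<N. poly (s k) w * z ^ k)"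
  proof (induction Q)
    case 0
    show ?case by (rule exI[of _ "\<lambda>_. 0"]) auto
  next
    case (pCons c Q)
    then obtain s :: "nat \<Rightarrow> complex poly" and N where
      s: "\<And>w z. poly Q z - poly Q w = (z - w) * (\<Sum>k<N. poly (s k) w * z ^ k)" by blast
    define s' where "s' = (\<lambda>k. case k of 0 \<Rightarrow> Q | Suc k \<Rightarrow> s k)"
    have "poly (pCons c Q) z - poly (pCons c Q) w = (z - w) * (\<Sum>k<Suc N. poly (s' k) w * z ^ k)" for w z
    proof -
      have "(\<Sum>k<Suc N. poly (s' k) w * z ^ k) = poly Q w + z * (\<Sum>k<N. poly (s k) w * z ^ k)"
        unfolding sum.lessThan_Suc_shift by (simp add: s'_def sum_distrib_left mult_ac)
      then have "(z - w) * (\<Sum>k<Suc N. poly (s' k) w * z ^ k) =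
          (z - w) * poly Q w + z * ((z - w) * (\<Sum>k<N. poly (s k) w * z ^ k))"
        by (simp add: algebra_simps)
      also have "\<dots> = (z - w) * poly Q w + z * (poly Q z - poly Q w)" by (simp only: s)
      also have "\<dots> = poly (pCons c Q) z - poly (pCons c Q) w" by (simp add: algebra_simps)
      finally show ?thesis by simp
    qed
    then show ?case by blast
  qed
  then show ?thesis using that by blast
qed

lemma poly_antiderivative:
  fixes p :: "complex poly"
  obtains R where "pderiv R = p"
proof -
  have "\<exists>R. pderiv R = p"
  proof
    show "pderiv (\<Sum>i\<le>degree p. monom (coeff p i / of_nat (Suc i)) (Suc i)) = p"
    proof (rule poly_eqI)
      fix n
      have "(\<Sum>i\<le>degree p. coeff (monom (coeff p i / of_nat (Suc i)) (Suc i)) (Suc n)) =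
          (\<Sum>i\<le>degree p. if i = n then coeff p n / of_nat (Suc n) else 0)"
        by (rule sum.cong) (auto simp: coeff_monom)
      also have "\<dots> = coeff p n / of_nat (Suc n)"
        by (simp add: coeff_eq_0)
      finally show "coeff (pderiv (\<Sum>i\<le>degree p. monom (coeff p i / of_nat (Suc i)) (Suc i))) n = coeff p n"
        by (simp add: coeff_pderiv coeff_sum del: of_nat_Suc)
    qed
  qed
  then show ?thesis using that by blast
qed

lemma pderiv_over_poly_minus_value:
  fixes P :: "complex poly"
  assumes "degree P > 0" "finite I" "card I = degree P" "inj_on v I" "\<And>i. i \<in> I \<Longrightarrow> poly P (v i) = t"
    and z: "poly P z \<noteq> t"
  shows "poly (pderiv P) z / (poly P z - t) = (\<Sum>i\<in>I. 1 / (z - v i))"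
proof -
  define \<pi> where "\<pi> = (\<Prod>i\<in>I. [:- v i, 1:])"
  have pi': "\<pi> = (\<Prod>x\<in>v ` I. [:- x, 1:])" unfolding \<pi>_def by (simp add: prod.reindex[OF assms(4)])
  define c where "c = lead_coeff (P - [:t:])"
  have "P - [:t:] \<noteq> 0" using assms(1) by auto
  then have r: "P - [:t:] = smult c \<pi>"
    unfolding pi' c_def
    by (rule poly_eq_prod_roots) (use assms in \<open>auto simp: card_image degree_minus_const\<close>)
  have "pderiv P = pderiv (P - [:t:])" by (simp add: pderiv_diff pderiv_pCons)
  also have "\<dots> = smult c (pderiv \<pi>)" using r by (simp add: pderiv_smult)
  finally have dP: "pderiv P = smult c (pderiv \<pi>)" .
  have Pz: "poly P z - t = c * poly \<pi> z" using arg_cong[OF r, of "\<lambda>p. poly p z"] by simp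
  have nz: "z - v i \<noteq> 0" if "i \<in> I" for i using z assms(5)[OF that] by auto
  have "poly (pderiv \<pi>) z = (\<Sum>i\<in>I. \<Prod>j\<in>I - {i}. z - v j)"
    unfolding \<pi>_def pderiv_prod by (simp add: poly_sum poly_prod pderiv_pCons)
  also have "\<dots> = (\<Sum>i\<in>I. poly \<pi> z / (z - v i))"
  proof (rule sum.cong)
    fix i assume i: "i \<in> I"
    have "poly \<pi> z = (z - v i) * (\<Prod>j\<in>I - {i}. z - v j)"
      unfolding \<pi>_def poly_prod using assms(2) i by (subst prod.remove[of I i]) auto
    then show "(\<Prod>j\<in>I - {i}. z - v j) = poly \<pi> z / (z - v i)" using nz[OF i] by simp
  qed auto
  finally have d\<pi>: "poly (pderiv \<pi>) z = poly \<pi> z * (\<Sum>i\<in>I. 1 / (z - v i))" by (simp add: sum_distrib_left)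
  have "c * poly \<pi> z \<noteq> 0" using Pz z by auto
  then show ?thesis unfolding dP Pz by (simp add: d\<pi>)
qed

section \<open>Logarithmic relations from vanishing moments\<close>

text \<open>The function \<Phi> built from principal logarithms is a primitive of Q P' / (P - t):
  split Q(z) / (z - v) into Q(v) / (z - v) and the divided difference, then sum over the fibre.
  Expanding 1 / (P - t) in powers of P / t turns its increment from \<open>a\<close> to
  \<open>b\<close> into a series of moments of Q P' P^k, all zero. The polynomial \<open>T\<close>
  is the contribution of the divided difference.\<close>

lemma moment_log_identity:
  fixes P Q :: "complex poly"
  assumes degP: "degree P > 0" and Pab: "poly P a = poly P b"
    and moments: "\<And>k R. pderiv R = P ^ k * pderiv Q \<Longrightarrow> poly R a = poly R b"
  obtains T R0 where "\<And>t (v :: 'i \<Rightarrow> complex) I. norm t \<ge> R0 \<Longrightarrow> finite I \<Longrightarrow> card I = degree P \<Longrightarrow>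
      inj_on v I \<Longrightarrow> (\<And>i. i \<in> I \<Longrightarrow> poly P (v i) = t) \<Longrightarrow>
      (\<forall>i\<in>I. norm a < norm (v i) \<and> norm b < norm (v i)) \<and>
      (\<Sum>i\<in>I. poly Q (v i) * (Ln (1 - b / v i) - Ln (1 - a / v i)) + poly T (v i)) = 0"
proof -
  have Qab: "poly Q a = poly Q b" using moments[of Q 0] by simp
  have "\<exists>R. pderiv R = Q * pderiv P * P ^ k \<and> poly R a = poly R b" for k
  proof -
    obtain R where R: "pderiv R = P ^ Suc k * pderiv Q" by (rule poly_antiderivative)
    define R' where "R' = smult (1 / of_nat (Suc k)) (P ^ Suc k * Q - R)"
    have "pderiv (P ^ Suc k * Q) = P ^ Suc k * pderiv Q + Q * smult (of_nat (Suc k)) (P ^ k * pderiv P)"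
      unfolding pderiv_mult pderiv_power_Suc by (simp add: mult_ac)
    then have "pderiv R' = smult (1 / of_nat (Suc k)) (Q * smult (of_nat (Suc k)) (P ^ k * pderiv P))"
      by (simp add: R'_def pderiv_smult pderiv_diff R del: of_nat_Suc)
    also have "\<dots> = Q * pderiv P * P ^ k" by (simp add: mult_ac del: of_nat_Suc)
    finally have "pderiv R' = Q * pderiv P * P ^ k" .
    moreover have "poly R' a = poly R' b"
      using moments[OF R] Pab Qab by (simp add: R'_def)
    ultimately show ?thesis by blast
  qed
  then obtain Rk where Rk: "\<And>k. pderiv (Rk k) = Q * pderiv P * P ^ k" "\<And>k. poly (Rk k) a = poly (Rk k) b"
    by metis
  define S where "S = cball (0::complex) (max (norm a) (norm b))"
  have abS: "a \<in> S" "b \<in> S" by (auto simp: S_def)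
  have "compact S" "convex S" by (auto simp: S_def)
  have "bounded (poly P ` S)" "bounded (poly (Q * pderiv P) ` S)"
    by (intro compact_imp_bounded compact_continuous_image \<open>compact S\<close> continuous_intros)+
  then obtain B1 B2 where B: "\<And>z. z \<in> S \<Longrightarrow> norm (poly P z) \<le> B1" "\<And>z. z \<in> S \<Longrightarrow> norm (poly (Q * pderiv P) z) \<le> B2"
    by (auto simp: bounded_iff)
  have B1: "B1 \<ge> 0" using B(1)[OF abS(1)] norm_ge_zero order_trans by blast
  have B2: "B2 \<ge> 0" using B(2)[OF abS(1)] norm_ge_zero order_trans by blast
  obtain s :: "nat \<Rightarrow> complex poly" and N where
    s: "\<And>w z. poly Q z - poly Q w = (z - w) * (\<Sum>k<N. poly (s k) w * z ^ k)"
    using divided_difference_poly by blast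
  define T where "T = (\<Sum>k<N. smult ((b ^ Suc k - a ^ Suc k) / of_nat (Suc k)) (s k))"
  show ?thesis
  \<comment> \<open>With this bound \<open>norm (P z / t)\<close> is at most 1/2 and
    \<open>norm (P z - t)\<close> at least 1 on \<open>S\<close>; moreover the fibre over
    \<open>t\<close> lies outside the disc \<open>S\<close>, which keeps \<open>1 - z / v i\<close>
    off the branch cut.\<close>
  proof (rule that[of "2 * B1 + 2" T])
    fix t and v :: "'i \<Rightarrow> complex" and I
    assume t: "norm t \<ge> 2 * B1 + 2" and I: "finite I" "card I = degree P" "inj_on v I"
      and Pv: "\<And>i. i \<in> I \<Longrightarrow> poly P (v i) = t"
    have Pt: "poly P z \<noteq> t" if "z \<in> S" for z using B(1)[OF that] B1 t by auto
    have vS: "v i \<notin> S" if "i \<in> I" for i using Pt Pv that by blast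
    then have far: "norm a < norm (v i)" "norm b < norm (v i)" if "i \<in> I" for i
      using vS[OF that] by (auto simp: S_def)
    have v0: "v i \<noteq> 0" if "i \<in> I" for i using far(1)[OF that] by auto
    define \<Phi> where "\<Phi> = (\<lambda>z. \<Sum>i\<in>I. poly Q (v i) * Ln (1 - z / v i) +
        (\<Sum>k<N. poly (s k) (v i) * (z ^ Suc k / of_nat (Suc k))))"
    have dLn: "((\<lambda>z. Ln (1 - z / v i)) has_field_derivative 1 / (z - v i)) (at z within S)"
      if z: "z \<in> S" and i: "i \<in> I" for z i
    proof -
      have "norm z < norm (v i)" using z vS[OF i] by (auto simp: S_def)
      then have "norm (z / v i) < 1" using v0[OF i] by (simp add: norm_divide)
      then have "Re (z / v i) < 1" using complex_Re_le_cmod[of "z / v i"] by linarith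
      then have "1 - z / v i \<notin> \<real>\<^sub>\<le>\<^sub>0" by (auto simp: complex_nonpos_Reals_iff)
      moreover have "z \<noteq> v i" using z vS[OF i] by blast
      ultimately show ?thesis
        using v0[OF i] by (auto intro!: derivative_eq_intros simp: field_simps)
    qed
    have d\<Phi>: "(\<Phi> has_field_derivative poly (Q * pderiv P) z / (poly P z - t)) (at z within S)"
      if z: "z \<in> S" for z
    proof -
      have pw: "((\<lambda>z. z ^ Suc k / of_nat (Suc k)) has_field_derivative z ^ k) (at z within S)" for k
        by (auto intro!: derivative_eq_intros simp del: power_Suc of_nat_Suc)
      have "(\<Phi> has_field_derivative (\<Sum>i\<in>I. poly Q (v i) * (1 / (z - v i)) + (\<Sum>k<N. poly (s k) (v i) * z ^ k)))
          (at z within S)"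
        unfolding \<Phi>_def by (intro DERIV_sum DERIV_add DERIV_cmult dLn z pw)
      also have "(\<Sum>i\<in>I. poly Q (v i) * (1 / (z - v i)) + (\<Sum>k<N. poly (s k) (v i) * z ^ k)) =
          (\<Sum>i\<in>I. poly Q z * (1 / (z - v i)))"
      proof (rule sum.cong)
        fix i assume "i \<in> I"
        then have "z - v i \<noteq> 0" using z vS by auto
        then have "(\<Sum>k<N. poly (s k) (v i) * z ^ k) = (poly Q z - poly Q (v i)) / (z - v i)"
          using s[of z "v i"] by simp
        then show "poly Q (v i) * (1 / (z - v i)) + (\<Sum>k<N. poly (s k) (v i) * z ^ k) = poly Q z * (1 / (z - v i))"
          by (simp add: diff_divide_distrib)
      qed auto
      also have "\<dots> = poly Q z * (poly (pderiv P) z / (poly P z - t))"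
        by (simp only: pderiv_over_poly_minus_value[OF degP I Pv Pt[OF z]] sum_distrib_left)
      finally show ?thesis by simp
    qed
    have t0: "t \<noteq> 0" using t B1 by auto
    have bound: "norm (\<Phi> b - \<Phi> a) \<le> B2 * (1 / 2) ^ K * norm (b - a)" for K
    proof -
      \<comment> \<open>The added terms take equal values at \<open>a\<close> and \<open>b\<close>,
        and their derivatives cancel the first \<open>K\<close> terms of the geometric series; the
        remainder is of order 2^(-K).\<close>
      define \<Psi> where "\<Psi> = (\<lambda>z. \<Phi> z + (\<Sum>k<K. poly (Rk k) z / t ^ Suc k))"
      define \<psi> where "\<psi> = (\<lambda>z. poly (Q * pderiv P) z / (poly P z - t) +
          (\<Sum>k<K. poly (pderiv (Rk k)) z / t ^ Suc k))"
      have "norm (\<Psi> b - \<Psi> a) \<le> B2 * (1 / 2) ^ K * norm (b - a)"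
      proof (rule field_differentiable_bound[OF \<open>convex S\<close> _ _ abS(2,1)])
        fix z assume z: "z \<in> S"
        show "(\<Psi> has_field_derivative \<psi> z) (at z within S)"
          unfolding \<Psi>_def \<psi>_def
          by (intro DERIV_add DERIV_sum DERIV_cdivide d\<Phi> z has_field_derivative_at_within[OF poly_DERIV])
        define x where "x = poly P z / t"
        have x: "norm x \<le> 1 / 2"
          using B(1)[OF z] t B1 t0 by (auto simp: x_def norm_divide field_simps)
        have x1: "x \<noteq> 1" using x by auto
        have "(\<Sum>k<K. poly (pderiv (Rk k)) z / t ^ Suc k) = poly (Q * pderiv P) z / t * (\<Sum>k<K. x ^ k)"
          by (simp add: Rk sum_distrib_left x_def power_divide mult_ac)
        also have "\<dots> = poly (Q * pderiv P) z / t * ((1 - x ^ K) / (1 - x))"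
          using x1 by (subst sum_gp_strict) auto
        also have "\<dots> = - (poly (Q * pderiv P) z * (1 - x ^ K) / (poly P z - t))"
        proof -
          have "t * (1 - x) = - (poly P z - t)" using t0 by (simp add: x_def algebra_simps)
          then show ?thesis by (metis divide_minus_right times_divide_times_eq)
        qed
        finally have "\<psi> z = poly (Q * pderiv P) z * x ^ K / (poly P z - t)"
          unfolding \<psi>_def by (simp add: right_diff_distrib diff_divide_distrib)
        then have "norm (\<psi> z) = norm (poly (Q * pderiv P) z) * norm x ^ K / norm (poly P z - t)"
          by (simp add: norm_mult norm_divide norm_power)
        also have "\<dots> \<le> B2 * (1 / 2) ^ K / 1"
        proof (intro frac_le mult_mono power_mono)
          show "1 \<le> norm (poly P z - t)"
            using B(1)[OF z] t B1 norm_triangle_ineq2[of t "poly P z"] by (simp add: norm_minus_commute)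
        qed (use B(2)[OF z] B2 x in auto)
        finally show "norm (\<psi> z) \<le> B2 * (1 / 2) ^ K" by simp
      qed
      moreover have "\<Psi> b - \<Psi> a = \<Phi> b - \<Phi> a" unfolding \<Psi>_def using Rk(2) by simp
      ultimately show ?thesis by simp
    qed
    have "(\<lambda>K. B2 * (1 / 2) ^ K * norm (b - a)) \<longlonglongrightarrow> B2 * 0 * norm (b - a)"
      by (intro tendsto_intros LIMSEQ_power_zero) auto
    then have "norm (\<Phi> b - \<Phi> a) \<le> B2 * 0 * norm (b - a)"
      by (rule Lim_bounded2) (use bound in auto)
    then have "\<Phi> b - \<Phi> a = 0" by simp
    moreover have "\<Phi> b - \<Phi> a = (\<Sum>i\<in>I. poly Q (v i) * (Ln (1 - b / v i) - Ln (1 - a / v i)) + poly T (v i))"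
      unfolding \<Phi>_def sum_subtractf[symmetric]
    proof (rule sum.cong)
      fix i assume "i \<in> I"
      have "poly T (v i) = (\<Sum>k<N. poly (s k) (v i) * (b ^ Suc k / of_nat (Suc k))) -
          (\<Sum>k<N. poly (s k) (v i) * (a ^ Suc k / of_nat (Suc k)))"
        unfolding T_def poly_sum sum_subtractf[symmetric]
        by (rule sum.cong) (simp_all add: diff_divide_distrib algebra_simps del: of_nat_Suc power_Suc)
      then show "poly Q (v i) * Ln (1 - b / v i) + (\<Sum>k<N. poly (s k) (v i) * (b ^ Suc k / of_nat (Suc k))) -
          (poly Q (v i) * Ln (1 - a / v i) + (\<Sum>k<N. poly (s k) (v i) * (a ^ Suc k / of_nat (Suc k)))) =
          poly Q (v i) * (Ln (1 - b / v i) - Ln (1 - a / v i)) + poly T (v i)"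
        by (simp add: right_diff_distrib)
    qed auto
    ultimately show "(\<forall>i\<in>I. norm a < norm (v i) \<and> norm b < norm (v i)) \<and>
      (\<Sum>i\<in>I. poly Q (v i) * (Ln (1 - b / v i) - Ln (1 - a / v i)) + poly T (v i)) = 0"
      using far by simp
  qed
qed

text \<open>The difference is a multiple of 2 pi i and, by continuity, of norm below 1 near
  \<open>t\<close>.\<close>

lemma logarithms_agree_near:
  fixes f g :: "complex \<Rightarrow> complex"
  assumes "isCont f t" "isCont g t" "f t = g t" "\<forall>\<^sub>F s in nhds t. exp (f s) = exp (g s)"
  shows "\<forall>\<^sub>F s in nhds t. f s = g s"
proof -
  have "isCont (\<lambda>s. f s - g s) t" using assms by (intro continuous_intros)
  then have "filterlim (\<lambda>s. f s - g s) (nhds (f t - g t)) (nhds t)" by (rule isCont_filterlim_nhds)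
  then have "filterlim (\<lambda>s. f s - g s) (nhds 0) (nhds t)" using assms(3) by simp
  then have "\<forall>\<^sub>F s in nhds t. dist (f s - g s) 0 < 1" by (rule tendstoD) simp
  with assms(4) show ?thesis
  proof eventually_elim
    case (elim s)
    then obtain n :: int where n: "f s = g s + (of_int (2 * n) * pi) * \<i>" by (auto simp: exp_eq)
    then have "norm (f s - g s) = 2 * pi * \<bar>of_int n\<bar>" by (simp add: norm_mult abs_mult)
    then have "2 * pi * \<bar>real_of_int n\<bar> < 1" using elim(2) by simp
    have "n = 0"
    proof (rule ccontr)
      assume "n \<noteq> 0"
      then have "1 \<le> \<bar>real_of_int n\<bar>" by linarith
      then have "2 * pi * 1 \<le> 2 * pi * \<bar>real_of_int n\<bar>" by (intro mult_left_mono) auto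
      then show False using \<open>2 * pi * \<bar>real_of_int n\<bar> < 1\<close> pi_gt3 by linarith
    qed
    then show ?case using n by simp
  qed
qed

context fibre_markings
begin

text \<open>The logarithms are quantified existentially because continuation around a loop may
  change them by multiples of 2 pi i: what persists is that some choice on each disc satisfies the
  relation.\<close>

definition log_relation ::
  "complex poly \<Rightarrow> complex poly \<Rightarrow> complex \<Rightarrow> complex \<Rightarrow> ('i \<Rightarrow> complex \<Rightarrow> complex) \<Rightarrow> complex \<Rightarrow> real \<Rightarrow> bool" where
  "log_relation Q T a b \<phi> c r \<longleftrightarrow> (\<exists>l. (\<forall>i\<in>I. l i holomorphic_on ball c r \<and>
     (\<forall>s\<in>ball c r. exp (l i s) = (\<phi> i s - b) / (\<phi> i s - a))) \<and>
     (\<forall>s\<in>ball c r. (\<Sum>i\<in>I. poly Q (\<phi> i s) * l i s + poly T (\<phi> i s)) = 0))"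

lemma family_subset: "family \<phi> c r \<Longrightarrow> ball c' r' \<subseteq> ball c r \<Longrightarrow> family \<phi> c' r'"
  unfolding family_def using holomorphic_on_subset by blast

text \<open>As the values at \<open>a\<close> and \<open>b\<close> are excluded, no branch meets
  these points, and the quotient has a logarithm on the new disc. A constant with exponential 1
  adjusts it to the old one at \<open>t\<close>; the two then agree near \<open>t\<close>, and the
  identity theorem does the rest.\<close>

lemma log_relation_transfer:
  assumes X: "poly P a \<in> X" "poly P b \<in> X"
    and fam: "family \<phi> c r" "family \<phi>' c' r'" and t: "t \<in> ball c r" "t \<in> ball c' r'"
    and eq: "\<And>i. i \<in> I \<Longrightarrow> \<forall>\<^sub>F s in nhds t. \<phi> i s = \<phi>' i s"
    and rel: "log_relation Q T a b \<phi> c r"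
  shows "log_relation Q T a b \<phi>' c' r'"
proof -
  obtain l where l: "\<And>i. i \<in> I \<Longrightarrow> l i holomorphic_on ball c r"
    "\<And>i s. i \<in> I \<Longrightarrow> s \<in> ball c r \<Longrightarrow> exp (l i s) = (\<phi> i s - b) / (\<phi> i s - a)"
    "\<And>s. s \<in> ball c r \<Longrightarrow> (\<Sum>i\<in>I. poly Q (\<phi> i s) * l i s + poly T (\<phi> i s)) = 0"
    using rel unfolding log_relation_def by blast
  have ne: "\<phi>' i s \<noteq> a" "\<phi>' i s \<noteq> b" if "i \<in> I" "s \<in> ball c' r'" for i s
    using family_marking[OF fam(2) that(2)] that(1) X by (auto simp: marking_def)
  have hol': "\<phi>' i holomorphic_on ball c' r'" if "i \<in> I" for i using fam(2) that by (simp add: family_def)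
  have "\<exists>l'. l' holomorphic_on ball c' r' \<and> (\<forall>s\<in>ball c' r'. exp (l' s) = (\<phi>' i s - b) / (\<phi>' i s - a)) \<and>
      l' t = l i t" if i: "i \<in> I" for i
  proof -
    obtain g where g: "g holomorphic_on ball c' r'" "\<And>s. s \<in> ball c' r' \<Longrightarrow> exp (g s) = (\<phi>' i s - b) / (\<phi>' i s - a)"
      by (rule holomorphic_logarithm_exists[of "ball c' r'" "\<lambda>s. (\<phi>' i s - b) / (\<phi>' i s - a)" t])
         (use ne[OF i] t(2) hol'[OF i] in \<open>auto intro!: holomorphic_intros\<close>)
    have "\<phi> i t = \<phi>' i t" using eq[OF i] by (rule eventually_nhds_x_imp_x)
    then have e: "exp (l i t) = exp (g t)" using l(2)[OF i t(1)] g(2)[OF t(2)] by simp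
    define k where "k = l i t - g t"
    have "exp k = 1" using e by (simp add: k_def exp_diff)
    then show ?thesis
      using g by (intro exI[of _ "\<lambda>s. g s + k"]) (auto simp: k_def exp_add intro!: holomorphic_intros)
  qed
  then obtain l' where l': "\<And>i. i \<in> I \<Longrightarrow> l' i holomorphic_on ball c' r'"
    "\<And>i s. i \<in> I \<Longrightarrow> s \<in> ball c' r' \<Longrightarrow> exp (l' i s) = (\<phi>' i s - b) / (\<phi>' i s - a)"
    "\<And>i. i \<in> I \<Longrightarrow> l' i t = l i t"
    by metis
  have evb: "\<forall>\<^sub>F s in nhds t. s \<in> ball c r" "\<forall>\<^sub>F s in nhds t. s \<in> ball c' r'"
    using t by (auto intro!: eventually_nhds_in_open simp del: mem_ball)
  have evl: "\<forall>\<^sub>F s in nhds t. l i s = l' i s" if i: "i \<in> I" for i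
  proof (rule logarithms_agree_near)
    show "isCont (l i) t" "isCont (l' i) t"
      using l(1)[OF i] l'(1)[OF i] t holomorphic_isCont by blast+
    show "\<forall>\<^sub>F s in nhds t. exp (l i s) = exp (l' i s)"
      using eq[OF i] evb by eventually_elim (use l(2)[OF i] l'(2)[OF i] in simp)
  qed (use l'(3)[OF i] in simp)
  have "\<forall>\<^sub>F s in nhds t. \<forall>i\<in>I. l i s = l' i s \<and> \<phi> i s = \<phi>' i s"
    using eq evl by (intro eventually_ball_finite finI ballI eventually_conj) auto
  then have "\<forall>\<^sub>F s in nhds t. (\<Sum>i\<in>I. poly Q (\<phi>' i s) * l' i s + poly T (\<phi>' i s)) = 0"
    using evb(1)
  proof eventually_elim
    case (elim s)
    have "(\<Sum>i\<in>I. poly Q (\<phi>' i s) * l' i s + poly T (\<phi>' i s)) = (\<Sum>i\<in>I. poly Q (\<phi> i s) * l i s + poly T (\<phi> i s))"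
      by (rule sum.cong) (use elim in auto)
    then show ?case using l(3)[OF elim(2)] by simp
  qed
  moreover have "(\<lambda>s. \<Sum>i\<in>I. poly Q (\<phi>' i s) * l' i s + poly T (\<phi>' i s)) holomorphic_on ball c' r'"
    by (intro holomorphic_intros hol' l'(1))
  ultimately have "(\<Sum>i\<in>I. poly Q (\<phi>' i s) * l' i s + poly T (\<phi>' i s)) = 0" if "s \<in> ball c' r'" for s
    using holomorphic_zero_near[OF _ open_ball connected_ball t(2) _ that] by blast
  then show ?thesis unfolding log_relation_def using l'(1,2) by blast
qed

lemma log_relation_everywhere:
  assumes X: "poly P a \<in> X" "poly P b \<in> X" and Pab: "poly P a = poly P b"
    and moments: "\<And>k R. pderiv R = P ^ k * pderiv Q \<Longrightarrow> poly R a = poly R b"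
  obtains T where "\<And>\<phi> c r t. family \<phi> c r \<Longrightarrow> t \<in> ball c r \<Longrightarrow> reach (\<lambda>i. \<phi> i t) \<Longrightarrow>
    log_relation Q T a b \<phi> c r"
proof -
  obtain R0 T where TR: "\<And>t (v :: 'i \<Rightarrow> complex) I. norm t \<ge> R0 \<Longrightarrow> finite I \<Longrightarrow> card I = degree P \<Longrightarrow>
      inj_on v I \<Longrightarrow> (\<And>i. i \<in> I \<Longrightarrow> poly P (v i) = t) \<Longrightarrow>
      (\<forall>i\<in>I. norm a < norm (v i) \<and> norm b < norm (v i)) \<and>
      (\<Sum>i\<in>I. poly Q (v i) * (Ln (1 - b / v i) - Ln (1 - a / v i)) + poly T (v i)) = 0"
  proof (rule moment_log_identity[of P a b Q, OF degP Pab])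
    show "poly R a = poly R b" if "pderiv R = P ^ k * pderiv Q" for k R
      by (rule moments[OF that])
  next
    fix T R0
    assume *: "\<And>t (v :: 'i \<Rightarrow> complex) I. norm t \<ge> R0 \<Longrightarrow> finite I \<Longrightarrow> card I = degree P \<Longrightarrow>
      inj_on v I \<Longrightarrow> (\<And>i. i \<in> I \<Longrightarrow> poly P (v i) = t) \<Longrightarrow>
      (\<forall>i\<in>I. norm a < norm (v i) \<and> norm b < norm (v i)) \<and>
      (\<Sum>i\<in>I. poly Q (v i) * (Ln (1 - b / v i) - Ln (1 - a / v i)) + poly T (v i)) = 0"
    show thesis by (rule that[of R0 T]) (rule *)
  qed
  obtain c0 p0 where Pc: "P = pCons c0 p0" by (cases P)
  have "p0 \<noteq> 0" using degP Pc by auto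
  \<comment> \<open>The extra 1 leaves room for a disc of radius at most 1 around the value at
    \<open>z0\<close> on which norms stay at least \<open>R0\<close>.\<close>
  then obtain r1 where r1: "\<And>z. r1 \<le> norm z \<Longrightarrow> R0 + 1 \<le> norm (poly P z)"
    using poly_infinity[of p0 "R0 + 1" c0] unfolding Pc by blast
  obtain r2 where r2: "\<And>z. \<not> regular (poly P z) \<Longrightarrow> norm z \<le> r2"
    using finite_imp_bounded[OF finite_irregular] by (auto simp: bounded_iff)
  define z0 where "z0 = complex_of_real (max 0 (max r1 (r2 + 1)))"
  have z0: "r1 \<le> norm z0" "r2 < norm z0" by (auto simp: z0_def)
  define t0 where "t0 = poly P z0"
  have "regular t0" using r2[of z0] z0 by (force simp: t0_def)
  obtain i0 where i0: "i0 \<in> I" using I_nonempty by blast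
  obtain m where m: "reach m" "marking m t0"
    using reach_through[of z0 i0] \<open>regular t0\<close> i0 unfolding t0_def by blast
  obtain r \<phi> where \<phi>: "r > 0" "family \<phi> t0 r" "\<And>i. i \<in> I \<Longrightarrow> \<phi> i t0 = m i"
    by (rule local_family[OF m(2)]) (rule that; assumption)
  define r' where "r' = min r 1"
  have fam: "family \<phi> t0 r'" by (rule family_subset[OF \<phi>(2)]) (auto simp: r'_def)
  have tb: "t0 \<in> ball t0 r'" using \<phi>(1) by (simp add: r'_def)
  have start: "log_relation Q T a b \<phi> t0 r'"
  proof -
    define l where "l = (\<lambda>i s. Ln (1 - b / \<phi> i s) - Ln (1 - a / \<phi> i s))"
    have big: "(\<forall>i\<in>I. norm a < norm (\<phi> i s) \<and> norm b < norm (\<phi> i s)) \<and>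
      (\<Sum>i\<in>I. poly Q (\<phi> i s) * l i s + poly T (\<phi> i s)) = 0" if s: "s \<in> ball t0 r'" for s
      unfolding l_def
    proof (rule TR[OF _ finI cardI])
      have "dist t0 s < 1" using s by (simp add: r'_def)
      then have "norm t0 - norm s < 1"
        using norm_triangle_ineq2[of t0 s] by (simp add: dist_norm)
      then show "R0 \<le> norm s" using r1[OF z0(1)] by (simp add: t0_def)
      show "inj_on (\<lambda>i. \<phi> i s) I" "\<And>i. i \<in> I \<Longrightarrow> poly P (\<phi> i s) = s"
        using family_marking[OF fam s] by (auto simp: marking_def)
    qed
    have nonpos: "1 - x / y \<notin> \<real>\<^sub>\<le>\<^sub>0" if "norm x < norm y" for x y :: complex
    proof -
      have "norm (x / y) < 1" using that by (cases "y = 0") (auto simp: norm_divide)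
      then have "Re (x / y) < 1" using complex_Re_le_cmod[of "x / y"] by linarith
      then show ?thesis by (auto simp: complex_nonpos_Reals_iff)
    qed
    have hol: "\<phi> i holomorphic_on ball t0 r'" if "i \<in> I" for i using fam that by (simp add: family_def)
    have "l i holomorphic_on ball t0 r'" if i: "i \<in> I" for i
    proof -
      have "\<phi> i s \<noteq> 0" if "s \<in> ball t0 r'" for s using big[OF that] i by force
      then show ?thesis unfolding l_def
        using big i nonpos by (intro holomorphic_intros hol) auto
    qed
    moreover have "exp (l i s) = (\<phi> i s - b) / (\<phi> i s - a)" if i: "i \<in> I" and s: "s \<in> ball t0 r'" for i s
    proof -
      have n: "norm a < norm (\<phi> i s)" "norm b < norm (\<phi> i s)" using big[OF s] i by auto
      then have "\<phi> i s \<noteq> 0" "\<phi> i s \<noteq> a" "\<phi> i s \<noteq> b" by auto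
      then show ?thesis unfolding l_def exp_diff by (simp add: field_simps)
    qed
    ultimately show ?thesis unfolding log_relation_def using big by blast
  qed
  have re: "reach (\<lambda>i. \<phi> i t0)" by (rule continuable_cong[OF m(1)]) (simp add: \<phi>(3))
  show ?thesis
  proof (rule that[of T])
    fix \<phi>' c r'' t assume *: "family \<phi>' c r''" "t \<in> ball c r''" "reach (\<lambda>i. \<phi>' i t)"
    show "log_relation Q T a b \<phi>' c r''"
      by (rule continuation[where A = "log_relation Q T a b", OF _ fam tb re start *])
         (rule log_relation_transfer[OF X]; assumption)
  qed
qed

end

section \<open>The fibre through a and b, and the relation between the two means\<close>

locale critical_fibre = fibre_chart P c\<^sub>1 \<rho> \<kappa>
  for P :: "complex poly" and c\<^sub>1 :: complex and \<rho> :: real and \<kappa> :: "complex \<Rightarrow> complex \<Rightarrow> complex" +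
  fixes Q :: "complex poly" and a b u0 :: complex
  assumes u0: "u0 \<in> H" and ab: "a \<noteq> b" and Pa: "poly P a = c\<^sub>1" and Pb: "poly P b = c\<^sub>1"
    and noncritical: "\<And>z. poly P z = c\<^sub>1 \<Longrightarrow> z \<noteq> a \<Longrightarrow> z \<noteq> b \<Longrightarrow> poly (pderiv P) z \<noteq> 0"
    and moments: "\<And>k R. pderiv R = P ^ k * pderiv Q \<Longrightarrow> poly R a = poly R b"
begin

text \<open>The value \<open>c\<^sub>1\<close> is excluded even if all points over it are simple,
  since the logarithms are singular at \<open>a\<close> and \<open>b\<close>. Taking the base point
  close to it makes the local turn \<open>\<sigma>\<close> an element of \<open>G\<close>.\<close>

sublocale fibre_markings P J "{c\<^sub>1}" "\<lambda>x. branch x u0" "c\<^sub>1 + exp u0"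
  by unfold_locales
    (use degW finite_J card_J branch_inj[OF u0] branch_value[OF _ u0] in auto)

lemma marking_branch: "u \<in> H \<Longrightarrow> marking (\<lambda>x. branch x u) (c\<^sub>1 + exp u)"
  unfolding marking_def using branch_inj branch_value by auto

lemma reach_branch:
  assumes "u \<in> H"
  shows "reach (\<lambda>x. branch x u)"
proof -
  obtain m where "reach m" "\<And>x. x \<in> J \<Longrightarrow> m x = branch x u"
  proof (rule lift_connected[of H J "\<lambda>u. c\<^sub>1 + exp u" branch u0 u "\<lambda>x. branch x u0"])
    show "connected H" using convex_H by (rule convex_connected)
    show "regular (c\<^sub>1 + exp s)" if "s \<in> H" for s
      using marking_branch[OF that] marking_regular by blast
    show "continuous_on H (branch x)" if "x \<in> J" for x
      using branch_holomorphic[OF that] by (rule holomorphic_on_imp_continuous_on)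
    fix m' assume "reach m'" "\<And>i. i \<in> J \<Longrightarrow> m' i = branch i u"
    then show thesis by (rule that)
  qed (use assms u0 marking_branch branch_value in \<open>auto intro!: continuous_intros\<close>)
  then show ?thesis by (rule continuable_cong)
qed

lemma \<sigma>_in_G: "\<sigma> \<in> G"
proof -
  have "reach (\<lambda>x. branch x (u0 + 2 * of_real pi * \<i>))"
    by (rule reach_branch) (use u0 in \<open>simp add: H_def\<close>)
  then have "reach ((\<lambda>x. branch x u0) \<circ> \<sigma>)"
    by (rule continuable_cong) (simp add: branch_shift)
  then show ?thesis using \<sigma>_permutes by (simp add: G_def)
qed

lemma mult_eq_1: "poly P s = c\<^sub>1 \<Longrightarrow> s \<noteq> a \<Longrightarrow> s \<noteq> b \<Longrightarrow> mult s = 1"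
proof -
  assume s: "poly P s = c\<^sub>1" "s \<noteq> a" "s \<noteq> b"
  have "P - [:c\<^sub>1:] \<noteq> 0" using degW by auto
  moreover have "poly (P - [:c\<^sub>1:]) s = 0" using s by simp
  ultimately have "mult s = Suc (order s (pderiv (P - [:c\<^sub>1:])))" by (rule order_pderiv)
  moreover have "order s (pderiv (P - [:c\<^sub>1:])) = 0"
    by (rule order_0I) (use noncritical[OF s] in \<open>simp add: pderiv_diff pderiv_pCons\<close>)
  ultimately show ?thesis by simp
qed

text \<open>The coefficient of \<open>u\<close> in the logarithm of (z - b) / (z - a) along a
  branch. Summation against it gives the mean over the branches at \<open>b\<close> minus the mean
  over those at \<open>a\<close>.\<close>

definition v :: "complex \<times> nat \<Rightarrow> real" where
  "v x = (if fst x = b then 1 / real (mult b) else if fst x = a then - 1 / real (mult a) else 0)"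

lemma sum_v:
  fixes f :: "complex \<times> nat \<Rightarrow> 'z::real_vector"
  shows "(\<Sum>x\<in>J. v x *\<^sub>R f x) =
    (1 / real (mult b)) *\<^sub>R (\<Sum>j<mult b. f (b, j)) - (1 / real (mult a)) *\<^sub>R (\<Sum>j<mult a. f (a, j))"
proof -
  let ?F = "{z. poly P z = c\<^sub>1}"
  have fin: "finite ?F" by (rule finite_poly_fibre[OF degW])
  have "(\<Sum>x\<in>J. v x *\<^sub>R f x) = (\<Sum>s\<in>?F. \<Sum>j<mult s. v (s, j) *\<^sub>R f (s, j))"
    unfolding J_def by (subst sum.Sigma) (use fin in \<open>auto simp: split_def\<close>)
  also have "\<dots> = (\<Sum>s\<in>{a, b}. \<Sum>j<mult s. v (s, j) *\<^sub>R f (s, j))"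
    by (rule sum.mono_neutral_right) (use fin Pa Pb in \<open>auto simp: v_def\<close>)
  also have "\<dots> = (1 / real (mult b)) *\<^sub>R (\<Sum>j<mult b. f (b, j)) - (1 / real (mult a)) *\<^sub>R (\<Sum>j<mult a. f (a, j))"
    using ab by (simp add: v_def scaleR_sum_right sum_negf)
  finally show ?thesis .
qed

text \<open>A local inverse of the map from \<open>u\<close> to \<open>c\<^sub>1 + exp u\<close>.
  Division by \<open>exp u0\<close> keeps the principal logarithm away from its cut near the base
  point.\<close>

definition \<nu> :: "complex \<Rightarrow> complex" where
  "\<nu> s = u0 + Ln ((s - c\<^sub>1) / exp u0)"

lemma chart_family:
  obtains r where "r > 0" "family (\<lambda>x s. branch x (\<nu> s)) (c\<^sub>1 + exp u0) r" "\<nu> (c\<^sub>1 + exp u0) = u0"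
    "\<And>s. s \<in> ball (c\<^sub>1 + exp u0) r \<Longrightarrow> \<nu> s \<in> H"
    "\<forall>\<^sub>F u in nhds u0. u \<in> H \<and> c\<^sub>1 + exp u \<in> ball (c\<^sub>1 + exp u0) r \<and> \<nu> (c\<^sub>1 + exp u) = u"
proof -
  define t where "t = c\<^sub>1 + exp u0"
  have \<nu>t: "\<nu> t = u0" by (simp add: \<nu>_def t_def)
  have pos: "(s - c\<^sub>1) / exp u0 \<notin> \<real>\<^sub>\<le>\<^sub>0" "s \<noteq> c\<^sub>1" if "s \<in> ball t (norm (exp u0))" for s
  proof -
    have "(s - c\<^sub>1) / exp u0 = 1 - (t - s) / exp u0" by (simp add: t_def field_simps)
    moreover have "norm ((t - s) / exp u0) < 1"
      using that by (simp add: norm_divide dist_norm del: norm_exp_eq_Re)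
    then have "Re ((t - s) / exp u0) < 1" using complex_Re_le_cmod[of "(t - s) / exp u0"] by linarith
    ultimately have R: "Re ((s - c\<^sub>1) / exp u0) > 0" by simp
    then show "(s - c\<^sub>1) / exp u0 \<notin> \<real>\<^sub>\<le>\<^sub>0" by (simp add: complex_nonpos_Reals_iff)
    show "s \<noteq> c\<^sub>1" using R by auto
  qed
  have hol\<nu>: "\<nu> holomorphic_on ball t (norm (exp u0))"
    unfolding \<nu>_def[abs_def] by (intro holomorphic_intros) (use pos in auto)
  have "t \<in> ball t (norm (exp u0))" by (simp del: norm_exp_eq_Re)
  then have "isCont \<nu> t" using hol\<nu> holomorphic_isCont by blast
  then have "\<exists>r>0. \<forall>s. dist t s < r \<longrightarrow> \<nu> s \<in> H"
    using continuous_at_open[of t \<nu>] open_H u0 \<nu>t by (metis open_dist dist_commute)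
  then obtain r1 where r1: "r1 > 0" "\<And>s. dist t s < r1 \<Longrightarrow> \<nu> s \<in> H" by blast
  define r where "r = min r1 (norm (exp u0))"
  have r: "r > 0" using r1 by (simp add: r_def del: norm_exp_eq_Re)
  have rb: "ball t r \<subseteq> ball t (norm (exp u0))" by (auto simp: r_def simp del: norm_exp_eq_Re)
  have \<nu>H: "\<nu> s \<in> H" if "s \<in> ball t r" for s using r1(2) that by (simp add: r_def)
  have exp\<nu>: "c\<^sub>1 + exp (\<nu> s) = s" if "s \<in> ball t r" for s
    using pos(2)[of s] rb that by (auto simp: \<nu>_def exp_add)
  show ?thesis
  proof (rule that[OF r])
    show "family (\<lambda>x s. branch x (\<nu> s)) (c\<^sub>1 + exp u0) r"
      unfolding family_def t_def[symmetric]
    proof safe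
      fix x assume x: "x \<in> J"
      have "branch x \<circ> \<nu> holomorphic_on ball t r"
        by (rule holomorphic_on_compose_gen[OF holomorphic_on_subset[OF hol\<nu> rb] branch_holomorphic[OF x]])
           (use \<nu>H in auto)
      then show "(\<lambda>s. branch x (\<nu> s)) holomorphic_on ball t r" by (simp add: o_def)
    next
      fix s assume "s \<in> ball t r"
      then show "marking (\<lambda>x. branch x (\<nu> s)) s"
        using marking_branch[OF \<nu>H] exp\<nu> by metis
    qed
    show "\<nu> (c\<^sub>1 + exp u0) = u0" using \<nu>t by (simp add: t_def)
    show "\<nu> s \<in> H" if "s \<in> ball (c\<^sub>1 + exp u0) r" for s using \<nu>H that by (simp add: t_def)
    have "\<forall>\<^sub>F u in nhds u0. u \<in> H" using open_H u0 by (rule eventually_nhds_in_open)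
    moreover have "\<forall>\<^sub>F u in nhds u0. c\<^sub>1 + exp u \<in> ball (c\<^sub>1 + exp u0) r"
    proof -
      have "open ((\<lambda>u. c\<^sub>1 + exp u) -` ball (c\<^sub>1 + exp u0) r)"
        by (intro open_vimage continuous_intros) auto
      then show ?thesis using r by (auto simp: eventually_nhds intro!: exI[of _ "(\<lambda>u. c\<^sub>1 + exp u) -` ball (c\<^sub>1 + exp u0) r"])
    qed
    moreover have "\<forall>\<^sub>F u in nhds u0. u \<in> ball u0 1" by (rule eventually_nhds_in_open) auto
    then have "\<forall>\<^sub>F u in nhds u0. \<nu> (c\<^sub>1 + exp u) = u"
    proof eventually_elim
      case (elim u)
      have "\<bar>Im (u - u0)\<bar> < 1" using elim abs_Im_le_cmod[of "u - u0"] by (simp add: dist_norm norm_minus_commute)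
      then have "Ln (exp (u - u0)) = u - u0"
        by (intro Ln_exp) (use pi_gt3 in linarith)+
      then show ?case by (simp add: \<nu>_def exp_diff)
    qed
    ultimately show "\<forall>\<^sub>F u in nhds u0. u \<in> H \<and> c\<^sub>1 + exp u \<in> ball (c\<^sub>1 + exp u0) r \<and> \<nu> (c\<^sub>1 + exp u) = u"
      by eventually_elim auto
  qed
qed

text \<open>Turning \<open>mult a * mult b\<close> times around \<open>c\<^sub>1\<close> restores every branch but changes the
  logarithms by multiples of \<open>v\<close>.\<close>

lemma weighted_sum_near:
  assumes "u \<in> H"
  shows "(\<Sum>x\<in>J. v x *\<^sub>R poly Q (branch x u)) = 0"
proof -
  define t where "t = c\<^sub>1 + exp u0"
  obtain r where r: "r > 0" "family (\<lambda>x s. branch x (\<nu> s)) t r" "\<nu> t = u0"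
    "\<forall>\<^sub>F u in nhds u0. u \<in> H \<and> c\<^sub>1 + exp u \<in> ball t r \<and> \<nu> (c\<^sub>1 + exp u) = u"
    by (rule chart_family[folded t_def]) (rule that; assumption)
  have tb: "t \<in> ball t r" using r(1) by simp
  obtain T where TT: "\<And>\<phi> c r t. family \<phi> c r \<Longrightarrow> t \<in> ball c r \<Longrightarrow> reach (\<lambda>i. \<phi> i t) \<Longrightarrow>
      log_relation Q T a b \<phi> c r"
    using log_relation_everywhere[of a b Q] Pa Pb moments by auto
  have "log_relation Q T a b (\<lambda>x s. branch x (\<nu> s)) t r"
    by (rule TT[OF r(2) tb]) (use reach_branch[OF u0] in \<open>simp only: r(3)\<close>)
  then obtain l where l: "\<And>x. x \<in> J \<Longrightarrow> l x holomorphic_on ball t r"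
    "\<And>x s. x \<in> J \<Longrightarrow> s \<in> ball t r \<Longrightarrow> exp (l x s) = (branch x (\<nu> s) - b) / (branch x (\<nu> s) - a)"
    "\<And>s. s \<in> ball t r \<Longrightarrow> (\<Sum>x\<in>J. poly Q (branch x (\<nu> s)) * l x s + poly T (branch x (\<nu> s))) = 0"
    unfolding log_relation_def by blast
  have "\<exists>\<Lambda>. \<Lambda> holomorphic_on ball 0 \<rho> \<and> (\<forall>\<zeta>\<in>ball 0 \<rho>. \<zeta> \<noteq> 0 \<longrightarrow> (\<kappa> s \<zeta> - b) / (\<kappa> s \<zeta> - a) =
       (if s = b then \<zeta> else if s = a then 1 / \<zeta> else 1) * exp (\<Lambda> \<zeta>))" if s: "poly P s = c\<^sub>1" for s
  proof -
    obtain \<Lambda> where "\<Lambda> holomorphic_on ball 0 \<rho>"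
      "\<And>\<zeta>. \<zeta> \<in> ball 0 \<rho> \<Longrightarrow> \<zeta> \<noteq> 0 \<Longrightarrow> (\<kappa> s \<zeta> - b) / (\<kappa> s \<zeta> - a) =
       (if s = b then \<zeta> else if s = a then 1 / \<zeta> else 1) * exp (\<Lambda> \<zeta>)"
      by (rule chart_logarithm[OF ab Pa Pb s]) (rule that; assumption)
    then show ?thesis by blast
  qed
  then obtain \<Lambda> where \<Lambda>: "\<And>s. poly P s = c\<^sub>1 \<Longrightarrow> \<Lambda> s holomorphic_on ball 0 \<rho>"
    "\<And>s \<zeta>. poly P s = c\<^sub>1 \<Longrightarrow> \<zeta> \<in> ball 0 \<rho> \<Longrightarrow> \<zeta> \<noteq> 0 \<Longrightarrow> (\<kappa> s \<zeta> - b) / (\<kappa> s \<zeta> - a) =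
       (if s = b then \<zeta> else if s = a then 1 / \<zeta> else 1) * exp (\<Lambda> s \<zeta>)"
    by metis
  define L where "L = (\<lambda>x u. of_real (v x) * (u + 2 * of_real pi * \<i> * of_nat (snd x)) +
      \<Lambda> (fst x) (unif (fst x) (snd x) u))"
  have holL: "L x holomorphic_on H" if x: "x \<in> J" for x
  proof -
    have "\<Lambda> (fst x) \<circ> unif (fst x) (snd x) holomorphic_on H"
      by (rule holomorphic_on_compose_gen[where t = "ball 0 \<rho>"])
         (use x unif_in_ball \<Lambda>(1) unif_holomorphic in \<open>auto simp: in_J\<close>)
    then show ?thesis unfolding L_def o_def by (intro holomorphic_intros)
  qed
  have expL: "exp (L x u) = (branch x u - b) / (branch x u - a)" if x: "x \<in> J" and u: "u \<in> H" for x u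
  proof -
    define s where "s = fst x"
    have s: "poly P s = c\<^sub>1" using x by (simp add: in_J s_def)
    define y where "y = u + 2 * of_real pi * \<i> * of_nat (snd x)"
    have un: "unif s (snd x) u = exp (y / of_nat (mult s))" by (simp add: unif_def y_def)
    have "exp (of_real (v x) * y) = (if s = b then unif s (snd x) u else if s = a then 1 / unif s (snd x) u else 1)"
      unfolding un v_def s_def[symmetric] using exp_minus[of "y / of_nat (mult a)"]
      by (auto simp: field_simps)
    then show ?thesis
      using \<Lambda>(2)[OF s unif_in_ball[OF s u] unif_nonzero, of "snd x"]
      by (simp add: L_def exp_add branch_def s_def y_def)
  qed
  \<comment> \<open>The continued logarithm \<open>l x\<close> and the explicit \<open>L x\<close>
    differ by this constant, whose exponential is 1; it drops out when the values of
    \<open>F\<close> at \<open>u\<close> and \<open>u'\<close> are subtracted.\<close>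
  define k where "k = (\<lambda>x. l x t - L x u0)"
  have expk: "exp (k x) = 1" if "x \<in> J" for x
    using l(2)[OF that tb] expL[OF that u0] r(3) marking_branch[OF u0] that Pa Pb
    by (auto simp: k_def exp_diff marking_def)
  define F where "F = (\<lambda>u. \<Sum>x\<in>J. poly Q (branch x u) * (L x u + k x) + poly T (branch x u))"
  have near: "\<forall>\<^sub>F u in nhds u0. F u = 0"
  proof -
    have "\<forall>\<^sub>F u in nhds u0. \<forall>x\<in>J. l x (c\<^sub>1 + exp u) = L x u + k x"
    proof (intro eventually_ball_finite finI ballI)
      fix x assume x: "x \<in> J"
      show "\<forall>\<^sub>F u in nhds u0. l x (c\<^sub>1 + exp u) = L x u + k x"
      proof (rule logarithms_agree_near)
        have "isCont (l x) t"
          using l(1)[OF x] tb holomorphic_isCont by blast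
        moreover have "isCont (\<lambda>u. c\<^sub>1 + exp u) u0" by (intro continuous_intros)
        ultimately show "isCont (\<lambda>u. l x (c\<^sub>1 + exp u)) u0"
          unfolding t_def by (rule isCont_o2[rotated])
        have "isCont (L x) u0"
          using holL[OF x] open_H u0 by (rule holomorphic_isCont)
        then show "isCont (\<lambda>u. L x u + k x) u0" by (intro continuous_intros)
        show "l x (c\<^sub>1 + exp u0) = L x u0 + k x" by (simp add: k_def t_def)
        show "\<forall>\<^sub>F u in nhds u0. exp (l x (c\<^sub>1 + exp u)) = exp (L x u + k x)"
          using r(4) by eventually_elim (use l(2)[OF x] expL[OF x] expk[OF x] in \<open>simp add: exp_add\<close>)
      qed
    qed
    with r(4) show ?thesis
    proof eventually_elim
      case (elim u)
      have "F u = (\<Sum>x\<in>J. poly Q (branch x (\<nu> (c\<^sub>1 + exp u))) * l x (c\<^sub>1 + exp u) + poly T (branch x (\<nu> (c\<^sub>1 + exp u))))"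
        unfolding F_def by (rule sum.cong) (use elim in auto)
      also have "\<dots> = 0" by (rule l(3)) (use elim in blast)
      finally show ?case .
    qed
  qed
  have holF: "F holomorphic_on H"
    unfolding F_def by (intro holomorphic_intros branch_holomorphic holL)
  have F0: "F u = 0" if "u \<in> H" for u
    by (rule holomorphic_zero_near[OF holF open_H convex_connected[OF convex_H] u0 near that])
  \<comment> \<open>Every multiplicity in the fibre divides \<open>N\<close>: apart from
    \<open>a\<close> and \<open>b\<close> it is 1, by the hypothesis on critical points.\<close>
  define N where "N = mult a * mult b"
  define u' where "u' = u + 2 * of_real pi * \<i> * of_nat N"
  have u': "u' \<in> H" using assms by (simp add: u'_def H_def)
  have un': "unif (fst x) (snd x) u' = unif (fst x) (snd x) u" if x: "x \<in> J" for x
  proof -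
    have s: "poly P (fst x) = c\<^sub>1" using x by (simp add: in_J)
    have "mult (fst x) dvd N"
      using mult_eq_1[OF s] by (cases "fst x = a \<or> fst x = b") (auto simp: N_def)
    then obtain q where q: "N = mult (fst x) * q" by (elim dvdE)
    show ?thesis unfolding unif_def exp_eq
    proof (rule exI[of _ "int q"])
      show "(u' + 2 * complex_of_real pi * \<i> * of_nat (snd x)) / of_nat (mult (fst x)) =
        (u + 2 * complex_of_real pi * \<i> * of_nat (snd x)) / of_nat (mult (fst x)) + (of_int (2 * int q) * pi) * \<i>"
        unfolding u'_def q using mult_pos[OF s] by (simp add: field_simps)
    qed
  qed
  have br': "branch x u' = branch x u" if "x \<in> J" for x using un'[OF that] by (simp add: branch_def)
  have L': "L x u' = L x u + of_real (v x) * (2 * of_real pi * \<i> * of_nat N)" if "x \<in> J" for x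
    using un'[OF that] by (simp add: L_def u'_def algebra_simps)
  have "F u' - F u = (\<Sum>x\<in>J. poly Q (branch x u) * (of_real (v x) * (2 * of_real pi * \<i> * of_nat N)))"
    unfolding F_def sum_subtractf[symmetric] by (rule sum.cong) (auto simp: br' L' algebra_simps)
  also have "\<dots> = (\<Sum>x\<in>J. v x *\<^sub>R poly Q (branch x u)) * (2 * of_real pi * \<i> * of_nat N)"
    unfolding sum_distrib_right scaleR_conv_of_real by (rule sum.cong) (simp_all add: mult_ac)
  finally have "(\<Sum>x\<in>J. v x *\<^sub>R poly Q (branch x u)) * (2 * of_real pi * \<i> * of_nat N) = 0"
    using F0[OF u'] F0[OF assms] by simp
  moreover have "N > 0" using mult_pos Pa Pb by (simp add: N_def)
  ultimately show ?thesis by simp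
qed

lemma weighted_sum:
  assumes "reach m"
  shows "(\<Sum>x\<in>J. v x *\<^sub>R poly Q (m x)) = 0"
proof -
  define t where "t = c\<^sub>1 + exp u0"
  obtain r where r: "r > 0" "family (\<lambda>x s. branch x (\<nu> s)) t r" "\<nu> t = u0"
    "\<And>s. s \<in> ball t r \<Longrightarrow> \<nu> s \<in> H"
    by (rule chart_family[folded t_def]) (rule that; assumption)
  show ?thesis
  proof (rule relation_continues[where F = "\<lambda>m. \<Sum>x\<in>J. v x *\<^sub>R poly Q (m x)", OF _ _ r(2) _ _ _ assms])
    show "(\<lambda>s. \<Sum>x\<in>J. v x *\<^sub>R poly Q (\<phi> x s)) holomorphic_on ball c r" if "family \<phi> c r" for \<phi> c r
      unfolding scaleR_conv_of_real using that by (intro holomorphic_intros) (auto simp: family_def)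
    show "t \<in> ball t r" using r(1) by simp
    show "reach (\<lambda>x. branch x (\<nu> t))" using reach_branch[OF u0] r(3) by simp
    show "(\<Sum>x\<in>J. v x *\<^sub>R poly Q (branch x (\<nu> s))) = 0" if "s \<in> ball t r" for s
      by (rule weighted_sum_near[OF r(4)[OF that]])
  qed (rule sum.cong, auto)
qed

text \<open>Agreement of \<open>Q\<close> under all continuations is an equivalence preserved by
  \<open>G\<close>. On its classes both \<open>P\<close> and \<open>Q\<close> are constant, so both
  factor through the polynomial of this block system.\<close>

lemma decomposition_of_coincidence:
  assumes "i \<in> J" "j \<in> J" "i \<noteq> j" "\<And>m. reach m \<Longrightarrow> poly Q (m i) = poly Q (m j)"
  obtains P' Q' W where "degree W \<ge> 2" "P = pcompose P' W" "Q = pcompose Q' W"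
proof -
  define R where "R = (\<lambda>i j. \<forall>m. reach m \<longrightarrow> poly Q (m i) = poly Q (m j))"
  have "R (g i) (g j)" if "g \<in> G" "R i j" for g i j
    unfolding R_def
  proof (intro allI impI)
    fix m assume "reach m"
    then have "reach (m \<circ> g)" by (rule reach_comp[OF that(1)])
    then have "poly Q ((m \<circ> g) i) = poly Q ((m \<circ> g) j)" using that(2) unfolding R_def by blast
    then show "poly Q (m (g i)) = poly Q (m (g j))" by simp
  qed
  then have R: "G_equivalence R" unfolding G_equivalence_def by (auto simp: R_def)
  obtain W where bf: "block_factor W R" by (rule block_polynomial[OF R])
  have "{i, j} \<subseteq> {j\<in>J. R i j}" using assms by (auto simp: R_def)
  then have "2 \<le> card {j\<in>J. R i j}"
    using card_mono[of "{j\<in>J. R i j}" "{i, j}"] finite_J assms(3) by simp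
  then have "degree W \<ge> 2" using block_factorD(2)[OF bf assms(1)] by simp
  moreover have "\<exists>P'. P = pcompose P' W" by (rule block_factor_divides[OF bf])
  moreover have "\<exists>Q'. Q = pcompose Q' W"
    by (rule factor_through_block_polynomial[OF bf]) (auto simp: R_def)
  ultimately show ?thesis using that by blast
qed

end

section \<open>The separating kernel\<close>

context critical_fibre
begin

lemma branch_tendsto:
  assumes "x \<in> J"
  shows "(\<lambda>n. branch x (of_real (- real n))) \<longlonglongrightarrow> fst x"
proof (rule tendstoI)
  fix \<eta> :: real assume "\<eta> > 0"
  then obtain r where r: "\<And>x u. x \<in> J \<Longrightarrow> u \<in> H \<Longrightarrow> Re u < r \<Longrightarrow> dist (branch x u) (fst x) < \<eta>"
    using branch_limit by blast
  have "\<forall>\<^sub>F n in sequentially. - real n < min r (real (degree P) * ln \<rho>)"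
    by real_asymp
  then show "\<forall>\<^sub>F n in sequentially. dist (branch x (of_real (- real n))) (fst x) < \<eta>"
    by eventually_elim (use assms r in \<open>auto simp: H_def\<close>)
qed

lemma in_H_eventually: "\<forall>\<^sub>F n in sequentially. of_real (- real n) \<in> H"
proof -
  have "\<forall>\<^sub>F n in sequentially. - real n < real (degree P) * ln \<rho>" by real_asymp
  then show ?thesis by (simp add: H_def)
qed

text \<open>At a regular value the roots of \<open>W - W (m i)\<close> are the members of the block of \<open>i\<close>;
  let the value tend to \<open>c\<^sub>1\<close>.\<close>

lemma block_polynomial_at_fibre:
  assumes bf: "block_factor W R" and i: "i \<in> J"
  shows "poly W z = poly W (fst i) + lead_coeff W * (\<Prod>x\<in>{j\<in>J. R i j}. z - fst x)"
proof -
  note degW = block_factorD(1,2)[OF bf]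
  define cls where "cls = {j\<in>J. R i j}"
  have fin: "finite cls" using finite_J by (simp add: cls_def)
  have eq: "poly W z = poly W (branch i u) + lead_coeff W * (\<Prod>x\<in>cls. z - branch x u)" if u: "u \<in> H" for u
  proof -
    define p where "p = W - [:poly W (branch i u):]"
    have degp: "degree p = degree W"
      by (simp add: p_def degree_minus_const)
    note fibre = block_fibre[OF bf reach_branch[OF u] i, folded cls_def]
    note inj = fibre(1)
    have "p = smult (lead_coeff p) (\<Prod>s\<in>(\<lambda>x. branch x u) ` cls. [:-s, 1:])"
    proof (rule poly_eq_prod_roots)
      show "p \<noteq> 0" using degp degW(1) by auto
      show "card ((\<lambda>x. branch x u) ` cls) = degree p"
        using card_image[OF inj] degp degW(2)[OF i] by (simp add: cls_def)
      show "poly p s = 0" if "s \<in> (\<lambda>x. branch x u) ` cls" for s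
        using that unfolding fibre(2) by (simp add: p_def)
    qed (use fin in auto)
    moreover have "lead_coeff p = lead_coeff W"
      using degp degW(1) by (simp add: p_def coeff_pCons split: nat.split)
    ultimately have "p = smult (lead_coeff W) (\<Prod>s\<in>(\<lambda>x. branch x u) ` cls. [:-s, 1:])" by simp
    then have "poly p z = lead_coeff W * (\<Prod>x\<in>cls. z - branch x u)"
      by (simp add: poly_prod prod.reindex[OF inj])
    then show ?thesis by (simp add: p_def algebra_simps)
  qed
  have "(\<lambda>n. poly W (branch i (of_real (- real n))) + lead_coeff W * (\<Prod>x\<in>cls. z - branch x (of_real (- real n))))
    \<longlonglongrightarrow> poly W (fst i) + lead_coeff W * (\<Prod>x\<in>cls. z - fst x)"
    by (intro tendsto_intros tendsto_prod branch_tendsto i) (auto simp: cls_def intro: branch_tendsto)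
  moreover have "\<forall>\<^sub>F n in sequentially.
      poly W (branch i (of_real (- real n))) + lead_coeff W * (\<Prod>x\<in>cls. z - branch x (of_real (- real n))) = poly W z"
    using in_H_eventually by eventually_elim (rule eq[symmetric])
  then have "(\<lambda>n. poly W (branch i (of_real (- real n))) + lead_coeff W * (\<Prod>x\<in>cls. z - branch x (of_real (- real n))))
    \<longlonglongrightarrow> poly W z"
    by (rule tendsto_eventually)
  ultimately show ?thesis unfolding cls_def[symmetric] using LIMSEQ_unique by blast
qed

end

locale separated_fibre = critical_fibre +
  assumes separated: "\<And>i j. i \<in> J \<Longrightarrow> j \<in> J \<Longrightarrow> i \<noteq> j \<Longrightarrow> \<exists>m. reach m \<and> poly Q (m i) \<noteq> poly Q (m j)"
begin

definition separating :: "(complex \<times> nat) \<times> (complex \<times> nat) \<Rightarrow> complex \<times> nat \<Rightarrow> complex" where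
  "separating p = (SOME m. reach m \<and> poly Q (m (fst p)) \<noteq> poly Q (m (snd p)))"

definition pairs :: "((complex \<times> nat) \<times> (complex \<times> nat)) set" where
  "pairs = {p \<in> J \<times> J. fst p \<noteq> snd p}"

text \<open>One marking for each pair of labels suffices to separate them all while keeping the sum
  finite. The real inner product on the complex plane gives a real symmetric, positive semidefinite
  matrix, so contributions of different markings cannot cancel.\<close>

definition ker :: "complex \<times> nat \<Rightarrow> complex \<times> nat \<Rightarrow> real" where
  "ker k l = (\<Sum>p\<in>pairs. \<Sum>g\<in>G. poly Q (separating p (g k)) \<bullet> poly Q (separating p (g l)))"

lemma separating: "p \<in> pairs \<Longrightarrow> reach (separating p) \<and> poly Q (separating p (fst p)) \<noteq> poly Q (separating p (snd p))"
proof -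
  assume "p \<in> pairs"
  then have "fst p \<in> J" "snd p \<in> J" "fst p \<noteq> snd p" by (auto simp: pairs_def)
  then have "\<exists>m. reach m \<and> poly Q (m (fst p)) \<noteq> poly Q (m (snd p))" by (rule separated)
  then show ?thesis unfolding separating_def by (rule someI_ex)
qed

lemma finite_pairs: "finite pairs"
  using finite_J by (simp add: pairs_def)

lemma ker_sym: "ker k l = ker l k"
  unfolding ker_def by (simp add: inner_commute)

lemma ker_invariant:
  assumes h: "h \<in> G"
  shows "ker (h k) (h l) = ker k l"
proof -
  have bij: "bij_betw (\<lambda>g. g \<circ> h) G G"
  proof (rule bij_betwI[where g = "\<lambda>g. g \<circ> inv h"])
    have "h \<circ> inv h = id" "inv h \<circ> h = id"
      using permutes_inv_o[OF G_permutes[OF h]] by auto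
    then show "g \<circ> h \<circ> inv h = g" "g \<circ> inv h \<circ> h = g" for g :: "complex \<times> nat \<Rightarrow> complex \<times> nat"
      by (simp_all add: comp_assoc)
  qed (use G_comp h G_inv in auto)
  show ?thesis
    unfolding ker_def
  proof (rule sum.cong[OF refl])
    fix p
    show "(\<Sum>g\<in>G. poly Q (separating p (g (h k))) \<bullet> poly Q (separating p (g (h l)))) =
        (\<Sum>g\<in>G. poly Q (separating p (g k)) \<bullet> poly Q (separating p (g l)))"
      using sum.reindex_bij_betw[OF bij, of "\<lambda>g. poly Q (separating p (g k)) \<bullet> poly Q (separating p (g l))"]
      by simp
  qed
qed

text \<open>For fixed \<open>p\<close> and \<open>g\<close> the marking
  \<open>separating p \<circ> g\<close> is reached, so the sum over \<open>l\<close> vanishes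
  already inside the inner product.\<close>

lemma ker_v: "(\<Sum>l\<in>J. v l * ker k l) = 0"
proof -
  have "(\<Sum>l\<in>J. v l * ker k l) =
      (\<Sum>p\<in>pairs. \<Sum>g\<in>G. \<Sum>l\<in>J. v l * (poly Q (separating p (g k)) \<bullet> poly Q (separating p (g l))))"
    unfolding ker_def sum_distrib_left
    by (subst sum.swap, rule sum.cong[OF refl], subst sum.swap) simp
  also have "\<dots> = (\<Sum>p\<in>pairs. \<Sum>g\<in>G. poly Q (separating p (g k)) \<bullet> (\<Sum>l\<in>J. v l *\<^sub>R poly Q (separating p (g l))))"
    by (simp add: inner_sum_right)
  also have "\<dots> = 0"
  proof (intro sum.neutral ballI)
    fix p g assume p: "p \<in> pairs" and g: "g \<in> G"
    have "reach (separating p \<circ> g)" using separating[OF p] reach_comp[OF g] by blast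
    from weighted_sum[OF this]
    show "poly Q (separating p (g k)) \<bullet> (\<Sum>l\<in>J. v l *\<^sub>R poly Q (separating p (g l))) = 0"
      by simp
  qed
  finally show ?thesis .
qed

text \<open>If the columns agree, the quadratic form vanishes on the difference of the two unit
  vectors. It is a sum of squares, and the term for the pair itself and the identity of
  \<open>G\<close> is positive.\<close>

lemma ker_separates:
  assumes "i \<in> J" "j \<in> J" "\<And>k. k \<in> J \<Longrightarrow> ker k i = ker k j"
  shows "i = j"
proof (rule ccontr)
  assume "i \<noteq> j"
  then have p: "(i, j) \<in> pairs" using assms by (simp add: pairs_def)
  define N where "N = (\<lambda>p g. (norm (poly Q (separating p (g i)) - poly Q (separating p (g j))))\<^sup>2)"
  have "ker i i - ker i j - (ker j i - ker j j) = (\<Sum>p\<in>pairs. \<Sum>g\<in>G. N p g)"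
    unfolding ker_def sum_subtractf[symmetric] N_def
    by (intro sum.cong refl) (simp add: power2_norm_eq_inner inner_diff_left inner_diff_right)
  then have "(\<Sum>p\<in>pairs. \<Sum>g\<in>G. N p g) = 0" using assms by simp
  then have "(\<Sum>g\<in>G. N (i, j) g) = 0"
    using p finite_pairs by (subst (asm) sum_nonneg_eq_0_iff) (auto simp: N_def intro: sum_nonneg)
  then have "N (i, j) id = 0"
    using G_id finite_G by (subst (asm) sum_nonneg_eq_0_iff) (auto simp: N_def)
  then show False using separating[OF p] by (simp add: N_def)
qed

lemma ker_diag: "i \<in> J \<Longrightarrow> j \<in> J \<Longrightarrow> ker i i = ker j j"
  using G_transitive[of i j] ker_invariant by metis

text \<open>The kernel applied to the branches themselves is a polynomial of degree at most one in
  the branch. As it is orthogonal to \<open>v\<close>, it takes the same value at \<open>a\<close> and \<open>b\<close>.\<close>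

lemma ker_branches:
  obtains \<beta> where "\<And>m i. reach m \<Longrightarrow> i \<in> J \<Longrightarrow> (\<Sum>j\<in>J. ker i j *\<^sub>R m j) = \<beta>"
proof -
  define F where "F = (\<lambda>m i. \<Sum>j\<in>J. ker i j *\<^sub>R (m j :: complex))"
  obtain B where B: "B \<ge> 0" "\<And>z w. poly P z = poly P w \<Longrightarrow> norm w \<le> B * (1 + norm z)"
    using poly_fibre_growth[OF degW] by blast
  define M where "M = (\<Sum>i\<in>J. \<Sum>j\<in>J. \<bar>ker i j\<bar> * B)"
  have "\<exists>p. degree p \<le> 1 \<and> (\<forall>m i. reach m \<longrightarrow> i \<in> J \<longrightarrow> F m i = poly p (m i))"
  proof (rule equivariant_is_poly[of F M 1])
    show "F (m \<circ> g) i = F m (g i)" if g: "g \<in> G" for g m i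
    proof -
      have "F m (g i) = (\<Sum>j\<in>J. ker (g i) (g j) *\<^sub>R m (g j))"
        unfolding F_def
        using sum.reindex_bij_betw[OF permutes_imp_bij[OF G_permutes[OF g]], of "\<lambda>j. ker (g i) j *\<^sub>R m j"]
        by simp
      then show ?thesis by (simp add: F_def ker_invariant[OF g])
    qed
    show "F m i = F m' i" if "\<And>i. i \<in> J \<Longrightarrow> m i = m' i" for m m' i
      unfolding F_def by (rule sum.cong) (use that in auto)
    show "(\<lambda>s. F (\<lambda>i. \<phi> i s) i) holomorphic_on ball c r" if "family \<phi> c r" for \<phi> c r i
      unfolding F_def scaleR_conv_of_real using that by (intro holomorphic_intros) (auto simp: family_def)
    show "norm (F m i) \<le> M * (1 + norm (m i)) ^ 1" if m: "reach m" "i \<in> J" for m i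
    proof -
      have "norm (F m i) \<le> (\<Sum>j\<in>J. \<bar>ker i j\<bar> * norm (m j))"
        unfolding F_def by (rule order_trans[OF norm_sum]) simp
      also have "\<dots> \<le> (\<Sum>j\<in>J. \<bar>ker i j\<bar> * (B * (1 + norm (m i))))"
        using reach_value[OF m] by (intro sum_mono mult_left_mono B(2)) auto
      also have "\<dots> = (\<Sum>j\<in>J. \<bar>ker i j\<bar> * B) * (1 + norm (m i))"
        by (simp add: sum_distrib_right mult.assoc)
      also have "(\<Sum>j\<in>J. \<bar>ker i j\<bar> * B) \<le> M"
        unfolding M_def using m(2) finite_J B(1)
        by (intro member_le_sum[of i J "\<lambda>i. \<Sum>j\<in>J. \<bar>ker i j\<bar> * B"]) (auto intro!: sum_nonneg)
      then have "(\<Sum>j\<in>J. \<bar>ker i j\<bar> * B) * (1 + norm (m i)) \<le> M * (1 + norm (m i))"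
        by (intro mult_right_mono) auto
      finally show ?thesis by simp
    qed
  qed auto
  then obtain p where p: "degree p \<le> 1" "\<And>m i. reach m \<Longrightarrow> i \<in> J \<Longrightarrow> F m i = poly p (m i)" by blast
  obtain \<alpha> \<beta> where \<alpha>\<beta>: "p = [:\<beta>, \<alpha>:]"
  proof -
    obtain \<beta> q where "p = pCons \<beta> q" by (cases p)
    moreover from this p(1) have "degree q = 0" by (cases "q = 0") auto
    then obtain \<alpha> where "q = [:\<alpha>:]" using degree_0_id by metis
    ultimately show thesis using that by blast
  qed
  \<comment> \<open>By symmetry the kernel can be moved from the branches to \<open>v\<close>, which
    it annihilates. Letting the branches tend to the fibre leaves \<alpha> (b - a) = 0.\<close>
  have rel: "(\<Sum>i\<in>J. v i *\<^sub>R (\<beta> + \<alpha> * m i)) = 0" if m: "reach m" for m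
  proof -
    have "(\<Sum>i\<in>J. v i *\<^sub>R (\<beta> + \<alpha> * m i)) = (\<Sum>i\<in>J. v i *\<^sub>R F m i)"
      by (rule sum.cong) (use p(2)[OF m] \<alpha>\<beta> in \<open>auto simp: mult.commute\<close>)
    also have "\<dots> = (\<Sum>j\<in>J. (\<Sum>i\<in>J. v i * ker j i) *\<^sub>R m j)"
      unfolding F_def scaleR_sum_right scaleR_sum_left
      by (subst sum.swap) (simp add: ker_sym)
    also have "\<dots> = 0" by (simp add: ker_v)
    finally show ?thesis .
  qed
  have "(\<lambda>n. \<Sum>i\<in>J. v i *\<^sub>R (\<beta> + \<alpha> * branch i (of_real (- real n)))) \<longlonglongrightarrow> (\<Sum>i\<in>J. v i *\<^sub>R (\<beta> + \<alpha> * fst i))"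
    by (intro tendsto_intros branch_tendsto)
  moreover have "\<forall>\<^sub>F n in sequentially. (\<Sum>i\<in>J. v i *\<^sub>R (\<beta> + \<alpha> * branch i (of_real (- real n)))) = 0"
    using in_H_eventually by eventually_elim (rule rel[OF reach_branch])
  then have "(\<lambda>n. \<Sum>i\<in>J. v i *\<^sub>R (\<beta> + \<alpha> * branch i (of_real (- real n)))) \<longlonglongrightarrow> 0"
    by (rule tendsto_eventually)
  ultimately have "(\<Sum>i\<in>J. v i *\<^sub>R (\<beta> + \<alpha> * fst i)) = 0" by (rule LIMSEQ_unique)
  then have "(\<beta> + \<alpha> * b) - (\<beta> + \<alpha> * a) = 0"
    using mult_pos[OF Pa] mult_pos[OF Pb] unfolding sum_v by (simp add: scaleR_conv_of_real)
  then have "\<alpha> = 0" using ab by (simp add: algebra_simps)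
  then have "(\<Sum>j\<in>J. ker i j *\<^sub>R m j) = \<beta>" if "reach m" "i \<in> J" for m i
    using p(2)[OF that] \<alpha>\<beta> by (simp add: F_def)
  then show ?thesis by (rule that)
qed

text \<open>Rows \<open>i\<close> and \<open>j\<close> applied to the branches give the same
  constant, and their difference is supported on \<open>i\<close> and \<open>j\<close>. With equal
  diagonal entries it reads (ker i i - ker i j) (m i - m j) = 0, so the two rows coincide.\<close>

lemma no_homogeneous_pair:
  assumes ij: "i \<in> J" "j \<in> J" "i \<noteq> j"
  shows "\<not> homogeneous ker J {i, j}"
proof
  assume hom: "homogeneous ker J {i, j}"
  have out: "ker i k = ker j k" if "k \<in> J" "k \<noteq> i" "k \<noteq> j" for k
  proof -
    have "k \<in> J - {i, j}" using that by blast
    then have "ker k i = ker k j" using hom unfolding homogeneous_def by blast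
    then show ?thesis by (simp add: ker_sym[of i] ker_sym[of j])
  qed
  obtain \<beta> where \<beta>: "\<And>m i. reach m \<Longrightarrow> i \<in> J \<Longrightarrow> (\<Sum>j\<in>J. ker i j *\<^sub>R m j) = \<beta>" using ker_branches by blast
  define m where "m = (\<lambda>x. branch x u0)"
  have m: "reach m" by (simp add: m_def)
  have mne: "m i \<noteq> m j" using branch_inj[OF u0] ij by (auto simp: m_def inj_on_def)
  have "(\<Sum>k\<in>J. (ker i k - ker j k) *\<^sub>R m k) = 0"
    using \<beta>[OF m ij(1)] \<beta>[OF m ij(2)] by (simp add: scaleR_left_diff_distrib sum_subtractf)
  moreover have "(\<Sum>k\<in>J. (ker i k - ker j k) *\<^sub>R m k) = (\<Sum>k\<in>{i, j}. (ker i k - ker j k) *\<^sub>R m k)"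
    by (rule sum.mono_neutral_right) (use finite_J ij out in auto)
  ultimately have "(ker i i - ker j i) *\<^sub>R m i + (ker i j - ker j j) *\<^sub>R m j = 0" using ij(3) by simp
  then have "(ker i i - ker i j) *\<^sub>R (m i - m j) = 0"
    using ker_diag[OF ij(1,2)] by (simp add: ker_sym[of j i] algebra_simps)
  then have eq: "ker i i = ker i j" using mne by simp
  have "i = j"
  proof (rule ker_separates[OF ij(1,2)])
    fix k assume "k \<in> J"
    then show "ker k i = ker k j"
      using out[of k] eq ker_diag[OF ij(1,2)] ker_sym[of k i] ker_sym[of k j] by (metis ker_sym)
  qed
  then show False using ij(3) by simp
qed

definition C :: "(complex \<times> nat) set" where
  "C = {x \<in> J. fst x = a \<or> fst x = b}"

text \<open>A label \<open>k\<close> outside \<open>C\<close> is fixed by \<open>\<sigma>\<close>,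
  so its kernel values are constant on the cycle at \<open>a\<close> and on the cycle at
  \<open>b\<close>. Orthogonality to \<open>v\<close> equates the two constants.\<close>

lemma homogeneous_C: "homogeneous ker J C"
  unfolding homogeneous_def
proof (intro conjI ballI)
  show "C \<subseteq> J" by (auto simp: C_def)
  fix k x y assume k: "k \<in> J - C" and x: "x \<in> C" and y: "y \<in> C"
  have kJ: "poly P (fst k) = c\<^sub>1" "snd k < mult (fst k)" "fst k \<noteq> a" "fst k \<noteq> b"
    using k by (auto simp: C_def in_J)
  have m1: "mult (fst k) = 1" by (rule mult_eq_1[OF kJ(1,3,4)])
  then have "\<sigma> k = k" using k kJ(2) by (simp add: \<sigma>_def prod_eq_iff)
  then have shift: "ker k (\<sigma> x) = ker k x" for x using ker_invariant[OF \<sigma>_in_G, of k x] by simp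
  have const: "ker k (s, j) = ker k (s, 0)" if s: "poly P s = c\<^sub>1" and "j < mult s" for s j
    using that(2)
  proof (induction j)
    case (Suc j)
    then have "\<sigma> (s, j) = (s, Suc j)" using s by (simp add: \<sigma>_def in_J)
    then show ?case using shift[of "(s, j)"] Suc by simp
  qed simp
  have "(\<Sum>l\<in>J. v l *\<^sub>R ker k l) = 0" using ker_v[of k] by simp
  moreover have "(\<Sum>j<mult b. ker k (b, j)) = (\<Sum>j<mult b. ker k (b, 0))"
    by (rule sum.cong[OF refl], rule const[OF Pb], simp)
  moreover have "(\<Sum>j<mult a. ker k (a, j)) = (\<Sum>j<mult a. ker k (a, 0))"
    by (rule sum.cong[OF refl], rule const[OF Pa], simp)
  ultimately have "ker k (b, 0) - ker k (a, 0) = 0"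
    using mult_pos[OF Pa] mult_pos[OF Pb] unfolding sum_v by simp
  moreover have "ker k x = ker k (fst x, 0)" "ker k y = ker k (fst y, 0)"
    using const[of "fst x" "snd x"] const[of "fst y" "snd y"] x y by (auto simp: C_def in_J)
  ultimately show "ker k x = ker k y" using x y by (auto simp: C_def)
qed

lemma card_C: "card C \<ge> 2"
proof -
  have "{(a, 0), (b, 0)} \<subseteq> C" using mult_pos Pa Pb by (auto simp: C_def in_J)
  moreover have "finite C" using finite_J by (simp add: C_def)
  ultimately have "card {(a, 0::nat), (b, 0)} \<le> card C" by (intro card_mono)
  then show ?thesis using ab by simp
qed

end

section \<open>Exclusion of the separated case\<close>

lemma pcompose_power: "pcompose (p ^ n) q = pcompose p q ^ n"
  for p q :: "complex poly"
  by (induction n) (auto simp: pcompose_mult pcompose_1)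

text \<open>The derivative is l (p + q) (z - a)^(p-1) (z - b)^(q-1) (z - \<xi>), where \<xi> = (p b
  + q a) / (p + q). Both \<open>a\<close> and \<open>b\<close> lie over \<open>d\<close>, and \<xi>
  does not, so the fibre of \<xi> has no further critical point.\<close>

lemma two_point_polynomial:
  fixes W :: "complex poly"
  assumes W: "W = [:d:] + smult l ([:-a, 1:] ^ p * [:-b, 1:] ^ q)"
    and "l \<noteq> 0" "a \<noteq> b" "p > 0" "q > 0"
  obtains \<xi> where "order \<xi> (W - [:poly W \<xi>:]) = 2"
    "\<And>s. poly W s = poly W \<xi> \<Longrightarrow> s \<noteq> \<xi> \<Longrightarrow> order s (W - [:poly W \<xi>:]) = 1"
proof -
  obtain p' q' where pq: "p = Suc p'" "q = Suc q'" using assms(4,5) gr0_implies_Suc by blast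
  define n :: complex where "n = of_nat p + of_nat q"
  have n: "n \<noteq> 0"
    unfolding n_def of_nat_add[symmetric] of_nat_eq_0_iff using assms(4) by simp
  define \<xi> where "\<xi> = (of_nat p * b + of_nat q * a) / n"
  have "\<xi> - a = of_nat p * (b - a) / n" "\<xi> - b = of_nat q * (a - b) / n"
    using n by (simp_all add: \<xi>_def field_simps) (simp_all add: n_def algebra_simps)
  then have ne: "\<xi> \<noteq> a" "\<xi> \<noteq> b" using n assms(3-5) by auto
  define r where "r = smult (l * n) ([:-a, 1:] ^ p' * [:-b, 1:] ^ q')"
  have n\<xi>: "n * \<xi> = of_nat p * b + of_nat q * a" using n by (simp add: \<xi>_def)
  have "smult n [:-\<xi>, 1:] = [:- (n * \<xi>), n:]" by simp
  then have D: "smult (of_nat p) [:-b, 1:] + smult (of_nat q) [:-a, 1:] = smult n [:-\<xi>, 1:]"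
    unfolding n\<xi> by (simp add: n_def)
  have "pderiv W = smult l ([:-a, 1:] ^ p * pderiv ([:-b, 1:] ^ q) + [:-b, 1:] ^ q * pderiv ([:-a, 1:] ^ p))"
    unfolding W by (simp add: pderiv_add pderiv_smult pderiv_mult pderiv_pCons)
  also have "\<dots> = smult l ([:-a, 1:] ^ p' * [:-b, 1:] ^ q' * (smult (of_nat p) [:-b, 1:] + smult (of_nat q) [:-a, 1:]))"
    unfolding pq pderiv_power_Suc
    by (rule poly_ext) (simp add: pderiv_pCons algebra_simps del: of_nat_Suc)
  also have "\<dots> = r * [:-\<xi>, 1:]" unfolding D r_def by (rule poly_ext) (simp add: algebra_simps)
  finally have dW: "pderiv W = r * [:-\<xi>, 1:]" .
  have r0: "poly r z \<noteq> 0" if "z \<noteq> a" "z \<noteq> b" for z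
    using that assms(2) n by (simp add: r_def)
  let ?V = "W - [:poly W \<xi>:]"
  have dV: "pderiv ?V = r * [:-\<xi>, 1:]" by (simp add: pderiv_diff pderiv_pCons dW)
  have "r \<noteq> 0" using r0[OF ne] by auto
  moreover have "[:-\<xi>, 1:] \<noteq> 0" by simp
  ultimately have r\<xi>0: "r * [:-\<xi>, 1:] \<noteq> 0" by (rule no_zero_divisors)
  then have V0: "?V \<noteq> 0" using dV by (metis pderiv_0)
  have ordV: "order s ?V = Suc (order s (r * [:-\<xi>, 1:]))" if "poly W s = poly W \<xi>" for s
    unfolding dV[symmetric] by (rule order_pderiv[OF V0]) (simp add: that)
  show ?thesis
  proof (rule that[of \<xi>])
    have "order \<xi> (r * [:-\<xi>, 1:]) = order \<xi> r + order \<xi> [:-\<xi>, 1:]" by (rule order_mult[OF r\<xi>0])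
    also have "\<dots> = 1" using order_0I[OF r0[OF ne]] order_power_n_n[of \<xi> 1] by simp
    finally show "order \<xi> ?V = 2" unfolding ordV[OF refl] by simp
    fix s assume s: "poly W s = poly W \<xi>" "s \<noteq> \<xi>"
    have "poly W \<xi> - d \<noteq> 0" unfolding W using ne assms(2) by simp
    moreover have "poly W a - d = 0" "poly W b - d = 0" unfolding W using assms(4,5) by simp_all
    ultimately have "s \<noteq> a" "s \<noteq> b" using s(1) by auto
    then have "poly (r * [:-\<xi>, 1:]) s \<noteq> 0" using r0 s(2) by simp
    from order_0I[OF this] show "order s ?V = 1" unfolding ordV[OF s(1)] by simp
  qed
qed

context separated_fibre
begin

text \<open>A loop around the value of a simple critical point of \<open>W\<close> interchanges two members of one
  block and fixes the others, so the kernel does not distinguish the two.\<close>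

lemma no_simple_critical_point:
  assumes bf: "block_factor W R"
    and hom: "\<And>i. i \<in> J \<Longrightarrow> homogeneous ker J {j\<in>J. R i j}"
    and P': "P = pcompose P' W"
    and ord\<xi>: "order \<xi> (W - [:poly W \<xi>:]) = 2"
    and ords: "\<And>s. poly W s = poly W \<xi> \<Longrightarrow> s \<noteq> \<xi> \<Longrightarrow> order s (W - [:poly W \<xi>:]) = 1"
  shows False
proof -
  note degW = block_factorD(1)[OF bf]
  define w where "w = poly W \<xi>"
  obtain \<rho>' \<kappa>' where "fibre_chart W w \<rho>' \<kappa>'" by (rule fibre_chart_exists[OF degW])
  then interpret Y: fibre_chart W w \<rho>' \<kappa>' .
  \<comment> \<open>The loop is kept so close to \<open>w\<close> that it meets no image of an
    irregular point; \<open>w\<close> itself may be such an image.\<close>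
  define N where "N = poly W ` {z. \<not> regular (poly P z)}"
  have "finite N" using finite_irregular by (simp add: N_def)
  then obtain \<delta> where \<delta>: "\<delta> > 0" "\<And>y. y \<in> N \<Longrightarrow> y \<noteq> w \<Longrightarrow> \<delta> \<le> dist w y"
    using finite_set_avoid[of N w] by auto
  define S where "S = Y.H \<inter> {u. Re u < ln \<delta>}"
  have "connected S" unfolding S_def
    by (intro convex_connected convex_Int Y.convex_H convex_halfspace_Re_lt)
  have reg: "regular (poly P z)" if "u \<in> S" "poly W z = w + exp u" for u z
  proof (rule ccontr)
    assume "\<not> regular (poly P z)"
    then have "w + exp u \<in> N" using that(2) by (auto simp: N_def intro!: image_eqI[of _ _ z])
    then have "\<delta> \<le> dist w (w + exp u)" using \<delta>(2) by simp
    also have "\<dots> = exp (Re u)" by (simp add: dist_norm)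
    also have "\<dots> < \<delta>" using that(1) \<delta>(1) by (metis (mono_tags, lifting) Int_iff S_def exp_less_mono exp_ln mem_Collect_eq)
    finally show False by simp
  qed
  obtain u1 where u1: "u1 \<in> Y.H" "Re u1 < ln \<delta>" using Y.H_nonempty by blast
  have u1S: "u1 \<in> S" using u1 by (simp add: S_def)
  define u2 where "u2 = u1 + 2 * of_real pi * \<i>"
  have u2S: "u2 \<in> S" using u1 by (simp add: S_def u2_def Y.H_def)
  have W\<xi>: "poly W \<xi> = w" and mult\<xi>: "Y.mult \<xi> = 2"
    and mults: "\<And>s. poly W s = w \<Longrightarrow> s \<noteq> \<xi> \<Longrightarrow> Y.mult s = 1"
    using ord\<xi> ords by (simp_all add: w_def)
  have \<xi>J: "(\<xi>, 0) \<in> Y.J" "(\<xi>, 1) \<in> Y.J" using W\<xi> mult\<xi> by (simp_all add: Y.in_J)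
  define z1 where "z1 = Y.branch (\<xi>, 0) u1"
  have Wz1: "poly W z1 = w + exp u1" unfolding z1_def by (rule Y.branch_value[OF \<xi>J(1) u1(1)])
  obtain i0 where i0: "i0 \<in> J" using I_nonempty by blast
  obtain m where m: "reach m" "marking m (poly P z1)" "m i0 = z1"
    using reach_through[OF reg[OF u1S Wz1] i0] by blast
  define cls where "cls = {j\<in>J. R i0 j}"
  have clsJ: "cls \<subseteq> J" and fin: "finite cls" using finite_J by (auto simp: cls_def)
  let ?F = "{z. poly W z = w + exp u1}"
  have finF: "finite ?F" by (rule finite_poly_fibre[OF degW])
  have cardF: "card ?F \<le> degree W" by (rule card_poly_fibre_le[OF degW])
  have injm: "inj_on m cls" and mF: "m ` cls = ?F"
    using block_fibre[OF bf m(1) i0] m(3) Wz1 by (simp_all add: cls_def)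
  have "(\<lambda>y. Y.branch y u1) ` Y.J \<subseteq> ?F" using Y.branch_value u1(1) by auto
  then have bF: "(\<lambda>y. Y.branch y u1) ` Y.J = ?F"
    using card_seteq[OF finF] cardF card_image[OF Y.branch_inj[OF u1(1)]] Y.card_J by simp
  define \<theta> where "\<theta> = (\<lambda>l. inv_into Y.J (\<lambda>y. Y.branch y u1) (m l))"
  have \<theta>: "\<theta> l \<in> Y.J" "Y.branch (\<theta> l) u1 = m l" if "l \<in> cls" for l
  proof -
    have "m l \<in> (\<lambda>y. Y.branch y u1) ` Y.J" using that mF bF by blast
    then show "\<theta> l \<in> Y.J" "Y.branch (\<theta> l) u1 = m l"
      unfolding \<theta>_def by (rule inv_into_into, rule f_inv_into_f)
  qed
  have \<theta>_surj: "\<exists>l\<in>cls. \<theta> l = y" if "y \<in> Y.J" for y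
  proof -
    have "Y.branch y u1 \<in> m ` cls" using that mF bF by blast
    then obtain l where l: "l \<in> cls" "m l = Y.branch y u1" by auto
    then have "\<theta> l = y"
      using inv_into_f_f[OF Y.branch_inj[OF u1(1)] that] by (simp add: \<theta>_def)
    with l(1) show ?thesis by blast
  qed
  \<comment> \<open>Only the members of one block are followed. The loop may permute the remaining
    branches in any way, but they will not enter, because differences of two kernel rows of the
    block vanish on them.\<close>
  obtain m' where m': "reach m'" "\<And>l. l \<in> cls \<Longrightarrow> m' l = Y.branch (\<theta> l) u2"
  proof (rule lift_connected[of S cls "\<lambda>u. poly P' (w + exp u)" "\<lambda>l u. Y.branch (\<theta> l) u" u1 u2 m])
    show "continuous_on S (\<lambda>u. poly P' (w + exp u))" by (intro continuous_intros)
    show "regular (poly P' (w + exp u))" if "u \<in> S" for u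
    proof -
      have val: "poly W (Y.branch (\<xi>, 0) u) = w + exp u"
        by (rule Y.branch_value[OF \<xi>J(1)]) (use that in \<open>simp add: S_def\<close>)
      from reg[OF that val] show ?thesis by (simp add: P' poly_pcompose val)
    qed
    show "continuous_on S (Y.branch (\<theta> l))" if "l \<in> cls" for l
      by (rule continuous_on_subset[OF holomorphic_on_imp_continuous_on[OF Y.branch_holomorphic[OF \<theta>(1)[OF that]]]])
         (simp add: S_def)
    show "poly P (Y.branch (\<theta> l) u) = poly P' (w + exp u)" if "l \<in> cls" "u \<in> S" for l u
      using Y.branch_value[OF \<theta>(1)[OF that(1)]] that(2) by (simp add: P' poly_pcompose S_def)
    show "marking m (poly P' (w + exp u1))" using m(2) Wz1 by (simp add: P' poly_pcompose)
    show "m l = Y.branch (\<theta> l) u1" if "l \<in> cls" for l using \<theta>(2)[OF that] by simp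
    fix m' assume "reach m'" "\<And>l. l \<in> cls \<Longrightarrow> m' l = Y.branch (\<theta> l) u2"
    then show thesis by (rule that)
  qed (use clsJ \<open>connected S\<close> u1S u2S m(1) in auto)
  have m'\<sigma>: "m' l = Y.branch (Y.\<sigma> (\<theta> l)) u1" if "l \<in> cls" for l
    using m'(2)[OF that] Y.branch_shift[OF \<theta>(1)[OF that]] by (simp add: u2_def)
  obtain l1 where l1: "l1 \<in> cls" "\<theta> l1 = (\<xi>, 0)" using \<theta>_surj[OF \<xi>J(1)] by blast
  obtain l2 where l2: "l2 \<in> cls" "\<theta> l2 = (\<xi>, 1)" using \<theta>_surj[OF \<xi>J(2)] by blast
  have l12: "l1 \<noteq> l2" using l1 l2 by auto
  have ml12: "m l1 \<noteq> m l2" using injm l1 l2 l12 by (auto dest: inj_onD)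
  have "Y.\<sigma> (\<xi>, 0) = (\<xi>, 1)" "Y.\<sigma> (\<xi>, 1) = (\<xi>, 0)"
    using \<xi>J mult\<xi> by (simp_all add: Y.\<sigma>_def)
  then have swap: "m' l1 = m l2" "m' l2 = m l1"
    using m'\<sigma>[OF l1(1)] m'\<sigma>[OF l2(1)] l1 l2 \<theta>(2)[OF l1(1)] \<theta>(2)[OF l2(1)] by simp_all
  have fixed: "m' l = m l" if l: "l \<in> cls" "l \<noteq> l1" "l \<noteq> l2" for l
  proof -
    define y where "y = \<theta> l"
    have y: "y \<in> Y.J" using \<theta>(1)[OF l(1)] by (simp add: y_def)
    have inj\<theta>: "l = l'" if "l' \<in> cls" "\<theta> l' = y" for l'
      using that l(1) \<theta>(2)[OF l(1)] \<theta>(2)[OF that(1)] injm by (auto simp: y_def dest: inj_onD)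
    have "fst y \<noteq> \<xi>"
    proof
      assume "fst y = \<xi>"
      then have "y = (\<xi>, snd y)" "snd y < 2" using y mult\<xi> by (auto simp: Y.in_J prod_eq_iff)
      moreover from this(2) have "snd y = 0 \<or> snd y = 1" by auto
      ultimately have "y = (\<xi>, 0) \<or> y = (\<xi>, 1)" by metis
      then show False using inj\<theta>[OF l1(1)] inj\<theta>[OF l2(1)] l1 l2 l by auto
    qed
    then have "Y.mult (fst y) = 1" using mults[of "fst y"] y by (simp add: Y.in_J)
    then have "Y.\<sigma> y = y" using y by (auto simp: Y.\<sigma>_def Y.in_J prod_eq_iff)
    then show ?thesis using m'\<sigma>[OF l(1)] \<theta>(2)[OF l(1)] by (simp add: y_def)
  qed
  obtain \<beta> where \<beta>: "\<And>m i. reach m \<Longrightarrow> i \<in> J \<Longrightarrow> (\<Sum>j\<in>J. ker i j *\<^sub>R m j) = \<beta>" using ker_branches by blast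
  have homc: "ker i k = ker j k" if "i \<in> cls" "j \<in> cls" "k \<in> J" "k \<notin> cls" for i j k
  proof -
    have "ker k i = ker k j" using hom[OF i0] that unfolding homogeneous_def cls_def by blast
    then show ?thesis by (simp only: ker_sym[of _ k])
  qed
  \<comment> \<open>The relation for the difference of two rows holds before and after the loop; on
    subtraction only the two interchanged branches survive.\<close>
  have diff: "ker i l1 - ker j l1 = ker i l2 - ker j l2" if i: "i \<in> cls" and j: "j \<in> cls" for i j
  proof -
    define x where "x = (\<lambda>l. ker i l - ker j l)"
    have x0: "(\<Sum>l\<in>cls. x l *\<^sub>R n l) = 0" if n: "reach n" for n
    proof -
      have "(\<Sum>l\<in>J. x l *\<^sub>R n l) = 0"
        using \<beta>[OF n subsetD[OF clsJ i]] \<beta>[OF n subsetD[OF clsJ j]]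
        by (simp add: x_def scaleR_left_diff_distrib sum_subtractf)
      moreover have "(\<Sum>l\<in>J. x l *\<^sub>R n l) = (\<Sum>l\<in>cls. x l *\<^sub>R n l)"
        by (rule sum.mono_neutral_right) (use finite_J clsJ homc[OF i j] in \<open>auto simp: x_def\<close>)
      ultimately show ?thesis by simp
    qed
    have "0 = (\<Sum>l\<in>cls. x l *\<^sub>R (m l - m' l))"
      using x0[OF m(1)] x0[OF m'(1)] by (simp add: scaleR_right_diff_distrib sum_subtractf)
    also have "\<dots> = (\<Sum>l\<in>{l1, l2}. x l *\<^sub>R (m l - m' l))"
      by (rule sum.mono_neutral_right) (use fin l1 l2 fixed in auto)
    also have "\<dots> = (x l1 - x l2) *\<^sub>R (m l1 - m l2)"
      using l12 swap by (simp add: algebra_simps)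
    finally have "x l1 = x l2" using ml12 by simp
    then show ?thesis by (simp add: x_def)
  qed
  have l12J: "l1 \<in> J" "l2 \<in> J" using l1 l2 clsJ by auto
  \<comment> \<open>The case of rows \<open>l1\<close> and \<open>l2\<close>, combined with symmetry
    and equal diagonal entries.\<close>
  have e: "ker l1 l1 = ker l1 l2"
    using diff[OF l1(1) l2(1)] ker_diag[OF l12J] ker_sym[of l1 l2] by simp
  have "l1 = l2"
  proof (rule ker_separates[OF l12J])
    fix k assume k: "k \<in> J"
    show "ker k l1 = ker k l2"
    proof (cases "k \<in> cls")
      case True
      then show ?thesis using diff[OF True l1(1)] e by simp
    next
      case False
      then have "ker l1 k = ker l2 k" by (rule homc[OF l1(1) l2(1) k])
      then show ?thesis by (simp only: ker_sym[of k])
    qed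
  qed
  then show False using l12 by simp
qed

lemma separated_fibre_inconsistent: False
proof -
  obtain K where K: "K \<subseteq> C" "homogeneous ker J K" "card K \<ge> 3"
    "\<And>g. g \<in> G \<Longrightarrow> g ` K \<inter> K \<noteq> {} \<Longrightarrow> g ` K = K"
    "\<And>g. g \<in> G \<Longrightarrow> g ` K \<inter> C \<noteq> {} \<Longrightarrow> g ` K \<subseteq> C"
  proof (rule minimal_homogeneous_block[of J ker G C])
    show "\<And>g i j. g \<in> G \<Longrightarrow> i \<in> J \<Longrightarrow> j \<in> J \<Longrightarrow> ker (g i) (g j) = ker i j" by (rule ker_invariant)
    fix K assume "K \<subseteq> C" "homogeneous ker J K" "card K \<ge> 3"
      "\<And>g. g \<in> G \<Longrightarrow> g ` K \<inter> K \<noteq> {} \<Longrightarrow> g ` K = K"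
      "\<And>g. g \<in> G \<Longrightarrow> g ` K \<inter> C \<noteq> {} \<Longrightarrow> g ` K \<subseteq> C"
    then show thesis by (rule that)
  qed (use finite_J ker_sym G_permutes G_inv homogeneous_C card_C no_homogeneous_pair in blast)+
  \<comment> \<open>The classes are the translates of \<open>K\<close>: translates that meet
    coincide, and by transitivity they cover \<open>J\<close>.\<close>
  define R where "R = (\<lambda>i j. \<exists>g\<in>G. i \<in> g ` K \<and> j \<in> g ` K)"
  have KJ: "K \<subseteq> J" using K(1) by (auto simp: C_def)
  have "K \<noteq> {}" using K(3) by auto
  then obtain k0 where k0: "k0 \<in> K" by blast
  have meet: "g ` K = h ` K" if g: "g \<in> G" and h: "h \<in> G" and x: "x \<in> g ` K" "x \<in> h ` K" for g h x
  proof -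
    have ih: "inv h \<circ> g \<in> G" using G_comp[OF G_inv[OF h] g] .
    have b: "bij h" using G_permutes[OF h] permutes_bij by blast
    have "inv h x \<in> (inv h \<circ> g) ` K" using x(1) by (auto simp: image_comp[symmetric])
    moreover have "inv h x \<in> K" using x(2) b by (auto simp: bij_is_inj)
    ultimately have "(inv h \<circ> g) ` K = K" using K(4)[OF ih] by blast
    then have "h ` ((inv h \<circ> g) ` K) = h ` K" by simp
    moreover have "h \<circ> (inv h \<circ> g) = g" using b by (simp add: fun_eq_iff bij_is_surj surj_f_inv_f)
    ultimately show ?thesis by (metis image_comp)
  qed
  have cover: "\<exists>g\<in>G. i \<in> g ` K" if i: "i \<in> J" for i
    using G_transitive[of k0 i] k0 KJ i by (metis image_eqI subsetD)
  have gJ: "g ` K \<subseteq> J" if "g \<in> G" for g using KJ G_in[OF that] by auto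
  have cls: "{j\<in>J. R i j} = g ` K" if g: "g \<in> G" and i: "i \<in> g ` K" for g i
  proof
    show "{j\<in>J. R i j} \<subseteq> g ` K" unfolding R_def using meet[OF g _ i] by blast
    show "g ` K \<subseteq> {j\<in>J. R i j}" unfolding R_def using gJ[OF g] g i by blast
  qed
  have Rinv: "R (h i) (h j)" if h: "h \<in> G" and r: "R i j" for h i j
  proof -
    obtain g where "g \<in> G" "i \<in> g ` K" "j \<in> g ` K" using r unfolding R_def by blast
    then have "h \<circ> g \<in> G" "h i \<in> (h \<circ> g) ` K" "h j \<in> (h \<circ> g) ` K" using G_comp[OF h] by auto
    then show ?thesis unfolding R_def by blast
  qed
  have Rtrans: "R i k" if r: "R i j" "R j k" for i j k
  proof -
    obtain g where g: "g \<in> G" "i \<in> g ` K" "j \<in> g ` K" using r(1) unfolding R_def by blast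
    obtain h where h: "h \<in> G" "j \<in> h ` K" "k \<in> h ` K" using r(2) unfolding R_def by blast
    have "g ` K = h ` K" by (rule meet[OF g(1) h(1) g(3) h(2)])
    then show ?thesis unfolding R_def using g h by blast
  qed
  have Rsym: "R j i" if "R i j" for i j using that unfolding R_def by blast
  have Rrefl: "R i i" if "i \<in> J" for i using cover[OF that] unfolding R_def by blast
  have GR: "G_equivalence R"
    unfolding G_equivalence_def using Rinv Rtrans Rsym Rrefl by blast
  obtain W where bf: "block_factor W R" by (rule block_polynomial[OF GR])
  note W = block_factorD[OF bf]
  have homK: "homogeneous ker J {j\<in>J. R i j}" if i: "i \<in> J" for i
  proof -
    obtain g where g: "g \<in> G" "i \<in> g ` K" using cover[OF i] by blast
    show ?thesis
      unfolding cls[OF g] by (rule homogeneous_image[OF G_permutes[OF g(1)] ker_invariant[OF g(1)] K(2)])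
  qed
  have inC: "{j\<in>J. R i j} \<subseteq> C" if i: "i \<in> C" for i
  proof -
    have "i \<in> J" using i by (simp add: C_def)
    then obtain g where g: "g \<in> G" "i \<in> g ` K" using cover by blast
    then show ?thesis using K(5)[OF g(1)] cls[OF g] i by blast
  qed
  have "degree W = card K"
  proof -
    have "{j\<in>J. R k0 j} = id ` K" by (rule cls[OF G_id]) (simp add: k0)
    then show ?thesis using W(2)[of k0] k0 KJ by auto
  qed
  then have deg3: "degree W \<ge> 3" using K(3) by simp
  have lcW: "lead_coeff W \<noteq> 0" using W(1) by auto
  \<comment> \<open>A class that meets \<open>C\<close> stays in \<open>C\<close>, so each of its
    branches tends to \<open>a\<close> or to \<open>b\<close>, and the product has only two kinds of
    factors.\<close>
  have Wvalue: "poly W z = poly W (fst i) + lead_coeff W * ((z - a) ^ card {x\<in>J. R i x \<and> fst x = a} *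
      (z - b) ^ card {x\<in>J. R i x \<and> fst x = b})" if i: "i \<in> C" for i z
  proof -
    have iJ: "i \<in> J" using i by (simp add: C_def)
    have const: "(\<Prod>x\<in>{x\<in>J. R i x \<and> fst x = c}. z - fst x) = (z - c) ^ card {x\<in>J. R i x \<and> fst x = c}" for c
    proof -
      have "(\<Prod>x\<in>{x\<in>J. R i x \<and> fst x = c}. z - fst x) = (\<Prod>x\<in>{x\<in>J. R i x \<and> fst x = c}. z - c)"
        by (rule prod.cong) auto
      then show ?thesis by simp
    qed
    have "(\<Prod>x\<in>{j\<in>J. R i j}. z - fst x) = (\<Prod>x\<in>{x\<in>J. R i x \<and> fst x = a} \<union> {x\<in>J. R i x \<and> fst x = b}. z - fst x)"
      using inC[OF i] by (intro prod.cong) (auto simp: C_def)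
    also have "\<dots> = (\<Prod>x\<in>{x\<in>J. R i x \<and> fst x = a}. z - fst x) * (\<Prod>x\<in>{x\<in>J. R i x \<and> fst x = b}. z - fst x)"
      using finite_J ab by (intro prod.union_disjoint) auto
    also have "\<dots> = (z - a) ^ card {x\<in>J. R i x \<and> fst x = a} * (z - b) ^ card {x\<in>J. R i x \<and> fst x = b}"
      by (simp only: const)
    finally show ?thesis using block_polynomial_at_fibre[OF bf iJ, of z] by simp
  qed
  have split: "card {x\<in>J. R i x \<and> fst x = a} + card {x\<in>J. R i x \<and> fst x = b} = degree W" if i: "i \<in> C" for i
  proof -
    have "{j\<in>J. R i j} = {x\<in>J. R i x \<and> fst x = a} \<union> {x\<in>J. R i x \<and> fst x = b}"
      using inC[OF i] by (auto simp: C_def)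
    then have "card {j\<in>J. R i j} = card {x\<in>J. R i x \<and> fst x = a} + card {x\<in>J. R i x \<and> fst x = b}"
      using finite_J ab by (simp add: card_Un_disjoint disjoint_iff)
    then show ?thesis using W(2)[of i] i by (simp add: C_def)
  qed
  have a0: "(a, 0) \<in> J" "(a, 0) \<in> C" and b0: "(b, 0) \<in> J" "(b, 0) \<in> C"
    using mult_pos Pa Pb by (auto simp: in_J C_def)
  define p where "p = card {x\<in>J. R (a, 0) x \<and> fst x = a}"
  define q where "q = card {x\<in>J. R (a, 0) x \<and> fst x = b}"
  have pos: "p > 0" unfolding p_def using finite_J a0 Rrefl by (auto simp: card_gt_0_iff)
  have Wa: "W = [:poly W a:] + smult (lead_coeff W) ([:-a, 1:] ^ p * [:-b, 1:] ^ q)"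
  proof (rule poly_ext)
    fix z
    show "poly W z = poly ([:poly W a:] + smult (lead_coeff W) ([:-a, 1:] ^ p * [:-b, 1:] ^ q)) z"
      using Wvalue[OF a0(2), of z] by (simp add: p_def q_def)
  qed
  show False
  proof (cases "q > 0")
    case True
    obtain \<xi> where \<xi>: "order \<xi> (W - [:poly W \<xi>:]) = 2"
      "\<And>s. poly W s = poly W \<xi> \<Longrightarrow> s \<noteq> \<xi> \<Longrightarrow> order s (W - [:poly W \<xi>:]) = 1"
      by (rule two_point_polynomial[OF Wa lcW ab pos True]) (rule that; assumption)
    obtain P' where "P = pcompose P' W" using block_factor_divides[OF bf] by blast
    from no_simple_critical_point[OF bf homK this \<xi>] show False .
  next
    case False
    define p' where "p' = card {x\<in>J. R (b, 0) x \<and> fst x = a}"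
    \<comment> \<open>A class with branches of both kinds would give equal values of
      \<open>W\<close> at \<open>a\<close> and \<open>b\<close>, whereas the class of
      \<open>(a, 0)\<close>, all at \<open>a\<close>, shows them to be different.\<close>
    have "p' = 0"
    proof (rule ccontr)
      assume "p' \<noteq> 0"
      then obtain x where x: "x \<in> J" "R (b, 0) x" "fst x = a"
        unfolding p'_def by (metis (mono_tags, lifting) card.empty ex_in_conv mem_Collect_eq)
      obtain g where g: "g \<in> G" "(b, 0) \<in> g ` K" "x \<in> g ` K" using x(2) unfolding R_def by blast
      have k1: "card {j\<in>J. R x j \<and> fst j = b} > 0"
        using g b0 finite_J by (auto simp: card_gt_0_iff R_def)
      have xC: "x \<in> C" using x by (simp add: C_def)
      have "poly W b = poly W a" using Wvalue[OF xC, of b] k1 x(3) by simp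
      have "poly W b = poly W a + lead_coeff W * (b - a) ^ p"
        using Wvalue[OF a0(2), of b] False by (simp add: p_def q_def)
      then show False using \<open>poly W b = poly W a\<close> lcW ab by simp
    qed
    have pk: "p = degree W" using split[OF a0(2)] False by (simp add: p_def q_def)
    define k where "k = degree W - 2"
    have k: "degree W = Suc (Suc k)" using deg3 by (simp add: k_def)
    have Wa': "W = [:poly W a:] + smult (lead_coeff W) ([:-a, 1:] ^ Suc (Suc k))"
    proof -
      have "[:-a, 1:] ^ p * [:-b, 1:] ^ q = [:-a, 1:] ^ Suc (Suc k)" using False by (simp only: pk k) simp
      from Wa[unfolded this] show ?thesis .
    qed
    have c: "card {x\<in>J. R (b, 0) x \<and> fst x = b} = Suc (Suc k)"
      using split[OF b0(2)] \<open>p' = 0\<close> k by (simp add: p'_def)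
    have Wb': "W = [:poly W b:] + smult (lead_coeff W) ([:-b, 1:] ^ Suc (Suc k))"
    proof (rule poly_ext)
      fix z
      have "card {x\<in>J. R (b, 0) x \<and> fst x = a} = 0" using \<open>p' = 0\<close> by (simp only: p'_def)
      from Wvalue[OF b0(2), of z, unfolded this c]
      show "poly W z = poly ([:poly W b:] + smult (lead_coeff W) ([:-b, 1:] ^ Suc (Suc k))) z"
        by (simp del: power_Suc)
    qed
    have d: "poly (pderiv ([:c:] + smult l ([:-s, 1:] ^ Suc (Suc k)))) z = l * of_nat (Suc (Suc k)) * (z - s) ^ Suc k"
      for c l s z :: complex
      unfolding pderiv_add pderiv_smult pderiv_power_Suc
      by (simp add: pderiv_pCons algebra_simps del: of_nat_Suc)
    \<comment> \<open>One description makes \<open>a\<close> a critical point of \<open>W\<close>,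
      the other makes \<open>b\<close> the only one.\<close>
    have "poly (pderiv W) a = lead_coeff W * of_nat (Suc (Suc k)) * (a - a) ^ Suc k"
      using arg_cong[OF Wa', of "\<lambda>p. poly (pderiv p) a"] unfolding d .
    moreover have "poly (pderiv W) a = lead_coeff W * of_nat (Suc (Suc k)) * (a - b) ^ Suc k"
      using arg_cong[OF Wb', of "\<lambda>p. poly (pderiv p) a"] unfolding d .
    ultimately show False using lcW ab by (simp del: of_nat_Suc)
  qed
qed

end

section \<open>Induction on the degree, and the equivalence\<close>

lemma decomposition_from_moments:
  fixes P Q :: "complex poly"
  assumes "a \<noteq> b" "poly P a = poly P b"
    and "\<And>z. poly P z = poly P a \<Longrightarrow> z \<noteq> a \<Longrightarrow> z \<noteq> b \<Longrightarrow> poly (pderiv P) z \<noteq> 0"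
    and "\<And>k R. pderiv R = P ^ k * pderiv Q \<Longrightarrow> poly R a = poly R b"
  shows "\<exists>P' Q' W. P = pcompose P' W \<and> Q = pcompose Q' W \<and> poly W a = poly W b"
  using assms
proof (induction "degree P" arbitrary: P Q a b rule: less_induct)
  case less
  have degP: "degree P > 0"
  proof (rule ccontr)
    assume "\<not> degree P > 0"
    then obtain c where c: "P = [:c:]" using degree_0_id by (metis neq0_conv)
    \<comment> \<open>A constant \<open>P\<close> would make every third point a forbidden critical
      point.\<close>
    obtain z where "z \<notin> {a, b}" using ex_new_if_finite[OF infinite_UNIV_char_0, of "{a, b}"] by auto
    then show False using less.prems(3)[of z] c by (simp add: pderiv_pCons)
  qed
  obtain \<rho> \<kappa> where "fibre_chart P (poly P a) \<rho> \<kappa>" by (rule fibre_chart_exists[OF degP])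
  then interpret fibre_chart P "poly P a" \<rho> \<kappa> .
  obtain u0 where u0: "u0 \<in> H" using H_nonempty by blast
  interpret critical_fibre P "poly P a" \<rho> \<kappa> Q a b u0
    by unfold_locales (use u0 less.prems in auto)
  show ?case
  proof (cases "\<exists>i\<in>J. \<exists>j\<in>J. i \<noteq> j \<and> (\<forall>m. reach m \<longrightarrow> poly Q (m i) = poly Q (m j))")
    case False
    then interpret separated_fibre P "poly P a" \<rho> \<kappa> Q a b u0
      by unfold_locales blast
    show ?thesis using separated_fibre_inconsistent by blast
  next
    case True
    then obtain i j where "i \<in> J" "j \<in> J" "i \<noteq> j" "\<And>m. reach m \<Longrightarrow> poly Q (m i) = poly Q (m j)" by blast
    then obtain P' Q' W where W: "degree W \<ge> 2" and P': "P = pcompose P' W" and Q': "Q = pcompose Q' W"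
      by (rule decomposition_of_coincidence)
    show ?thesis
    proof (cases "poly W a = poly W b")
      case True
      then show ?thesis using P' Q' by blast
    next
      case False
      have "degree P = degree P' * degree W" by (simp add: P' degree_pcompose)
      moreover from this have "degree P' > 0" using degP by (cases "degree P'") auto
      moreover have "degree P' * 2 \<le> degree P' * degree W" using W by (rule mult_le_mono2)
      ultimately have "degree P' < degree P" by linarith
      moreover have "poly P' (poly W a) = poly P' (poly W b)" using less.prems(2) by (simp add: P' poly_pcompose)
      \<comment> \<open>A critical point \<open>y\<close> of the outer factor would lift through
        \<open>W\<close> to a critical point of \<open>P\<close>, which differs from
        \<open>a\<close> and \<open>b\<close> because \<open>y\<close> differs from their
        images.\<close>
      moreover have "poly (pderiv P') y \<noteq> 0"
        if y: "poly P' y = poly P' (poly W a)" "y \<noteq> poly W a" "y \<noteq> poly W b" for y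
      proof -
        have "\<not> constant (poly (W - [:y:]))" using W by (simp add: constant_degree degree_minus_const)
        then obtain z where z: "poly W z = y"
          using fundamental_theorem_of_algebra[of "W - [:y:]"] by auto
        have "poly (pderiv P) z \<noteq> 0"
          by (rule less.prems(3)) (use y z in \<open>auto simp: P' poly_pcompose\<close>)
        then show ?thesis using z by (simp add: P' pderiv_pcompose poly_pcompose)
      qed
      \<comment> \<open>With moments expressed by antiderivatives, the change of variable is the
        chain rule, and no integration paths have to be compared.\<close>
      moreover have "poly R (poly W a) = poly R (poly W b)" if "pderiv R = P' ^ k * pderiv Q'" for k R
      proof -
        have "pderiv (pcompose R W) = P ^ k * pderiv Q"
          by (simp add: pderiv_pcompose that pcompose_mult P' Q' pcompose_power mult.assoc)
        from less.prems(4)[OF this] show ?thesis by (simp add: poly_pcompose)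
      qed
      ultimately obtain P2 Q2 V where V: "P' = pcompose P2 V" "Q' = pcompose Q2 V"
          "poly V (poly W a) = poly V (poly W b)"
        using less.hyps[of P' "poly W a" "poly W b" Q'] False by blast
      have "P = pcompose P2 (pcompose V W)" "Q = pcompose Q2 (pcompose V W)"
        by (simp_all add: P' Q' V pcompose_assoc)
      moreover have "poly (pcompose V W) a = poly (pcompose V W) b" using V(3) by (simp add: poly_pcompose)
      ultimately show ?thesis by blast
    qed
  qed
qed

lemma contour_integral_pderiv:
  "contour_integral (linepath a b) (\<lambda>z. poly (pderiv R) z) = poly R b - poly R a"
  using contour_integral_primitive[of UNIV "poly R" "poly (pderiv R)" "linepath a b"]
  by (intro contour_integral_unique) (auto intro: poly_DERIV)

theorem corollary3p1:
  fixes P q Q :: "complex poly" and a b c\<^sub>1 :: complex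
  assumes "q \<noteq> 0" and "a \<noteq> b"
    and "pderiv Q = q"
    and "poly P a = c\<^sub>1" and "poly P b = c\<^sub>1"
    and "\<forall>z \<in> poly P -` {c\<^sub>1} - {a, b}. poly (pderiv P) z \<noteq> 0"
  shows "(\<forall>i::nat. contour_integral (linepath a b) (\<lambda>z. poly P z ^ i * poly q z) = 0) \<longleftrightarrow>
         (\<exists>P' Q' W :: complex poly. P = pcompose P' W \<and> Q = pcompose Q' W \<and> poly W a = poly W b)"
proof
  assume int: "\<forall>i::nat. contour_integral (linepath a b) (\<lambda>z. poly P z ^ i * poly q z) = 0"
  show "\<exists>P' Q' W :: complex poly. P = pcompose P' W \<and> Q = pcompose Q' W \<and> poly W a = poly W b"
  proof (rule decomposition_from_moments[OF assms(2)])
    fix k R assume R: "pderiv R = P ^ k * pderiv Q"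
    have "(\<lambda>z. poly P z ^ k * poly q z) = (\<lambda>z. poly (pderiv R) z)"
      by (simp add: R assms(3))
    then show "poly R a = poly R b"
      using int contour_integral_pderiv[of a b R] by (metis eq_iff_diff_eq_0)
  qed (use assms in auto)
next
  assume "\<exists>P' Q' W :: complex poly. P = pcompose P' W \<and> Q = pcompose Q' W \<and> poly W a = poly W b"
  then obtain P' Q' W where W: "P = pcompose P' W" "Q = pcompose Q' W" "poly W a = poly W b" by blast
  show "\<forall>i::nat. contour_integral (linepath a b) (\<lambda>z. poly P z ^ i * poly q z) = 0"
  proof
    fix i
    obtain R where R: "pderiv R = P' ^ i * pderiv Q'" by (rule poly_antiderivative)
    have "pderiv (pcompose R W) = P ^ i * q"
      by (simp add: pderiv_pcompose R pcompose_mult W assms(3)[symmetric] pcompose_power mult.assoc)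
    then have "(\<lambda>z. poly P z ^ i * poly q z) = (\<lambda>z. poly (pderiv (pcompose R W)) z)" by simp
    then show "contour_integral (linepath a b) (\<lambda>z. poly P z ^ i * poly q z) = 0"
      using contour_integral_pderiv[of a b "pcompose R W"] W(3) by (simp add: poly_pcompose)
  qed
qed

end
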